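(* Any Hopf algebra $\mathcal{H}$ in $\mathrm{SupLat}$ has a corresponding group $R(\mathcal{H})$ (called the remnant of $\mathcal{H}$) such that the quotient Hopf algebra $\mathcal{H}/\epsilon^{-1}(\emptyset)$ is isomorphic, as a Hopf algebra, to the group algebra $\mathcal{P}(R(\mathcal{H}))$ of $R(\mathcal{H})$.
   Context: $\mathrm{SupLat}$ is the category whose objects are complete lattices (posets in which every subset $S$ has a join $\vee S$) and whose morphisms are maps preserving arbitrary joins. The least element is denoted $\emptyset$. $\mathcal{L}\otimes\mathcal{M}$ is the complete lattice through which every map $\mathcal{L}\times\mathcal{M}\to\mathcal{K}$ preserving joins separately in each variable factors uniquely as a join-preserving morphism; $(l,m)$ denotes the image of a pair. The unit object is $\mathcal{P}(1)=\{\emptyset,1\}$, and the symmetry is $(l,m)\mapsto(m,l)$. A Hopf algebra in $\mathrm{SupLat}$ is a complete lattice $\mathcal{H}$ with join-preserving morphisms $m:\mathcal{H}\otimes\mathcal{H}\to\mathcal{H}$ (written $a.b$), $\Delta:\mathcal{H}\to\mathcal{H}\otimes\mathcal{H}$, $\epsilon:\mathcal{H}\to\mathcal{P}(1)$, an element $1\in\mathcal{H}$ and an invertible join-preserving morphism $S:\mathcal{H}\to\mathcal{H}$ such that: $m$ is associative with two-sided unit $1$; $(\Delta\otimes\mathrm{id})\Delta=(\mathrm{id}\otimes\Delta)\Delta$ and $(\epsilon\otimes\mathrm{id})\Delta=\mathrm{id}=(\mathrm{id}\otimes\epsilon)\Delta$; $\Delta(1)=(1,1)$, $\epsilon(1)=1$,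 $\epsilon(h.h')=1$ iff $\epsilon(h)=\epsilon(h')=1$, and $\Delta(h.h')=\Delta(h).\Delta(h')$ with componentwise product on $\mathcal{H}\otimes\mathcal{H}$; and $m(\mathrm{id}\otimes S)\Delta(h)=m(S\otimes\mathrm{id})\Delta(h)$ equals $1$ if $\epsilon(h)=1$ and equals $\emptyset$ otherwise. The quotient $\mathcal{Q}=\mathcal{H}/\epsilon^{-1}(\emptyset)$ is the coequalizer $\pi:\mathcal{H}\to\mathcal{Q}$ in $\mathrm{SupLat}$ of the constant morphism $\emptyset$ and the inclusion $\epsilon^{-1}(\emptyset)\rightrightarrows\mathcal{H}$. With $D=\vee\epsilon^{-1}(\emptyset)$, it is the quotient of the set $\mathcal{H}$ by $h\sim h\vee D$, ordered by $\overline{a}\le\overline{b}$ iff $a\vee D\le b\vee D$, with $\pi(h)=\overline{h}$; it has the join-preserving section $\iota(\overline{h})=h\vee D$. Its Hopf algebra structure, which makes $\pi$ a Hopf algebra morphism, is $m'=\pi m(\iota\otimes\iota)$, $\Delta'=(\pi\otimes\pi)\Delta\iota$, $\epsilon'=\epsilon\iota$, $S'=\pi S\iota$, with unit $\overline{1}$. The group algebra of a group $G$ with identity $e$ is the Hopf algebra $\mathcal{P}(G)$ (power set ordered by inclusion) determined on singletons by $\{g\}.\{h\}=\{gh\}$, unit $\{e\}$, $\Delta(\{g\})=(\{g\},\{g\})$, $\epsilon(\{g\})=1$, $S(\{g\})=\{g^{-1}\}$. *)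

theory Defs
  imports "HOL-Algebra.Complete_Lattice" "HOL-Algebra.Coset"
begin

section \<open>The category SupLat\<close>

text \<open>
  Objects are the complete lattices of \<open>HOL-Algebra\<close>, with explicit carriers. A map is only
  relevant on the carrier of its source, so equations between maps are stated on carriers.
\<close>

definition suplat_hom ::
  "('a, 'c) gorder_scheme \<Rightarrow> ('b, 'd) gorder_scheme \<Rightarrow> ('a \<Rightarrow> 'b) set" where
  "suplat_hom L M = {f \<in> carrier L \<rightarrow> carrier M. sup_pres L M f}"

definition suplat_iso ::
  "('a, 'c) gorder_scheme \<Rightarrow> ('b, 'd) gorder_scheme \<Rightarrow> ('a \<Rightarrow> 'b) set" where
  "suplat_iso L M = {f \<in> suplat_hom L M. \<exists>g \<in> suplat_hom M L.
     (\<forall>x \<in> carrier L. g (f x) = x) \<and> (\<forall>y \<in> carrier M. f (g y) = y)}"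

definition bimorphism ::
  "('a, 'd) gorder_scheme \<Rightarrow> ('b, 'e) gorder_scheme \<Rightarrow> ('c, 'f) gorder_scheme \<Rightarrow> ('a \<Rightarrow> 'b \<Rightarrow> 'c) set"
  where
  "bimorphism L M K = {f. (\<forall>l \<in> carrier L. f l \<in> suplat_hom M K) \<and>
                          (\<forall>m \<in> carrier M. (\<lambda>l. f l m) \<in> suplat_hom L K)}"

definition powerset_order :: "'a set \<Rightarrow> 'a set gorder" where
  "powerset_order A = \<lparr>carrier = Pow A, eq = (=), le = (\<subseteq>)\<rparr>"

abbreviation P1 :: "unit set gorder" where
  "P1 \<equiv> powerset_order {()}"

section \<open>The tensor product\<close>

text \<open>
  The tensor product is characterised by its universal property. It is realised here as the
  lattice of those down-closed sets of pairs that are closed under joins in each coordinate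
  separately (empty joins included); the universal property is \<open>tensor_universal\<close> below.
\<close>

definition bi_ideal ::
  "('a, 'c) gorder_scheme \<Rightarrow> ('b, 'd) gorder_scheme \<Rightarrow> ('a \<times> 'b) set \<Rightarrow> bool" where
  "bi_ideal L M U \<longleftrightarrow>
     U \<subseteq> carrier L \<times> carrier M \<and>
     (\<forall>(l, m) \<in> U. \<forall>l' \<in> carrier L. \<forall>m' \<in> carrier M.
        l' \<sqsubseteq>\<^bsub>L\<^esub> l \<longrightarrow> m' \<sqsubseteq>\<^bsub>M\<^esub> m \<longrightarrow> (l', m') \<in> U) \<and>
     (\<forall>A m. A \<subseteq> carrier L \<longrightarrow> m \<in> carrier M \<longrightarrow> A \<times> {m} \<subseteq> U \<longrightarrow> (\<Squnion>\<^bsub>L\<^esub> A, m) \<in> U) \<and>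
     (\<forall>l B. l \<in> carrier L \<longrightarrow> B \<subseteq> carrier M \<longrightarrow> {l} \<times> B \<subseteq> U \<longrightarrow> (l, \<Squnion>\<^bsub>M\<^esub> B) \<in> U)"

definition tensor ::
  "('a, 'c) gorder_scheme \<Rightarrow> ('b, 'd) gorder_scheme \<Rightarrow> ('a \<times> 'b) set gorder" where
  "tensor L M = \<lparr>carrier = {U. bi_ideal L M U}, eq = (=), le = (\<subseteq>)\<rparr>"

text \<open>The image of the pair \<open>(l, m)\<close> in the tensor product.\<close>

definition pure_tensor ::
  "('a, 'c) gorder_scheme \<Rightarrow> ('b, 'd) gorder_scheme \<Rightarrow> 'a \<Rightarrow> 'b \<Rightarrow> ('a \<times> 'b) set" where
  "pure_tensor L M l m = \<Inter> {U. bi_ideal L M U \<and> (l, m) \<in> U}"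

text \<open>
  The join-preserving extension of a bimorphism \<open>f\<close> into \<open>K\<close>: an element \<open>U\<close> of the tensor
  product is the join of the \<open>pure_tensor L M l m\<close> with \<open>(l, m) \<in> U\<close>.
\<close>

definition tensor_lift ::
  "('c, 'd) gorder_scheme \<Rightarrow> ('a \<Rightarrow> 'b \<Rightarrow> 'c) \<Rightarrow> ('a \<times> 'b) set \<Rightarrow> 'c" where
  "tensor_lift K f U = \<Squnion>\<^bsub>K\<^esub> ((\<lambda>(l, m). f l m) ` U)"

lemma suplat_homI:
  assumes "complete_lattice L" "complete_lattice M" "\<And>x. x \<in> carrier L \<Longrightarrow> f x \<in> carrier M"
    and "\<And>A. A \<subseteq> carrier L \<Longrightarrow> f (\<Squnion>\<^bsub>L\<^esub> A) = \<Squnion>\<^bsub>M\<^esub> (f ` A)"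
  shows "f \<in> suplat_hom L M"
  using assms by (simp add: suplat_hom_def sup_pres_def)

lemma suplat_homD:
  assumes "f \<in> suplat_hom L M"
  shows "complete_lattice L" "complete_lattice M" "\<And>x. x \<in> carrier L \<Longrightarrow> f x \<in> carrier M"
    and "\<And>A. A \<subseteq> carrier L \<Longrightarrow> f (\<Squnion>\<^bsub>L\<^esub> A) = \<Squnion>\<^bsub>M\<^esub> (f ` A)"
  using assms by (auto simp: suplat_hom_def sup_pres_def)

lemma (in complete_lattice) sup_eqI:
  assumes "A \<subseteq> carrier L" "s \<in> carrier L" "\<And>x. x \<in> A \<Longrightarrow> x \<sqsubseteq> s"
    and "\<And>y. y \<in> carrier L \<Longrightarrow> (\<And>x. x \<in> A \<Longrightarrow> x \<sqsubseteq> y) \<Longrightarrow> s \<sqsubseteq> y"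
  shows "\<Squnion> A = s"
proof (rule le_antisym)
  show "\<Squnion> A \<sqsubseteq> s" using assms by (intro weak.sup_least) auto
  show "s \<sqsubseteq> \<Squnion> A" using assms weak.sup_upper by (intro assms(4)) auto
qed (use assms in auto)

lemma (in complete_lattice) sup_le_iff:
  assumes "A \<subseteq> carrier L" "y \<in> carrier L"
  shows "\<Squnion> A \<sqsubseteq> y \<longleftrightarrow> (\<forall>x \<in> A. x \<sqsubseteq> y)"
proof
  assume "\<Squnion> A \<sqsubseteq> y"
  show "\<forall>x \<in> A. x \<sqsubseteq> y"
  proof
    fix x assume "x \<in> A"
    then show "x \<sqsubseteq> y"
      using \<open>\<Squnion> A \<sqsubseteq> y\<close> assms weak.sup_upper[OF assms(1)] le_trans[of x "\<Squnion> A" y] by auto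
  qed
qed (use assms in \<open>auto intro: weak.sup_least\<close>)

lemma suplat_hom_mono:
  assumes "f \<in> suplat_hom L M" "x \<in> carrier L" "y \<in> carrier L" "x \<sqsubseteq>\<^bsub>L\<^esub> y"
  shows "f x \<sqsubseteq>\<^bsub>M\<^esub> f y"
proof -
  interpret L: complete_lattice L by (rule suplat_homD(1)[OF assms(1)])
  interpret M: complete_lattice M by (rule suplat_homD(2)[OF assms(1)])
  have "\<Squnion>\<^bsub>L\<^esub> {x, y} = y"
    using assms by (intro L.sup_eqI) auto
  then have "f y = \<Squnion>\<^bsub>M\<^esub> {f x, f y}"
    using suplat_homD(4)[OF assms(1), of "{x, y}"] assms by simp
  then show ?thesis
    using M.weak.sup_upper[of "{f x, f y}" "f x"] suplat_homD(3)[OF assms(1)] assms by auto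
qed

lemma powerset_order_sup:
  assumes "S \<subseteq> Pow A"
  shows "\<Squnion>\<^bsub>powerset_order A\<^esub> S = \<Union> S"
proof -
  interpret complete_lattice "powerset_order A"
    unfolding powerset_order_def by (rule powerset_is_complete_lattice)
  show ?thesis
    using assms by (intro sup_eqI) (simp_all add: powerset_order_def, blast+)
qed

lemma powerset_order_complete: "complete_lattice (powerset_order A)"
  unfolding powerset_order_def by (rule powerset_is_complete_lattice)

lemma bi_idealD:
  assumes "bi_ideal L M U"
  shows "(l, m) \<in> U \<Longrightarrow> l \<in> carrier L" "(l, m) \<in> U \<Longrightarrow> m \<in> carrier M"
    and "\<lbrakk>(l, m) \<in> U; l' \<in> carrier L; m' \<in> carrier M; l' \<sqsubseteq>\<^bsub>L\<^esub> l; m' \<sqsubseteq>\<^bsub>M\<^esub> m\<rbrakk> \<Longrightarrow> (l', m') \<in> U"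
    and "\<lbrakk>A \<subseteq> carrier L; m \<in> carrier M; \<And>a. a \<in> A \<Longrightarrow> (a, m) \<in> U\<rbrakk> \<Longrightarrow> (\<Squnion>\<^bsub>L\<^esub> A, m) \<in> U"
    and "\<lbrakk>l \<in> carrier L; B \<subseteq> carrier M; \<And>b. b \<in> B \<Longrightarrow> (l, b) \<in> U\<rbrakk> \<Longrightarrow> (l, \<Squnion>\<^bsub>M\<^esub> B) \<in> U"
proof -
  note d = assms[unfolded bi_ideal_def]
  show "(l, m) \<in> U \<Longrightarrow> l \<in> carrier L" "(l, m) \<in> U \<Longrightarrow> m \<in> carrier M" using d by auto
  show "\<lbrakk>(l, m) \<in> U; l' \<in> carrier L; m' \<in> carrier M; l' \<sqsubseteq>\<^bsub>L\<^esub> l; m' \<sqsubseteq>\<^bsub>M\<^esub> m\<rbrakk> \<Longrightarrow> (l', m') \<in> U"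
    using d[THEN conjunct2, THEN conjunct1] by auto
  show "\<lbrakk>A \<subseteq> carrier L; m \<in> carrier M; \<And>a. a \<in> A \<Longrightarrow> (a, m) \<in> U\<rbrakk> \<Longrightarrow> (\<Squnion>\<^bsub>L\<^esub> A, m) \<in> U"
    using d[THEN conjunct2, THEN conjunct2, THEN conjunct1, rule_format, of A m] by blast
  show "\<lbrakk>l \<in> carrier L; B \<subseteq> carrier M; \<And>b. b \<in> B \<Longrightarrow> (l, b) \<in> U\<rbrakk> \<Longrightarrow> (l, \<Squnion>\<^bsub>M\<^esub> B) \<in> U"
    using d[THEN conjunct2, THEN conjunct2, THEN conjunct2, rule_format, of l B] by blast
qed

lemma bi_idealI:
  assumes "\<And>l m. (l, m) \<in> U \<Longrightarrow> l \<in> carrier L \<and> m \<in> carrier M"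
    and "\<And>l m l' m'. \<lbrakk>(l, m) \<in> U; l' \<in> carrier L; m' \<in> carrier M; l' \<sqsubseteq>\<^bsub>L\<^esub> l; m' \<sqsubseteq>\<^bsub>M\<^esub> m\<rbrakk>
      \<Longrightarrow> (l', m') \<in> U"
    and "\<And>A m. \<lbrakk>A \<subseteq> carrier L; m \<in> carrier M; \<And>a. a \<in> A \<Longrightarrow> (a, m) \<in> U\<rbrakk> \<Longrightarrow> (\<Squnion>\<^bsub>L\<^esub> A, m) \<in> U"
    and "\<And>l B. \<lbrakk>l \<in> carrier L; B \<subseteq> carrier M; \<And>b. b \<in> B \<Longrightarrow> (l, b) \<in> U\<rbrakk> \<Longrightarrow> (l, \<Squnion>\<^bsub>M\<^esub> B) \<in> U"
  shows "bi_ideal L M U"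
  unfolding bi_ideal_def
proof (intro conjI)
  show "U \<subseteq> carrier L \<times> carrier M" using assms(1) by auto
  show "\<forall>(l, m) \<in> U. \<forall>l' \<in> carrier L. \<forall>m' \<in> carrier M.
        l' \<sqsubseteq>\<^bsub>L\<^esub> l \<longrightarrow> m' \<sqsubseteq>\<^bsub>M\<^esub> m \<longrightarrow> (l', m') \<in> U" using assms(2) by blast
  show "\<forall>A m. A \<subseteq> carrier L \<longrightarrow> m \<in> carrier M \<longrightarrow> A \<times> {m} \<subseteq> U \<longrightarrow> (\<Squnion>\<^bsub>L\<^esub> A, m) \<in> U"
    using assms(3) by blast
  show "\<forall>l B. l \<in> carrier L \<longrightarrow> B \<subseteq> carrier M \<longrightarrow> {l} \<times> B \<subseteq> U \<longrightarrow> (l, \<Squnion>\<^bsub>M\<^esub> B) \<in> U"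
    using assms(4) by blast
qed

lemma bi_ideal_Inter:
  assumes "\<And>U. U \<in> A \<Longrightarrow> bi_ideal L M U" "A \<noteq> {}"
  shows "bi_ideal L M (\<Inter> A)"
proof (rule bi_idealI)
  fix l m assume "(l, m) \<in> \<Inter> A"
  moreover obtain U where "U \<in> A" using assms(2) by auto
  ultimately show "l \<in> carrier L \<and> m \<in> carrier M" using bi_idealD(1,2)[OF assms(1)[of U]] by auto
next
  fix l m l' m'
  assume "(l, m) \<in> \<Inter> A" "l' \<in> carrier L" "m' \<in> carrier M" "l' \<sqsubseteq>\<^bsub>L\<^esub> l" "m' \<sqsubseteq>\<^bsub>M\<^esub> m"
  then show "(l', m') \<in> \<Inter> A" using bi_idealD(3)[OF assms(1), of _ l m l' m'] by auto
next
  fix B m assume "B \<subseteq> carrier L" "m \<in> carrier M" "\<And>a. a \<in> B \<Longrightarrow> (a, m) \<in> \<Inter> A"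
  then show "(\<Squnion>\<^bsub>L\<^esub> B, m) \<in> \<Inter> A" using bi_idealD(4)[OF assms(1), of _ B m] by auto
next
  fix l B assume "l \<in> carrier L" "B \<subseteq> carrier M" "\<And>b. b \<in> B \<Longrightarrow> (l, b) \<in> \<Inter> A"
  then show "(l, \<Squnion>\<^bsub>M\<^esub> B) \<in> \<Inter> A" using bi_idealD(5)[OF assms(1), of _ l B] by auto
qed

context
  fixes L :: "('a, 'c) gorder_scheme" and M :: "('b, 'd) gorder_scheme"
  assumes L: "complete_lattice L" and M: "complete_lattice M"
begin

interpretation L: complete_lattice L by (fact L)
interpretation M: complete_lattice M by (fact M)

lemma bi_ideal_top: "bi_ideal L M (carrier L \<times> carrier M)"
  by (rule bi_idealI) auto

lemma tensor_complete: "complete_lattice (tensor L M)"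
proof -
  interpret partial_order "tensor L M"
    by standard (auto simp: tensor_def)
  show ?thesis
  proof (rule complete_lattice_criterion1)
    show "\<exists>g. greatest (tensor L M) g (carrier (tensor L M))"
      by (rule exI[of _ "carrier L \<times> carrier M"])
        (use bi_ideal_top in \<open>auto simp: greatest_def tensor_def dest: bi_idealD\<close>)
  next
    fix A assume A: "A \<subseteq> carrier (tensor L M)" "A \<noteq> {}"
    have "bi_ideal L M (\<Inter> A)"
      using A by (intro bi_ideal_Inter) (auto simp: tensor_def)
    then show "\<exists>i. is_glb (tensor L M) i A"
      using A by (intro exI[of _ "\<Inter> A"]) (auto simp: greatest_def Lower_def tensor_def)
  qed
qed

lemma pure_tensor_bi_ideal:
  assumes "l \<in> carrier L" "m \<in> carrier M"
  shows "bi_ideal L M (pure_tensor L M l m)"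
  unfolding pure_tensor_def using bi_ideal_top assms by (intro bi_ideal_Inter) auto

lemma pure_tensor_least:
  assumes "bi_ideal L M U"
  shows "pure_tensor L M l m \<subseteq> U \<longleftrightarrow> (l, m) \<in> U"
  using assms unfolding pure_tensor_def by auto

lemma pure_tensor_bimorphism: "pure_tensor L M \<in> bimorphism L M (tensor L M)"
proof -
  interpret T: complete_lattice "tensor L M" by (rule tensor_complete)
  have c: "pure_tensor L M l m \<in> carrier (tensor L M)"
    if "l \<in> carrier L" "m \<in> carrier M" for l m
    using pure_tensor_bi_ideal[OF that] by (simp add: tensor_def)
  have "pure_tensor L M l \<in> suplat_hom M (tensor L M)" if l: "l \<in> carrier L" for l
  proof (rule suplat_homI[OF M tensor_complete])
    fix B assume B: "B \<subseteq> carrier M"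
    have d: "{l} \<times> B \<subseteq> U" if "bi_ideal L M U" "(l, \<Squnion>\<^bsub>M\<^esub> B) \<in> U" for U
      using bi_idealD(3)[OF that] l B M.weak.sup_upper[OF B] by (auto intro!: L.le_refl)
    show "pure_tensor L M l (\<Squnion>\<^bsub>M\<^esub> B) = \<Squnion>\<^bsub>tensor L M\<^esub> (pure_tensor L M l ` B)"
    proof (rule T.sup_eqI[symmetric])
      show "pure_tensor L M l ` B \<subseteq> carrier (tensor L M)" using c l B by auto
      show "pure_tensor L M l (\<Squnion>\<^bsub>M\<^esub> B) \<in> carrier (tensor L M)" using c l B by auto
      fix X assume "X \<in> pure_tensor L M l ` B"
      then show "X \<sqsubseteq>\<^bsub>tensor L M\<^esub> pure_tensor L M l (\<Squnion>\<^bsub>M\<^esub> B)"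
        using d by (auto simp: tensor_def pure_tensor_def)
    next
      fix Y assume Y: "Y \<in> carrier (tensor L M)"
        and le: "\<And>X. X \<in> pure_tensor L M l ` B \<Longrightarrow> X \<sqsubseteq>\<^bsub>tensor L M\<^esub> Y"
      have "(l, b) \<in> Y" if "b \<in> B" for b
        using Y pure_tensor_least[of Y l b] le[OF imageI[OF that]] by (simp add: tensor_def)
      then have "(l, \<Squnion>\<^bsub>M\<^esub> B) \<in> Y"
        using Y l B bi_idealD(5)[of L M Y l B] by (auto simp: tensor_def)
      then show "pure_tensor L M l (\<Squnion>\<^bsub>M\<^esub> B) \<sqsubseteq>\<^bsub>tensor L M\<^esub> Y"
        using Y pure_tensor_least[of Y l] by (simp add: tensor_def)
    qed
  qed (use c l in auto)
  moreover have "(\<lambda>l. pure_tensor L M l m) \<in> suplat_hom L (tensor L M)"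
    if m: "m \<in> carrier M" for m
  proof (rule suplat_homI[OF L tensor_complete])
    fix A assume A: "A \<subseteq> carrier L"
    have d: "A \<times> {m} \<subseteq> U" if "bi_ideal L M U" "(\<Squnion>\<^bsub>L\<^esub> A, m) \<in> U" for U
      using bi_idealD(3)[OF that] m A L.weak.sup_upper[OF A] by (auto intro!: M.le_refl)
    show "pure_tensor L M (\<Squnion>\<^bsub>L\<^esub> A) m = \<Squnion>\<^bsub>tensor L M\<^esub> ((\<lambda>l. pure_tensor L M l m) ` A)"
    proof (rule T.sup_eqI[symmetric])
      show "(\<lambda>l. pure_tensor L M l m) ` A \<subseteq> carrier (tensor L M)" using c m A by auto
      show "pure_tensor L M (\<Squnion>\<^bsub>L\<^esub> A) m \<in> carrier (tensor L M)" using c m A by auto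
      fix X assume "X \<in> (\<lambda>l. pure_tensor L M l m) ` A"
      then show "X \<sqsubseteq>\<^bsub>tensor L M\<^esub> pure_tensor L M (\<Squnion>\<^bsub>L\<^esub> A) m"
        using d by (auto simp: tensor_def pure_tensor_def)
    next
      fix Y assume Y: "Y \<in> carrier (tensor L M)"
        and le: "\<And>X. X \<in> (\<lambda>l. pure_tensor L M l m) ` A \<Longrightarrow> X \<sqsubseteq>\<^bsub>tensor L M\<^esub> Y"
      have "(a, m) \<in> Y" if "a \<in> A" for a
        using Y pure_tensor_least[of Y a m] le[OF imageI[OF that]] by (simp add: tensor_def)
      then have "(\<Squnion>\<^bsub>L\<^esub> A, m) \<in> Y"
        using Y m A bi_idealD(4)[of L M Y A m] by (auto simp: tensor_def)
      then show "pure_tensor L M (\<Squnion>\<^bsub>L\<^esub> A) m \<sqsubseteq>\<^bsub>tensor L M\<^esub> Y"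
        using Y pure_tensor_least[of Y _ m] by (simp add: tensor_def)
    qed
  qed (use c m in auto)
  ultimately show ?thesis by (simp add: bimorphism_def)
qed

lemma tensor_eq_sup_pure:
  assumes "U \<in> carrier (tensor L M)"
  shows "U = \<Squnion>\<^bsub>tensor L M\<^esub> ((\<lambda>(l, m). pure_tensor L M l m) ` U)"
proof -
  interpret T: complete_lattice "tensor L M" by (rule tensor_complete)
  have U: "bi_ideal L M U" "U \<subseteq> carrier L \<times> carrier M"
    using assms by (auto simp: tensor_def bi_ideal_def)
  show ?thesis
  proof (rule T.sup_eqI[symmetric])
    show "(\<lambda>(l, m). pure_tensor L M l m) ` U \<subseteq> carrier (tensor L M)"
      using U pure_tensor_bi_ideal by (auto simp: tensor_def)
    show "U \<in> carrier (tensor L M)" by (fact assms)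
    show "X \<sqsubseteq>\<^bsub>tensor L M\<^esub> U" if "X \<in> (\<lambda>(l, m). pure_tensor L M l m) ` U" for X
      using that pure_tensor_least[OF U(1)] by (force simp: tensor_def)
    show "U \<sqsubseteq>\<^bsub>tensor L M\<^esub> Y" if "Y \<in> carrier (tensor L M)"
      "\<And>X. X \<in> (\<lambda>(l, m). pure_tensor L M l m) ` U \<Longrightarrow> X \<sqsubseteq>\<^bsub>tensor L M\<^esub> Y" for Y
    proof -
      have Y: "bi_ideal L M Y" using that(1) by (simp add: tensor_def)
      have "(l, m) \<in> Y" if "(l, m) \<in> U" for l m
        using pure_tensor_least[OF Y, of l m] \<open>\<And>X. _ \<Longrightarrow> X \<sqsubseteq>\<^bsub>tensor L M\<^esub> Y\<close>[OF imageI[OF that]]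
        by (simp add: tensor_def)
      then show ?thesis by (auto simp: tensor_def)
    qed
  qed
qed

context
  fixes K :: "('e, 'f) gorder_scheme" and f :: "'a \<Rightarrow> 'b \<Rightarrow> 'e"
  assumes K: "complete_lattice K" and f: "f \<in> bimorphism L M K"
begin

interpretation K: complete_lattice K by (fact K)

private lemma f_closed: "l \<in> carrier L \<Longrightarrow> m \<in> carrier M \<Longrightarrow> f l m \<in> carrier K"
  using f suplat_homD(3)[of "f l" M K] unfolding bimorphism_def by auto

private lemma f_sup:
  "l \<in> carrier L \<Longrightarrow> B \<subseteq> carrier M \<Longrightarrow> f l (\<Squnion>\<^bsub>M\<^esub> B) = \<Squnion>\<^bsub>K\<^esub> (f l ` B)"
  "A \<subseteq> carrier L \<Longrightarrow> m \<in> carrier M \<Longrightarrow> f (\<Squnion>\<^bsub>L\<^esub> A) m = \<Squnion>\<^bsub>K\<^esub> ((\<lambda>l. f l m) ` A)"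
  using f suplat_homD(4)[of "f l" M K] suplat_homD(4)[of "\<lambda>l. f l m" L K]
  unfolding bimorphism_def by auto

private lemma bi_ideal_below:
  assumes y: "y \<in> carrier K"
  shows "bi_ideal L M {(l, m). l \<in> carrier L \<and> m \<in> carrier M \<and> f l m \<sqsubseteq>\<^bsub>K\<^esub> y}"
proof (rule bi_idealI, goal_cases)
  case (2 l m l' m')
  have "f l' m' \<sqsubseteq>\<^bsub>K\<^esub> f l m'"
    using f 2 suplat_hom_mono[of "\<lambda>l. f l m'" L K l' l] by (auto simp: bimorphism_def)
  moreover have "f l m' \<sqsubseteq>\<^bsub>K\<^esub> f l m"
    using f 2 suplat_hom_mono[of "f l" M K m' m] by (auto simp: bimorphism_def)
  ultimately have "f l' m' \<sqsubseteq>\<^bsub>K\<^esub> y"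
    using 2 y f_closed K.le_trans[of "f l' m'" "f l m'" "f l m"] K.le_trans[of "f l' m'" "f l m" y]
    by auto
  then show ?case using 2 by auto
next
  case (3 A m)
  then have "\<Squnion>\<^bsub>K\<^esub> ((\<lambda>l. f l m) ` A) \<sqsubseteq>\<^bsub>K\<^esub> y"
    using y f_closed by (intro K.weak.sup_least) auto
  then show ?case using 3 by (simp add: f_sup)
next
  case (4 l B)
  then have "\<Squnion>\<^bsub>K\<^esub> (f l ` B) \<sqsubseteq>\<^bsub>K\<^esub> y"
    using y f_closed by (intro K.weak.sup_least) auto
  then show ?case using 4 by (simp add: f_sup)
qed auto

lemma tensor_lift_closed:
  assumes "U \<subseteq> carrier L \<times> carrier M"
  shows "tensor_lift K f U \<in> carrier K"
  unfolding tensor_lift_def using assms f_closed by (intro K.weak.sup_closed) auto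

lemma tensor_lift_le_iff:
  assumes "U \<subseteq> carrier L \<times> carrier M" "y \<in> carrier K"
  shows "tensor_lift K f U \<sqsubseteq>\<^bsub>K\<^esub> y \<longleftrightarrow> (\<forall>(l, m) \<in> U. f l m \<sqsubseteq>\<^bsub>K\<^esub> y)"
  unfolding tensor_lift_def using assms f_closed by (subst K.sup_le_iff) auto

lemma tensor_lift_pure:
  assumes l: "l \<in> carrier L" and m: "m \<in> carrier M"
  shows "tensor_lift K f (pure_tensor L M l m) = f l m"
proof -
  have s: "pure_tensor L M l m \<subseteq> carrier L \<times> carrier M"
    using pure_tensor_bi_ideal[OF l m] by (simp add: bi_ideal_def)
  have "(l, m) \<in> pure_tensor L M l m" by (auto simp: pure_tensor_def)
  moreover have "tensor_lift K f (pure_tensor L M l m) \<sqsubseteq>\<^bsub>K\<^esub> f l m"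
    using pure_tensor_least[OF bi_ideal_below[OF f_closed[OF l m]], of l m] l m f_closed s
    by (subst tensor_lift_le_iff) auto
  moreover have "f l m \<sqsubseteq>\<^bsub>K\<^esub> tensor_lift K f (pure_tensor L M l m)"
    if "(l, m) \<in> pure_tensor L M l m"
    using tensor_lift_le_iff[OF s tensor_lift_closed[OF s]] that
      K.le_refl[OF tensor_lift_closed[OF s]] by blast
  ultimately show ?thesis
    using tensor_lift_closed[OF s] f_closed l m by (intro K.le_antisym) auto
qed

lemma tensor_lift_hom: "tensor_lift K f \<in> suplat_hom (tensor L M) K"
proof (rule suplat_homI[OF tensor_complete K])
  interpret T: complete_lattice "tensor L M" by (rule tensor_complete)
  have s: "U \<subseteq> carrier L \<times> carrier M" if "U \<in> carrier (tensor L M)" for U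
    using that by (simp add: tensor_def bi_ideal_def)
  show "tensor_lift K f U \<in> carrier K" if "U \<in> carrier (tensor L M)" for U
    using s tensor_lift_closed that by simp
  fix A assume A: "A \<subseteq> carrier (tensor L M)"
  have c: "\<Squnion>\<^bsub>tensor L M\<^esub> A \<in> carrier (tensor L M)" using A by simp
  show "tensor_lift K f (\<Squnion>\<^bsub>tensor L M\<^esub> A) = \<Squnion>\<^bsub>K\<^esub> (tensor_lift K f ` A)"
  proof (rule K.sup_eqI[symmetric])
    show "tensor_lift K f ` A \<subseteq> carrier K" using A s tensor_lift_closed by auto
    show "tensor_lift K f (\<Squnion>\<^bsub>tensor L M\<^esub> A) \<in> carrier K" using c s tensor_lift_closed by simp
  next
    fix x assume "x \<in> tensor_lift K f ` A"
    then obtain U where U: "U \<in> A" "x = tensor_lift K f U" by auto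
    have "U \<subseteq> \<Squnion>\<^bsub>tensor L M\<^esub> A" using T.weak.sup_upper[OF A U(1)] by (simp add: tensor_def)
    moreover have "\<forall>(l, m) \<in> \<Squnion>\<^bsub>tensor L M\<^esub> A. f l m \<sqsubseteq>\<^bsub>K\<^esub> tensor_lift K f (\<Squnion>\<^bsub>tensor L M\<^esub> A)"
      using tensor_lift_le_iff[OF s[OF c] tensor_lift_closed[OF s[OF c]]]
        K.le_refl[OF tensor_lift_closed[OF s[OF c]]] by blast
    moreover have "U \<subseteq> carrier L \<times> carrier M" using U A by (intro s) auto
    ultimately show "x \<sqsubseteq>\<^bsub>K\<^esub> tensor_lift K f (\<Squnion>\<^bsub>tensor L M\<^esub> A)"
      unfolding U(2) using tensor_lift_le_iff[OF _ tensor_lift_closed[OF s[OF c]], of U] by blast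
  next
    fix y assume y: "y \<in> carrier K" and le: "\<And>x. x \<in> tensor_lift K f ` A \<Longrightarrow> x \<sqsubseteq>\<^bsub>K\<^esub> y"
    let ?I = "{(l, m). l \<in> carrier L \<and> m \<in> carrier M \<and> f l m \<sqsubseteq>\<^bsub>K\<^esub> y}"
    have "U \<sqsubseteq>\<^bsub>tensor L M\<^esub> ?I" if U: "U \<in> A" for U
    proof -
      have "tensor_lift K f U \<sqsubseteq>\<^bsub>K\<^esub> y" using le U by simp
      moreover have U': "U \<subseteq> carrier L \<times> carrier M" using U A by (intro s) auto
      ultimately have "\<forall>(l, m) \<in> U. f l m \<sqsubseteq>\<^bsub>K\<^esub> y" using tensor_lift_le_iff[OF U' y] by simp
      then show ?thesis using U' by (auto simp: tensor_def)
    qed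
    then have "\<Squnion>\<^bsub>tensor L M\<^esub> A \<sqsubseteq>\<^bsub>tensor L M\<^esub> ?I"
      using A bi_ideal_below[OF y] by (intro T.weak.sup_least) (simp_all add: tensor_def)
    then have "\<forall>(l, m) \<in> \<Squnion>\<^bsub>tensor L M\<^esub> A. f l m \<sqsubseteq>\<^bsub>K\<^esub> y" by (auto simp: tensor_def)
    then show "tensor_lift K f (\<Squnion>\<^bsub>tensor L M\<^esub> A) \<sqsubseteq>\<^bsub>K\<^esub> y"
      using tensor_lift_le_iff[OF s[OF c] y] by simp
  qed
qed

lemma tensor_lift_unique:
  assumes g: "g \<in> suplat_hom (tensor L M) K"
    and eq: "\<And>l m. l \<in> carrier L \<Longrightarrow> m \<in> carrier M \<Longrightarrow> g (pure_tensor L M l m) = f l m"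
    and U: "U \<in> carrier (tensor L M)"
  shows "g U = tensor_lift K f U"
proof -
  have s: "U \<subseteq> carrier L \<times> carrier M"
    using U by (simp add: tensor_def bi_ideal_def)
  have "g U = g (\<Squnion>\<^bsub>tensor L M\<^esub> ((\<lambda>(l, m). pure_tensor L M l m) ` U))"
    using tensor_eq_sup_pure[OF U] by simp
  also have "\<dots> = \<Squnion>\<^bsub>K\<^esub> (g ` (\<lambda>(l, m). pure_tensor L M l m) ` U)"
    using s pure_tensor_bi_ideal by (intro suplat_homD(4)[OF g]) (auto simp: tensor_def)
  also have "g ` (\<lambda>(l, m). pure_tensor L M l m) ` U = (\<lambda>(l, m). f l m) ` U"
    unfolding image_image using s eq by (intro image_cong) auto
  finally show ?thesis by (simp add: tensor_lift_def)
qed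

end

end

theorem tensor_universal:
  assumes "complete_lattice L" "complete_lattice M"
  shows "complete_lattice (tensor L M)"
    and "pure_tensor L M \<in> bimorphism L M (tensor L M)"
    and "\<And>(K :: ('e, 'f) gorder_scheme) f. complete_lattice K \<Longrightarrow> f \<in> bimorphism L M K \<Longrightarrow>
      tensor_lift K f \<in> suplat_hom (tensor L M) K \<and>
      (\<forall>l \<in> carrier L. \<forall>m \<in> carrier M. tensor_lift K f (pure_tensor L M l m) = f l m) \<and>
      (\<forall>g \<in> suplat_hom (tensor L M) K.
         (\<forall>l \<in> carrier L. \<forall>m \<in> carrier M. g (pure_tensor L M l m) = f l m) \<longrightarrow>
         (\<forall>U \<in> carrier (tensor L M). g U = tensor_lift K f U))"
proof -
  show "complete_lattice (tensor L M)" "pure_tensor L M \<in> bimorphism L M (tensor L M)"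
    by (rule tensor_complete[OF assms], rule pure_tensor_bimorphism[OF assms])
  fix K :: "('e, 'f) gorder_scheme" and f assume Kf: "complete_lattice K" "f \<in> bimorphism L M K"
  show "tensor_lift K f \<in> suplat_hom (tensor L M) K \<and>
      (\<forall>l \<in> carrier L. \<forall>m \<in> carrier M. tensor_lift K f (pure_tensor L M l m) = f l m) \<and>
      (\<forall>g \<in> suplat_hom (tensor L M) K.
         (\<forall>l \<in> carrier L. \<forall>m \<in> carrier M. g (pure_tensor L M l m) = f l m) \<longrightarrow>
         (\<forall>U \<in> carrier (tensor L M). g U = tensor_lift K f U))"
  proof (intro conjI ballI impI)
    fix g U
    assume "g \<in> suplat_hom (tensor L M) K" "U \<in> carrier (tensor L M)"
      and "\<forall>l \<in> carrier L. \<forall>m \<in> carrier M. g (pure_tensor L M l m) = f l m"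
    then show "g U = tensor_lift K f U" by (intro tensor_lift_unique[OF assms Kf]) auto
  qed (fact tensor_lift_hom[OF assms Kf], rule tensor_lift_pure[OF assms Kf])
qed

text \<open>
  All structure maps of the monoidal category are given by the images of pairs:
  \<open>(l, m) \<mapsto> (f l, g m)\<close>, \<open>((l, m), n) \<mapsto> (l, (m, n))\<close>, and \<open>(1, l) \<mapsto> l\<close>, \<open>(l, 1) \<mapsto> l\<close>.
\<close>

definition tensor_map ::
  "('c, 'e) gorder_scheme \<Rightarrow> ('d, 'f) gorder_scheme \<Rightarrow> ('a \<Rightarrow> 'c) \<Rightarrow> ('b \<Rightarrow> 'd) \<Rightarrow>
    ('a \<times> 'b) set \<Rightarrow> ('c \<times> 'd) set" where
  "tensor_map L' M' f g = tensor_lift (tensor L' M') (\<lambda>l m. pure_tensor L' M' (f l) (g m))"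

definition tensor_assoc ::
  "('a, 'd) gorder_scheme \<Rightarrow> ('b, 'e) gorder_scheme \<Rightarrow> ('c, 'f) gorder_scheme \<Rightarrow>
    (('a \<times> 'b) set \<times> 'c) set \<Rightarrow> ('a \<times> ('b \<times> 'c) set) set" where
  "tensor_assoc L M N =
     tensor_lift (tensor L (tensor M N)) (\<lambda>t n.
       tensor_lift (tensor L (tensor M N)) (\<lambda>l m.
         pure_tensor L (tensor M N) l (pure_tensor M N m n)) t)"

definition left_unitor :: "('a, 'c) gorder_scheme \<Rightarrow> (unit set \<times> 'a) set \<Rightarrow> 'a" where
  "left_unitor L = tensor_lift L (\<lambda>x l. if x = {} then \<bottom>\<^bsub>L\<^esub> else l)"

definition right_unitor :: "('a, 'c) gorder_scheme \<Rightarrow> ('a \<times> unit set) set \<Rightarrow> 'a" where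
  "right_unitor L = tensor_lift L (\<lambda>l x. if x = {} then \<bottom>\<^bsub>L\<^esub> else l)"

lemma suplat_hom_comp:
  assumes "f \<in> suplat_hom L M" "g \<in> suplat_hom M K"
  shows "(\<lambda>x. g (f x)) \<in> suplat_hom L K"
proof (rule suplat_homI)
  fix A assume A: "A \<subseteq> carrier L"
  then have "f ` A \<subseteq> carrier M" using suplat_homD(3)[OF assms(1)] by auto
  then show "g (f (\<Squnion>\<^bsub>L\<^esub> A)) = \<Squnion>\<^bsub>K\<^esub> ((\<lambda>x. g (f x)) ` A)"
    using suplat_homD(4)[OF assms(1) A] suplat_homD(4)[OF assms(2), of "f ` A"]
    by (simp add: image_image)
qed (use suplat_homD(1)[OF assms(1)] suplat_homD(2)[OF assms(2)]
      suplat_homD(3)[OF assms(1)] suplat_homD(3)[OF assms(2)] in auto)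

lemma suplat_hom_id: "complete_lattice L \<Longrightarrow> id \<in> suplat_hom L L"
  by (rule suplat_homI) auto

lemma bimorphismD:
  assumes "f \<in> bimorphism L M K"
  shows "l \<in> carrier L \<Longrightarrow> f l \<in> suplat_hom M K" "m \<in> carrier M \<Longrightarrow> (\<lambda>l. f l m) \<in> suplat_hom L K"
  using assms by (auto simp: bimorphism_def)

lemma bimorphismI:
  assumes "\<And>l. l \<in> carrier L \<Longrightarrow> f l \<in> suplat_hom M K" "\<And>m. m \<in> carrier M \<Longrightarrow> (\<lambda>l. f l m) \<in> suplat_hom L K"
  shows "f \<in> bimorphism L M K"
  using assms by (auto simp: bimorphism_def)

lemma tensor_map_bim:
  assumes f: "f \<in> suplat_hom L L'" and g: "g \<in> suplat_hom M M'"
  shows "(\<lambda>l m. pure_tensor L' M' (f l) (g m)) \<in> bimorphism L M (tensor L' M')"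
proof -
  note p = pure_tensor_bimorphism[OF suplat_homD(2)[OF f] suplat_homD(2)[OF g]]
  show ?thesis
  proof (rule bimorphismI)
    fix l assume "l \<in> carrier L"
    then show "(\<lambda>m. pure_tensor L' M' (f l) (g m)) \<in> suplat_hom M (tensor L' M')"
      by (intro suplat_hom_comp[OF g] bimorphismD(1)[OF p] suplat_homD(3)[OF f])
  next
    fix m assume "m \<in> carrier M"
    then show "(\<lambda>l. pure_tensor L' M' (f l) (g m)) \<in> suplat_hom L (tensor L' M')"
      by (intro suplat_hom_comp[OF f bimorphismD(2)[OF p]] suplat_homD(3)[OF g])
  qed
qed

lemma tensor_map_props:
  assumes f: "f \<in> suplat_hom L L'" and g: "g \<in> suplat_hom M M'"
  shows "tensor_map L' M' f g \<in> suplat_hom (tensor L M) (tensor L' M')"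
    and "l \<in> carrier L \<Longrightarrow> m \<in> carrier M \<Longrightarrow>
      tensor_map L' M' f g (pure_tensor L M l m) = pure_tensor L' M' (f l) (g m)"
proof -
  note c = suplat_homD(1)[OF f] suplat_homD(1)[OF g]
    tensor_complete[OF suplat_homD(2)[OF f] suplat_homD(2)[OF g]] tensor_map_bim[OF f g]
  show "tensor_map L' M' f g \<in> suplat_hom (tensor L M) (tensor L' M')"
    unfolding tensor_map_def by (rule tensor_lift_hom[OF c])
  show "l \<in> carrier L \<Longrightarrow> m \<in> carrier M \<Longrightarrow>
      tensor_map L' M' f g (pure_tensor L M l m) = pure_tensor L' M' (f l) (g m)"
    unfolding tensor_map_def by (rule tensor_lift_pure[OF c])
qed

lemma tensor_sub: "U \<in> carrier (tensor L M) \<Longrightarrow> U \<subseteq> carrier L \<times> carrier M"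
  by (simp add: tensor_def bi_ideal_def)

lemma tensor_lift_param:
  assumes L: "complete_lattice L" and M: "complete_lattice M" and N: "complete_lattice N"
    and K: "complete_lattice K"
    and F: "\<And>n. n \<in> carrier N \<Longrightarrow> F n \<in> bimorphism L M K"
    and F': "\<And>l m. l \<in> carrier L \<Longrightarrow> m \<in> carrier M \<Longrightarrow> (\<lambda>n. F n l m) \<in> suplat_hom N K"
    and U: "U \<in> carrier (tensor L M)"
  shows "(\<lambda>n. tensor_lift K (F n) U) \<in> suplat_hom N K"
proof (rule suplat_homI[OF N K])
  interpret N: complete_lattice N by (fact N)
  interpret K: complete_lattice K by (fact K)
  note s = tensor_sub[OF U]
  show cl: "tensor_lift K (F n) U \<in> carrier K" if "n \<in> carrier N" for n
    by (rule tensor_lift_closed[OF L M K F[OF that] s])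
  fix A assume A: "A \<subseteq> carrier N"
  then have sA: "\<Squnion>\<^bsub>N\<^esub> A \<in> carrier N" by simp
  note le = tensor_lift_le_iff[OF L M K F s]
  have key: "(\<forall>(l, m) \<in> U. F (\<Squnion>\<^bsub>N\<^esub> A) l m \<sqsubseteq>\<^bsub>K\<^esub> y) \<longleftrightarrow> (\<forall>n \<in> A. \<forall>(l, m) \<in> U. F n l m \<sqsubseteq>\<^bsub>K\<^esub> y)"
    if y: "y \<in> carrier K" for y
  proof -
    have "F (\<Squnion>\<^bsub>N\<^esub> A) l m \<sqsubseteq>\<^bsub>K\<^esub> y \<longleftrightarrow> (\<forall>n \<in> A. F n l m \<sqsubseteq>\<^bsub>K\<^esub> y)" if "(l, m) \<in> U" for l m
    proof -
      have lm: "l \<in> carrier L" "m \<in> carrier M" using that s by auto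
      show ?thesis
        using suplat_homD(4)[OF F'[OF lm] A] suplat_homD(3)[OF F'[OF lm]] A y
        by (subst suplat_homD(4)[OF F'[OF lm] A], subst K.sup_le_iff) auto
    qed
    then show ?thesis by fast
  qed
  show "tensor_lift K (F (\<Squnion>\<^bsub>N\<^esub> A)) U = \<Squnion>\<^bsub>K\<^esub> ((\<lambda>n. tensor_lift K (F n) U) ` A)"
  proof (rule K.sup_eqI[symmetric])
    show "(\<lambda>n. tensor_lift K (F n) U) ` A \<subseteq> carrier K" using A cl by auto
    show "tensor_lift K (F (\<Squnion>\<^bsub>N\<^esub> A)) U \<in> carrier K" by (rule cl[OF sA])
    fix x assume "x \<in> (\<lambda>n. tensor_lift K (F n) U) ` A"
    then obtain n where n: "n \<in> A" "x = tensor_lift K (F n) U" by auto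
    have "\<forall>(l, m) \<in> U. F n l m \<sqsubseteq>\<^bsub>K\<^esub> tensor_lift K (F (\<Squnion>\<^bsub>N\<^esub> A)) U"
      using key[OF cl[OF sA]] le[OF sA cl[OF sA]] K.le_refl[OF cl[OF sA]] n(1) by simp
    then show "x \<sqsubseteq>\<^bsub>K\<^esub> tensor_lift K (F (\<Squnion>\<^bsub>N\<^esub> A)) U"
      using le[of n, OF _ cl[OF sA]] n A by auto
  next
    fix y assume y: "y \<in> carrier K" and h: "\<And>x. x \<in> (\<lambda>n. tensor_lift K (F n) U) ` A \<Longrightarrow> x \<sqsubseteq>\<^bsub>K\<^esub> y"
    have "\<forall>(l, m) \<in> U. F n l m \<sqsubseteq>\<^bsub>K\<^esub> y" if n: "n \<in> A" for n
      using le[of n, OF _ y] h[OF imageI[OF n]] n A by auto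
    then show "tensor_lift K (F (\<Squnion>\<^bsub>N\<^esub> A)) U \<sqsubseteq>\<^bsub>K\<^esub> y"
      using le[OF sA y] key[OF y] by simp
  qed
qed

lemma tensor_assoc_props:
  assumes L: "complete_lattice L" and M: "complete_lattice M" and N: "complete_lattice N"
  shows "tensor_assoc L M N \<in> suplat_hom (tensor (tensor L M) N) (tensor L (tensor M N))"
    and "l \<in> carrier L \<Longrightarrow> m \<in> carrier M \<Longrightarrow> n \<in> carrier N \<Longrightarrow>
     tensor_assoc L M N (pure_tensor (tensor L M) N (pure_tensor L M l m) n) =
     pure_tensor L (tensor M N) l (pure_tensor M N m n)"
proof -
  let ?T = "tensor L (tensor M N)"
  note LM = tensor_complete[OF L M] and MN = tensor_complete[OF M N]
  note T = tensor_complete[OF L MN]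
  note p = pure_tensor_bimorphism[OF M N] and q = pure_tensor_bimorphism[OF L MN]
  have 1: "(\<lambda>l m. pure_tensor L (tensor M N) l (pure_tensor M N m n)) \<in> bimorphism L M ?T"
    if n: "n \<in> carrier N" for n
  proof (rule bimorphismI)
    fix l assume "l \<in> carrier L"
    then show "(\<lambda>m. pure_tensor L (tensor M N) l (pure_tensor M N m n)) \<in> suplat_hom M ?T"
      by (intro suplat_hom_comp[OF bimorphismD(2)[OF p n] bimorphismD(1)[OF q]])
  next
    fix m assume "m \<in> carrier M"
    then show "(\<lambda>l. pure_tensor L (tensor M N) l (pure_tensor M N m n)) \<in> suplat_hom L ?T"
      by (intro bimorphismD(2)[OF q] suplat_homD(3)[OF bimorphismD(1)[OF p]] n)
  qed
  have 2: "(\<lambda>n. pure_tensor L (tensor M N) l (pure_tensor M N m n)) \<in> suplat_hom N ?T"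
    if "l \<in> carrier L" "m \<in> carrier M" for l m
    by (intro suplat_hom_comp[OF bimorphismD(1)[OF p] bimorphismD(1)[OF q]] that)
  have 3: "(\<lambda>t n. tensor_lift ?T (\<lambda>l m. pure_tensor L (tensor M N) l (pure_tensor M N m n)) t)
     \<in> bimorphism (tensor L M) N ?T"
    by (intro bimorphismI tensor_lift_param[OF L M N T] tensor_lift_hom[OF L M T] 1 2)
  show "tensor_assoc L M N \<in> suplat_hom (tensor (tensor L M) N) ?T"
    unfolding tensor_assoc_def by (rule tensor_lift_hom[OF LM N T 3])
  assume l: "l \<in> carrier L" and m: "m \<in> carrier M" and n: "n \<in> carrier N"
  have "pure_tensor L M l m \<in> carrier (tensor L M)"
    using pure_tensor_bi_ideal[OF L M l m] by (simp add: tensor_def)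
  then show "tensor_assoc L M N (pure_tensor (tensor L M) N (pure_tensor L M l m) n) =
     pure_tensor L (tensor M N) l (pure_tensor M N m n)"
    unfolding tensor_assoc_def using n
    by (simp add: tensor_lift_pure[OF LM N T 3] tensor_lift_pure[OF L M T 1[OF n] l m])
qed

lemma same_order:
  assumes "carrier L = carrier M" "eq L = eq M" "le L = le M"
  shows "\<Squnion>\<^bsub>L\<^esub> A = \<Squnion>\<^bsub>M\<^esub> A" "complete_lattice L = complete_lattice M" "\<bottom>\<^bsub>L\<^esub> = \<bottom>\<^bsub>M\<^esub>"
  unfolding Lattice.sup_def complete_lattice_def complete_lattice_axioms_def partial_order_def
    partial_order_axioms_def weak_partial_order_def weak_partial_order_axioms_def equivalence_def
    Upper_def Lower_def least_def greatest_def Order.bottom_def assms by simp_all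

section \<open>Hopf algebras in SupLat\<close>

record 'a hopf = "'a gorder" +
  hprod :: "('a \<times> 'a) set \<Rightarrow> 'a"
  hunit :: 'a
  coprod :: "'a \<Rightarrow> ('a \<times> 'a) set"
  counit :: "'a \<Rightarrow> unit set"
  antipode :: "'a \<Rightarrow> 'a"

definition hmult :: "('a, 'm) hopf_scheme \<Rightarrow> 'a \<Rightarrow> 'a \<Rightarrow> 'a" where
  "hmult H a b = hprod H (pure_tensor H H a b)"

text \<open>
  The componentwise product on \<open>tensor H H\<close>, i.e. the extension of
  \<open>((a, b), (c, d)) \<mapsto> (a.c, b.d)\<close> that preserves joins in each of its two arguments.
\<close>

definition tensor_mult ::
  "('a, 'm) hopf_scheme \<Rightarrow> ('a \<times> 'a) set \<Rightarrow> ('a \<times> 'a) set \<Rightarrow> ('a \<times> 'a) set" where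
  "tensor_mult H U V =
     tensor_lift (tensor H H) (\<lambda>a b.
       tensor_lift (tensor H H) (\<lambda>c d. pure_tensor H H (hmult H a c) (hmult H b d)) V) U"

locale suplat_hopf =
  fixes H :: "('a, 'm) hopf_scheme" (structure)
  assumes complete: "complete_lattice H"
    and prod_hom: "hprod H \<in> suplat_hom (tensor H H) H"
    and unit_closed: "hunit H \<in> carrier H"
    and coprod_hom: "coprod H \<in> suplat_hom H (tensor H H)"
    and counit_hom: "counit H \<in> suplat_hom H P1"
    and antipode_iso: "antipode H \<in> suplat_iso H H"
    and prod_assoc: "\<lbrakk>a \<in> carrier H; b \<in> carrier H; c \<in> carrier H\<rbrakk> \<Longrightarrow>
      hmult H (hmult H a b) c = hmult H a (hmult H b c)"
    and prod_unit: "a \<in> carrier H \<Longrightarrow> hmult H (hunit H) a = a"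
      "a \<in> carrier H \<Longrightarrow> hmult H a (hunit H) = a"
    and coassoc: "h \<in> carrier H \<Longrightarrow>
      tensor_assoc H H H (tensor_map (tensor H H) H (coprod H) id (coprod H h)) =
      tensor_map H (tensor H H) id (coprod H) (coprod H h)"
    and counit: "h \<in> carrier H \<Longrightarrow> left_unitor H (tensor_map P1 H (counit H) id (coprod H h)) = h"
      "h \<in> carrier H \<Longrightarrow> right_unitor H (tensor_map H P1 id (counit H) (coprod H h)) = h"
    and coprod_unit: "coprod H (hunit H) = pure_tensor H H (hunit H) (hunit H)"
    and counit_unit: "counit H (hunit H) = {()}"
    and counit_prod: "\<lbrakk>h \<in> carrier H; h' \<in> carrier H\<rbrakk> \<Longrightarrow>
      counit H (hmult H h h') = {()} \<longleftrightarrow> counit H h = {()} \<and> counit H h' = {()}"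
    and coprod_prod: "\<lbrakk>h \<in> carrier H; h' \<in> carrier H\<rbrakk> \<Longrightarrow>
      coprod H (hmult H h h') = tensor_mult H (coprod H h) (coprod H h')"
    and antipode_right: "h \<in> carrier H \<Longrightarrow>
      hprod H (tensor_map H H id (antipode H) (coprod H h)) =
      (if counit H h = {()} then hunit H else \<bottom>\<^bsub>H\<^esub>)"
    and antipode_left: "h \<in> carrier H \<Longrightarrow>
      hprod H (tensor_map H H (antipode H) id (coprod H h)) =
      (if counit H h = {()} then hunit H else \<bottom>\<^bsub>H\<^esub>)"

definition hopf_hom ::
  "('a, 'm) hopf_scheme \<Rightarrow> ('b, 'n) hopf_scheme \<Rightarrow> ('a \<Rightarrow> 'b) set" where
  "hopf_hom H K = {f \<in> suplat_hom H K.
     (\<forall>t \<in> carrier (tensor H H). f (hprod H t) = hprod K (tensor_map K K f f t)) \<and>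
     f (hunit H) = hunit K \<and>
     (\<forall>h \<in> carrier H. coprod K (f h) = tensor_map K K f f (coprod H h)) \<and>
     (\<forall>h \<in> carrier H. counit K (f h) = counit H h) \<and>
     (\<forall>h \<in> carrier H. antipode K (f h) = f (antipode H h))}"

definition hopf_isomorphic :: "('a, 'm) hopf_scheme \<Rightarrow> ('b, 'n) hopf_scheme \<Rightarrow> bool" where
  "hopf_isomorphic H K \<longleftrightarrow> suplat_hopf H \<and> suplat_hopf K \<and>
     (\<exists>f \<in> hopf_hom H K. \<exists>g \<in> hopf_hom K H.
        (\<forall>x \<in> carrier H. g (f x) = x) \<and> (\<forall>y \<in> carrier K. f (g y) = y))"

section \<open>The quotient by the kernel of the counit\<close>

definition kernel_top :: "('a, 'm) hopf_scheme \<Rightarrow> 'a" where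
  "kernel_top H = \<Squnion>\<^bsub>H\<^esub> {h \<in> carrier H. counit H h = {}}"

definition quot_rel :: "('a, 'm) hopf_scheme \<Rightarrow> ('a \<times> 'a) set" where
  "quot_rel H = {(h, h'). h \<in> carrier H \<and> h' \<in> carrier H \<and>
     h \<squnion>\<^bsub>H\<^esub> kernel_top H = h' \<squnion>\<^bsub>H\<^esub> kernel_top H}"

definition quot_proj :: "('a, 'm) hopf_scheme \<Rightarrow> 'a \<Rightarrow> 'a set" where
  "quot_proj H h = quot_rel H `` {h}"

text \<open>The section sends the class of \<open>h\<close> to \<open>h \<squnion> kernel_top H\<close>, cf. \<open>quot_section_proj\<close>.\<close>

definition quot_section :: "('a, 'm) hopf_scheme \<Rightarrow> 'a set \<Rightarrow> 'a" where
  "quot_section H X = the_elem ((\<lambda>h. h \<squnion>\<^bsub>H\<^esub> kernel_top H) ` X)"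

definition quot_lattice :: "('a, 'm) hopf_scheme \<Rightarrow> 'a set gorder" where
  "quot_lattice H = \<lparr>carrier = carrier H // quot_rel H, eq = (=),
     le = (\<lambda>X Y. quot_section H X \<sqsubseteq>\<^bsub>H\<^esub> quot_section H Y)\<rparr>"

definition quot_hopf :: "('a, 'm) hopf_scheme \<Rightarrow> 'a set hopf" where
  "quot_hopf H = (let Q = quot_lattice H; \<pi> = quot_proj H; \<iota> = quot_section H in
     \<lparr>carrier = carrier Q, eq = eq Q, le = le Q,
      hprod = \<pi> \<circ> hprod H \<circ> tensor_map H H \<iota> \<iota>,
      hunit = \<pi> (hunit H),
      coprod = tensor_map Q Q \<pi> \<pi> \<circ> coprod H \<circ> \<iota>,
      counit = counit H \<circ> \<iota>,
      antipode = \<pi> \<circ> antipode H \<circ> \<iota>\<rparr>)"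

text \<open>The map \<open>quot_proj H\<close> is the coequalizer of the constant map and the inclusion of the kernel.\<close>

context suplat_hopf
begin

context
begin

interpretation L: complete_lattice H by (fact complete)

private abbreviation (input) "D \<equiv> kernel_top H"

private lemma D: "D \<in> carrier H"
  unfolding kernel_top_def by (rule L.weak.sup_closed) auto

private lemma join_D: "h \<in> carrier H \<Longrightarrow> h \<squnion> D \<in> carrier H"
  using D by simp

private lemma proj_in: "h \<in> carrier H \<Longrightarrow> quot_proj H h \<in> carrier (quot_lattice H)"
  by (simp add: quot_proj_def quot_lattice_def quotientI)

lemma quot_section_proj: "h \<in> carrier H \<Longrightarrow> quot_section H (quot_proj H h) = h \<squnion> D"
proof -
  assume h: "h \<in> carrier H"
  then have "h \<in> quot_proj H h" by (simp add: quot_proj_def quot_rel_def)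
  moreover have "k \<squnion> D = h \<squnion> D" if "k \<in> quot_proj H h" for k
    using that by (simp add: quot_proj_def quot_rel_def)
  ultimately have "(\<lambda>h. h \<squnion> D) ` quot_proj H h = {h \<squnion> D}"
    by (metis (no_types, lifting) image_cong image_constant)
  then show ?thesis by (simp add: quot_section_def)
qed

lemma quot_le_iff: "\<lbrakk>a \<in> carrier H; b \<in> carrier H\<rbrakk> \<Longrightarrow>
    quot_proj H a \<sqsubseteq>\<^bsub>quot_lattice H\<^esub> quot_proj H b \<longleftrightarrow> a \<squnion> D \<sqsubseteq> b \<squnion> D"
  by (simp add: quot_lattice_def quot_section_proj)

private lemma carrier_cases:
  assumes "X \<in> carrier (quot_lattice H)"
  obtains h where "h \<in> carrier H" "X = quot_proj H h"
  using assms by (auto simp: quot_lattice_def quot_proj_def elim: quotientE)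

private lemma proj_eq_iff: "\<lbrakk>a \<in> carrier H; b \<in> carrier H\<rbrakk> \<Longrightarrow>
    quot_proj H a = quot_proj H b \<longleftrightarrow> a \<squnion> D = b \<squnion> D"
  using quot_section_proj[of a] quot_section_proj[of b]
  by (auto simp: quot_proj_def quot_rel_def)

private lemma quot_is_sup:
  assumes A: "A \<subseteq> carrier H"
  shows "least (quot_lattice H) (quot_proj H (\<Squnion> A)) (Upper (quot_lattice H) (quot_proj H ` A))"
proof -
  have sA: "\<Squnion> A \<in> carrier H" using A by simp
  have iff: "\<Squnion> A \<sqsubseteq> y \<squnion> D \<longleftrightarrow> (\<forall>a \<in> A. a \<sqsubseteq> y \<squnion> D)" if "y \<in> carrier H" for y
    by (rule L.sup_le_iff[OF A join_D[OF that]])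
  have j: "a \<squnion> D \<sqsubseteq> y \<squnion> D \<longleftrightarrow> a \<sqsubseteq> y \<squnion> D" if "a \<in> carrier H" "y \<in> carrier H" for a y
  proof
    show "a \<squnion> D \<sqsubseteq> y \<squnion> D \<Longrightarrow> a \<sqsubseteq> y \<squnion> D"
      using L.le_trans[OF L.join_left[OF that(1) D] _ that(1) join_D[OF that(1)] join_D[OF that(2)]] .
    show "a \<sqsubseteq> y \<squnion> D \<Longrightarrow> a \<squnion> D \<sqsubseteq> y \<squnion> D"
      by (rule L.join_le[OF _ L.join_right[OF that(2) D] that(1) D join_D[OF that(2)]])
  qed
  show ?thesis
  proof (rule least_UpperI)
    fix X assume "X \<in> quot_proj H ` A"
    then obtain a where a: "a \<in> A" "X = quot_proj H a" by auto
    have "\<Squnion> A \<sqsubseteq> \<Squnion> A \<squnion> D" using sA D by (intro L.join_left)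
    then show "X \<sqsubseteq>\<^bsub>quot_lattice H\<^esub> quot_proj H (\<Squnion> A)"
      using a A sA iff[OF sA] j[of a "\<Squnion> A"] quot_le_iff[of a "\<Squnion> A"] by auto
  next
    fix Y assume Y: "Y \<in> Upper (quot_lattice H) (quot_proj H ` A)"
    then have "Y \<in> carrier (quot_lattice H)" by (simp add: Upper_def)
    then obtain y where y: "y \<in> carrier H" "Y = quot_proj H y" by (rule carrier_cases)
    have "a \<sqsubseteq> y \<squnion> D" if "a \<in> A" for a
    proof -
      have "quot_proj H a \<sqsubseteq>\<^bsub>quot_lattice H\<^esub> Y"
        using Y that A proj_in by (auto simp: Upper_def)
      then show ?thesis using j[of a y] quot_le_iff[of a y] that A y by auto
    qed
    then have "\<Squnion> A \<sqsubseteq> y \<squnion> D" using iff[OF y(1)] by simp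
    then show "quot_proj H (\<Squnion> A) \<sqsubseteq>\<^bsub>quot_lattice H\<^esub> Y"
      using j[OF sA y(1)] quot_le_iff[OF sA y(1)] y(2) by simp
  qed (use A sA proj_in in auto)
qed

private lemma quot_lift_set:
  assumes "S \<subseteq> carrier (quot_lattice H)"
  obtains A where "A \<subseteq> carrier H" "S = quot_proj H ` A"
proof
  show "{h \<in> carrier H. quot_proj H h \<in> S} \<subseteq> carrier H" by auto
  show "S = quot_proj H ` {h \<in> carrier H. quot_proj H h \<in> S}"
  proof
    show "S \<subseteq> quot_proj H ` {h \<in> carrier H. quot_proj H h \<in> S}"
    proof
      fix X assume X: "X \<in> S"
      obtain h where "h \<in> carrier H" "X = quot_proj H h"
        by (rule carrier_cases[OF subsetD[OF assms X]])
      then show "X \<in> quot_proj H ` {h \<in> carrier H. quot_proj H h \<in> S}" using X by auto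
    qed
  qed auto
qed

lemma quot_lattice_complete: "complete_lattice (quot_lattice H)"
proof -
  interpret Q: partial_order "quot_lattice H"
  proof
    fix X Y assume "X \<in> carrier (quot_lattice H)" "Y \<in> carrier (quot_lattice H)"
      and le: "X \<sqsubseteq>\<^bsub>quot_lattice H\<^esub> Y" "Y \<sqsubseteq>\<^bsub>quot_lattice H\<^esub> X"
    then obtain a b where ab: "a \<in> carrier H" "X = quot_proj H a" "b \<in> carrier H" "Y = quot_proj H b"
      by (metis carrier_cases)
    then have "a \<squnion> D = b \<squnion> D"
      using le quot_le_iff join_D by (intro L.le_antisym) auto
    then show "X .=\<^bsub>quot_lattice H\<^esub> Y"
      using ab proj_eq_iff by (simp add: quot_lattice_def)
  next
    fix X assume "X \<in> carrier (quot_lattice H)"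
    then obtain a where "a \<in> carrier H" "X = quot_proj H a" by (rule carrier_cases)
    then show "X \<sqsubseteq>\<^bsub>quot_lattice H\<^esub> X" using quot_le_iff join_D L.le_refl by auto
  next
    fix X Y Z assume "X \<in> carrier (quot_lattice H)" "Y \<in> carrier (quot_lattice H)" "Z \<in> carrier (quot_lattice H)"
      and le: "X \<sqsubseteq>\<^bsub>quot_lattice H\<^esub> Y" "Y \<sqsubseteq>\<^bsub>quot_lattice H\<^esub> Z"
    then obtain a b c where abc: "a \<in> carrier H" "X = quot_proj H a" "b \<in> carrier H" "Y = quot_proj H b"
      "c \<in> carrier H" "Z = quot_proj H c"
      by (metis carrier_cases)
    then show "X \<sqsubseteq>\<^bsub>quot_lattice H\<^esub> Z"
      using le quot_le_iff join_D L.le_trans[of "a \<squnion> D" "b \<squnion> D" "c \<squnion> D"] by auto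
  qed (simp_all add: quot_lattice_def)
  have sup: "\<exists>s. least (quot_lattice H) s (Upper (quot_lattice H) S)" if "S \<subseteq> carrier (quot_lattice H)" for S
    using quot_lift_set[OF that] quot_is_sup by metis
  show ?thesis
  proof (rule Q.complete_latticeI[OF sup])
    fix S assume "S \<subseteq> carrier (quot_lattice H)"
    obtain s where "least (quot_lattice H) s (Upper (quot_lattice H) (Lower (quot_lattice H) S))"
      using sup[of "Lower (quot_lattice H) S"] by auto
    then show "\<exists>i. greatest (quot_lattice H) i (Lower (quot_lattice H) S)"
      using \<open>S \<subseteq> _\<close> unfolding least_def greatest_def Upper_def Lower_def
      by (intro exI[of _ s]) (auto; blast)
  qed assumption
qed

lemma quot_sup: "A \<subseteq> carrier H \<Longrightarrow> \<Squnion>\<^bsub>quot_lattice H\<^esub> (quot_proj H ` A) = quot_proj H (\<Squnion> A)"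
proof -
  interpret Q: complete_lattice "quot_lattice H" by (rule quot_lattice_complete)
  assume A: "A \<subseteq> carrier H"
  show ?thesis
    by (rule Q.weak.supI[where P = "\<lambda>s. s = quot_proj H (\<Squnion> A)"])
      (use A quot_is_sup[OF A] Q.least_unique proj_in in auto)
qed

theorem quot_coequalizer:
  fixes K :: "('b, 'n) gorder_scheme"
  shows "quot_proj H \<in> suplat_hom H (quot_lattice H)"
    and "\<And>h. \<lbrakk>h \<in> carrier H; counit H h = {}\<rbrakk> \<Longrightarrow> quot_proj H h = \<bottom>\<^bsub>quot_lattice H\<^esub>"
    and "\<And>f. \<lbrakk>f \<in> suplat_hom H K; \<And>h. \<lbrakk>h \<in> carrier H; counit H h = {}\<rbrakk> \<Longrightarrow> f h = \<bottom>\<^bsub>K\<^esub>\<rbrakk> \<Longrightarrow>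
      (\<exists>g \<in> suplat_hom (quot_lattice H) K. \<forall>h \<in> carrier H. g (quot_proj H h) = f h)"
    and "\<And>g g'. \<lbrakk>\<And>h. h \<in> carrier H \<Longrightarrow> g (quot_proj H h) = g' (quot_proj H h); 
        X \<in> carrier (quot_lattice H)\<rbrakk> \<Longrightarrow> (g X :: 'b) = g' X"
proof -
  interpret Q: complete_lattice "quot_lattice H" by (rule quot_lattice_complete)
  show "quot_proj H \<in> suplat_hom H (quot_lattice H)"
    by (rule suplat_homI[OF complete quot_lattice_complete]) (simp_all add: proj_in quot_sup)
  show "quot_proj H h = \<bottom>\<^bsub>quot_lattice H\<^esub>" if h: "h \<in> carrier H" "counit H h = {}" for h
  proof (rule Q.le_antisym)
    have "h \<sqsubseteq> D" unfolding kernel_top_def using h by (intro L.weak.sup_upper) auto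
    have "\<bottom>\<^bsub>quot_lattice H\<^esub> \<in> carrier (quot_lattice H)" by simp
    then obtain b where b: "b \<in> carrier H" "\<bottom>\<^bsub>quot_lattice H\<^esub> = quot_proj H b" by (rule carrier_cases)
    have "h \<squnion> D \<sqsubseteq> b \<squnion> D"
      using h b D \<open>h \<sqsubseteq> D\<close> L.join_right[of b D] L.le_trans[of h D "b \<squnion> D"] by (intro L.join_le) auto
    then show "quot_proj H h \<sqsubseteq>\<^bsub>quot_lattice H\<^esub> \<bottom>\<^bsub>quot_lattice H\<^esub>"
      using b h quot_le_iff by simp
  qed (use h proj_in in auto)
  show "g X = g' X" if "\<And>h. h \<in> carrier H \<Longrightarrow> g (quot_proj H h) = g' (quot_proj H h)"
    "X \<in> carrier (quot_lattice H)" for g g' :: "'a set \<Rightarrow> 'b"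
    using that by (metis carrier_cases)
  fix f assume f: "f \<in> suplat_hom H K" and f0: "\<And>h. \<lbrakk>h \<in> carrier H; counit H h = {}\<rbrakk> \<Longrightarrow> f h = \<bottom>\<^bsub>K\<^esub>"
  interpret K: complete_lattice K by (rule suplat_homD(2)[OF f])
  have fD: "f D = \<bottom>\<^bsub>K\<^esub>"
  proof (rule K.le_antisym)
    have "f D = \<Squnion>\<^bsub>K\<^esub> (f ` {h \<in> carrier H. counit H h = {}})"
      unfolding kernel_top_def by (rule suplat_homD(4)[OF f]) auto
    also have "\<dots> \<sqsubseteq>\<^bsub>K\<^esub> \<bottom>\<^bsub>K\<^esub>"
      using f0 by (intro K.weak.sup_least) auto
    finally show "f D \<sqsubseteq>\<^bsub>K\<^esub> \<bottom>\<^bsub>K\<^esub>" .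
  qed (use suplat_homD(3)[OF f D] in auto)
  have fjoin: "f (h \<squnion> D) = f h" if h: "h \<in> carrier H" for h
  proof -
    have "f (h \<squnion> D) = \<Squnion>\<^bsub>K\<^esub> {f h, f D}"
      using suplat_homD(4)[OF f, of "{h, D}"] h D by (simp add: join_def)
    also have "\<dots> = f h"
      using suplat_homD(3)[OF f h] by (intro K.sup_eqI) (auto simp: fD K.le_refl)
    finally show ?thesis .
  qed
  have g: "f (quot_section H (quot_proj H h)) = f h" if "h \<in> carrier H" for h
    using that by (simp add: quot_section_proj fjoin)
  show "\<exists>g \<in> suplat_hom (quot_lattice H) K. \<forall>h \<in> carrier H. g (quot_proj H h) = f h"
  proof (intro bexI ballI)
    show "(\<lambda>X. f (quot_section H X)) \<in> suplat_hom (quot_lattice H) K"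
    proof (rule suplat_homI[OF quot_lattice_complete suplat_homD(2)[OF f]])
      fix X assume "X \<in> carrier (quot_lattice H)"
      then show "f (quot_section H X) \<in> carrier K"
        by (rule carrier_cases) (simp add: g suplat_homD(3)[OF f])
    next
      fix S assume "S \<subseteq> carrier (quot_lattice H)"
      then obtain A where A: "A \<subseteq> carrier H" "S = quot_proj H ` A" by (rule quot_lift_set)
      have "(\<lambda>X. f (quot_section H X)) ` S = f ` A"
        unfolding A(2) image_image using A(1) g by (intro image_cong) auto
      then show "f (quot_section H (\<Squnion>\<^bsub>quot_lattice H\<^esub> S)) = \<Squnion>\<^bsub>K\<^esub> ((\<lambda>X. f (quot_section H X)) ` S)"
        using A g[of "\<Squnion> A"] suplat_homD(4)[OF f A(1)] quot_sup[OF A(1)] by simp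
    qed
  qed (rule g)
qed

end

end

section \<open>The group algebra\<close>

text \<open>The structure maps are the join-preserving extensions of the usual ones on singletons.\<close>

definition group_algebra :: "('g, 'm) monoid_scheme \<Rightarrow> 'g set hopf" where
  "group_algebra G = (let P = powerset_order (carrier G) in
     \<lparr>carrier = carrier P, eq = eq P, le = le P,
      hprod = tensor_lift P (\<lambda>A B. A <#>\<^bsub>G\<^esub> B),
      hunit = {\<one>\<^bsub>G\<^esub>},
      coprod = (\<lambda>A. \<Squnion>\<^bsub>tensor P P\<^esub> ((\<lambda>g. pure_tensor P P {g} {g}) ` A)),
      counit = (\<lambda>A. if A = {} then {} else {()}),
      antipode = (\<lambda>A. m_inv G ` A)\<rparr>)"

lemma hom_powerset_eq:
  assumes "f \<in> suplat_hom L K" "g \<in> suplat_hom L K" "carrier L = Pow A" "eq L = (=)" "le L = (\<subseteq>)"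
    and "\<And>a. a \<in> A \<Longrightarrow> f {a} = g {a}" "X \<subseteq> A"
  shows "f X = g X"
proof -
  have X: "X = \<Squnion>\<^bsub>L\<^esub> ((\<lambda>a. {a}) ` X)"
    using assms(7) same_order(1)[of L "powerset_order A"]
      powerset_order_sup[of "(\<lambda>a. {a}) ` X" A] assms(3-5)
    by (auto simp: powerset_order_def)
  have c: "(\<lambda>a. {a}) ` X \<subseteq> carrier L" using assms by auto
  have "f ` (\<lambda>a. {a}) ` X = g ` (\<lambda>a. {a}) ` X"
    unfolding image_image using assms(6,7) by (intro image_cong) auto
  then show ?thesis
    using suplat_homD(4)[OF assms(1) c] suplat_homD(4)[OF assms(2) c] X by simp
qed

context
  fixes G :: "('g, 'm) monoid_scheme"
  assumes G: "group G"
begin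

interpretation G: group G by (fact G)

private abbreviation (input) "GA \<equiv> group_algebra G"

private lemma GA_sel [simp]: "carrier GA = Pow (carrier G)" "eq GA = (=)" "le GA = (\<subseteq>)" "hunit GA = {\<one>\<^bsub>G\<^esub>}"
  "counit GA = (\<lambda>A. if A = {} then {} else {()})"  "antipode GA = (\<lambda>A. m_inv G ` A)"
  by (simp_all add: group_algebra_def powerset_order_def Let_def)

private lemma GA_complete: "complete_lattice GA"
  using same_order(2)[of GA "powerset_order (carrier G)"] powerset_order_complete
  by (simp add: powerset_order_def)

private lemma GA_sup: "S \<subseteq> Pow (carrier G) \<Longrightarrow> \<Squnion>\<^bsub>GA\<^esub> S = \<Union> S"
  using same_order(1)[of GA "powerset_order (carrier G)"] powerset_order_sup[of S]
  by (simp add: powerset_order_def)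

private lemma GA_bot: "\<bottom>\<^bsub>GA\<^esub> = {}"
proof -
  interpret complete_lattice GA by (rule GA_complete)
  show ?thesis using bottom_lower[of "{}"] by simp
qed

private lemma P_GA: "\<Squnion>\<^bsub>powerset_order (carrier G)\<^esub> S = \<Squnion>\<^bsub>GA\<^esub> S"
   "tensor (powerset_order (carrier G)) (powerset_order (carrier G)) = tensor GA GA"
   "pure_tensor (powerset_order (carrier G)) (powerset_order (carrier G)) = pure_tensor GA GA"
proof -
  show s: "\<Squnion>\<^bsub>powerset_order (carrier G)\<^esub> S = \<Squnion>\<^bsub>GA\<^esub> S" for S
    by (rule same_order(1)) (simp_all add: powerset_order_def)
  have b: "bi_ideal (powerset_order (carrier G)) (powerset_order (carrier G)) = bi_ideal GA GA"
    unfolding bi_ideal_def fun_eq_iff s by (simp add: powerset_order_def)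
  show "tensor (powerset_order (carrier G)) (powerset_order (carrier G)) = tensor GA GA"
   "pure_tensor (powerset_order (carrier G)) (powerset_order (carrier G)) = pure_tensor GA GA"
    unfolding tensor_def pure_tensor_def b by (simp_all add: fun_eq_iff)
qed

private lemma GA_prod: "hprod GA = tensor_lift GA (\<lambda>A B. A <#>\<^bsub>G\<^esub> B)"
proof -
  have "hprod GA = tensor_lift (powerset_order (carrier G)) (\<lambda>A B. A <#>\<^bsub>G\<^esub> B)"
    by (simp add: group_algebra_def Let_def)
  then show ?thesis unfolding tensor_lift_def P_GA .
qed

private lemma GA_coprod: "coprod GA = (\<lambda>A. \<Squnion>\<^bsub>tensor GA GA\<^esub> ((\<lambda>g. pure_tensor GA GA {g} {g}) ` A))"
proof -
  have "coprod GA = (\<lambda>A. \<Squnion>\<^bsub>tensor (powerset_order (carrier G)) (powerset_order (carrier G))\<^esub>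
    ((\<lambda>g. pure_tensor (powerset_order (carrier G)) (powerset_order (carrier G)) {g} {g}) ` A))"
    by (simp add: group_algebra_def Let_def)
  then show ?thesis unfolding P_GA .
qed

private lemma GA_hom_to: 
  assumes "complete_lattice K" "\<And>X. X \<subseteq> carrier G \<Longrightarrow> f X \<in> carrier K"
    and "\<And>S. S \<subseteq> Pow (carrier G) \<Longrightarrow> f (\<Union> S) = \<Squnion>\<^bsub>K\<^esub> (f ` S)"
  shows "f \<in> suplat_hom GA K"
  using assms by (intro suplat_homI[OF GA_complete]) (auto simp: GA_sup)

private lemma ext_hom:
  assumes K: "complete_lattice K" and p: "\<And>g. g \<in> carrier G \<Longrightarrow> p g \<in> carrier K"
  shows "(\<lambda>A. \<Squnion>\<^bsub>K\<^esub> (p ` A)) \<in> suplat_hom GA K"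
proof (rule GA_hom_to[OF K])
  interpret K: complete_lattice K by (fact K)
  have i: "p ` X \<subseteq> carrier K" if "X \<subseteq> carrier G" for X using p that by auto
  show c: "\<Squnion>\<^bsub>K\<^esub> (p ` X) \<in> carrier K" if "X \<subseteq> carrier G" for X using i[OF that] by simp
  fix S assume S: "S \<subseteq> Pow (carrier G)"
  then have U: "\<Union> S \<subseteq> carrier G" by auto
  let ?s = "\<Squnion>\<^bsub>K\<^esub> ((\<lambda>A. \<Squnion>\<^bsub>K\<^esub> (p ` A)) ` S)"
  have "(\<lambda>A. \<Squnion>\<^bsub>K\<^esub> (p ` A)) ` S \<subseteq> carrier K" using S c by blast
  then have s: "?s \<in> carrier K" by simp
  have "(\<Squnion>\<^bsub>K\<^esub> (p ` \<Union> S) \<sqsubseteq>\<^bsub>K\<^esub> y) = (?s \<sqsubseteq>\<^bsub>K\<^esub> y)" if y: "y \<in> carrier K" for y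
  proof -
    have "(\<Squnion>\<^bsub>K\<^esub> (p ` A) \<sqsubseteq>\<^bsub>K\<^esub> y) = (\<forall>x \<in> A. p x \<sqsubseteq>\<^bsub>K\<^esub> y)" if "A \<subseteq> carrier G" for A
      using K.sup_le_iff[OF i[OF that] y] by simp
    then have a: "\<forall>A \<in> S. (\<Squnion>\<^bsub>K\<^esub> (p ` A) \<sqsubseteq>\<^bsub>K\<^esub> y) = (\<forall>x \<in> A. p x \<sqsubseteq>\<^bsub>K\<^esub> y)" using S by auto
    show ?thesis
      using K.sup_le_iff[OF i[OF U] y] K.sup_le_iff[OF \<open>(\<lambda>A. \<Squnion>\<^bsub>K\<^esub> (p ` A)) ` S \<subseteq> carrier K\<close> y] a by simp
  qed
  then show "\<Squnion>\<^bsub>K\<^esub> (p ` \<Union> S) = ?s"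
    using s c[OF U] by (intro K.le_antisym) (auto intro: K.le_refl)
qed

private lemma mult_bim: "(\<lambda>A B. A <#>\<^bsub>G\<^esub> B) \<in> bimorphism GA GA GA"
proof -
  have c: "A <#>\<^bsub>G\<^esub> B \<subseteq> carrier G" if "A \<subseteq> carrier G" "B \<subseteq> carrier G" for A B
    using that by (rule G.setmult_subset_G)
  show ?thesis
  proof (rule bimorphismI; rule GA_hom_to[OF GA_complete])
    fix l S assume "l \<in> carrier GA" "S \<subseteq> Pow (carrier G)"
    then show "l <#>\<^bsub>G\<^esub> \<Union> S = \<Squnion>\<^bsub>GA\<^esub> ((\<lambda>B. l <#>\<^bsub>G\<^esub> B) ` S)"
      using c by (subst GA_sup) (auto simp: set_mult_def)
  next
    fix l S assume "l \<in> carrier GA" "S \<subseteq> Pow (carrier G)"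
    then show "\<Union> S <#>\<^bsub>G\<^esub> l = \<Squnion>\<^bsub>GA\<^esub> ((\<lambda>B. B <#>\<^bsub>G\<^esub> l) ` S)"
      using c by (subst GA_sup) (auto simp: set_mult_def)
  qed (use c in auto)
qed

private lemma GA_hmult: "A \<subseteq> carrier G \<Longrightarrow> B \<subseteq> carrier G \<Longrightarrow> hmult GA A B = A <#>\<^bsub>G\<^esub> B"
  unfolding hmult_def GA_prod
  by (rule tensor_lift_pure[OF GA_complete GA_complete GA_complete mult_bim]) auto

private lemmas T = tensor_complete[OF GA_complete GA_complete]
private lemmas p = pure_tensor_bimorphism[OF GA_complete GA_complete]

private lemma pc: "A \<subseteq> carrier G \<Longrightarrow> B \<subseteq> carrier G \<Longrightarrow> pure_tensor GA GA A B \<in> carrier (tensor GA GA)"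
  using pure_tensor_bi_ideal[OF GA_complete GA_complete, of A B] by (simp add: tensor_def)

private lemma GA_coprod_hom: "coprod GA \<in> suplat_hom GA (tensor GA GA)"
  unfolding GA_coprod by (intro ext_hom[OF T] pc) auto

private lemma GA_coprod_sing: "g \<in> carrier G \<Longrightarrow> coprod GA {g} = pure_tensor GA GA {g} {g}"
proof -
  interpret T: complete_lattice "tensor GA GA" by (rule T)
  assume "g \<in> carrier G" then show ?thesis by (simp add: GA_coprod pc)
qed

private lemma counit_hom: "counit GA \<in> suplat_hom GA P1"
proof (rule GA_hom_to[OF powerset_order_complete])
  fix S assume "S \<subseteq> Pow (carrier G)"
  show "counit GA (\<Union> S) = \<Squnion>\<^bsub>P1\<^esub> (counit GA ` S)"
    by (subst powerset_order_sup) auto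
qed (auto simp: powerset_order_def)

private lemma antip_hom: "antipode GA \<in> suplat_hom GA GA"
proof (rule GA_hom_to[OF GA_complete])
  fix S assume "S \<subseteq> Pow (carrier G)"
  then show "antipode GA (\<Union> S) = \<Squnion>\<^bsub>GA\<^esub> (antipode GA ` S)"
    by (subst GA_sup) auto
qed auto

private lemma P1_sup: "S \<subseteq> Pow {()} \<Longrightarrow> \<Squnion>\<^bsub>P1\<^esub> S = \<Union> S" by (rule powerset_order_sup)

private lemma unit_bim:
  "(\<lambda>x l. if x = {} then \<bottom>\<^bsub>GA\<^esub> else l) \<in> bimorphism P1 GA GA" (is ?a)
  "(\<lambda>l x. if x = {} then \<bottom>\<^bsub>GA\<^esub> else l) \<in> bimorphism GA P1 GA" (is ?b)
proof -
  have 1: "(\<lambda>l. if x = {} then \<bottom>\<^bsub>GA\<^esub> else l) \<in> suplat_hom GA GA" for x :: "unit set"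
  proof (rule GA_hom_to[OF GA_complete])
    fix S assume "S \<subseteq> Pow (carrier G)"
    then show "(if x = {} then \<bottom>\<^bsub>GA\<^esub> else \<Union> S) = \<Squnion>\<^bsub>GA\<^esub> ((\<lambda>l. if x = {} then \<bottom>\<^bsub>GA\<^esub> else l) ` S)"
      by (subst GA_sup) (auto simp: GA_bot)
  qed (auto simp: GA_bot)
  have 2: "(\<lambda>x. if x = {} then \<bottom>\<^bsub>GA\<^esub> else l) \<in> suplat_hom P1 GA" if "l \<in> carrier GA" for l
  proof (rule suplat_homI[OF powerset_order_complete GA_complete])
    fix A assume "A \<subseteq> carrier P1"
    then have "A \<subseteq> Pow {()}" by (simp add: powerset_order_def)
    then have A: "A \<subseteq> Pow {()}" "\<Squnion>\<^bsub>P1\<^esub> A = \<Union> A" by (auto simp only: P1_sup)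
    then show "(if \<Squnion>\<^bsub>P1\<^esub> A = {} then \<bottom>\<^bsub>GA\<^esub> else l) = \<Squnion>\<^bsub>GA\<^esub> ((\<lambda>x. if x = {} then \<bottom>\<^bsub>GA\<^esub> else l) ` A)"
      using that by (subst GA_sup) (auto simp: GA_bot)
  qed (use that in \<open>auto simp: GA_bot\<close>)
  show ?a ?b by (auto intro!: bimorphismI 1 2)
qed

private lemma tmult_bim0:
  assumes "a \<in> carrier GA" "b \<in> carrier GA"
  shows "(\<lambda>c d. pure_tensor GA GA (hmult GA a c) (hmult GA b d)) \<in> bimorphism GA GA (tensor GA GA)"
    "(\<lambda>c d. pure_tensor GA GA (hmult GA c a) (hmult GA d b)) \<in> bimorphism GA GA (tensor GA GA)"
proof -
  have m: "hmult GA a \<in> suplat_hom GA GA" if "a \<in> carrier GA" for a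
    unfolding hmult_def GA_prod
    by (rule suplat_hom_comp[OF bimorphismD(1)[OF p that] tensor_lift_hom[OF GA_complete GA_complete GA_complete mult_bim]])
  have m': "(\<lambda>c. hmult GA c a) \<in> suplat_hom GA GA" if "a \<in> carrier GA" for a
    unfolding hmult_def GA_prod
    by (rule suplat_hom_comp[OF bimorphismD(2)[OF p that] tensor_lift_hom[OF GA_complete GA_complete GA_complete mult_bim]])
  show "(\<lambda>c d. pure_tensor GA GA (hmult GA a c) (hmult GA b d)) \<in> bimorphism GA GA (tensor GA GA)"
    by (rule tensor_map_bim[OF m m]) fact+
  show "(\<lambda>c d. pure_tensor GA GA (hmult GA c a) (hmult GA d b)) \<in> bimorphism GA GA (tensor GA GA)"
    by (rule tensor_map_bim[OF m' m']) fact+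
qed

private lemma tmult:
  "V \<in> carrier (tensor GA GA) \<Longrightarrow> (\<lambda>U. tensor_mult GA U V) \<in> suplat_hom (tensor GA GA) (tensor GA GA)"
  "U \<in> carrier (tensor GA GA) \<Longrightarrow> tensor_mult GA U \<in> suplat_hom (tensor GA GA) (tensor GA GA)"
  "a \<in> carrier GA \<Longrightarrow> b \<in> carrier GA \<Longrightarrow> c \<in> carrier GA \<Longrightarrow> d \<in> carrier GA \<Longrightarrow>
    tensor_mult GA (pure_tensor GA GA a b) (pure_tensor GA GA c d) =
    pure_tensor GA GA (hmult GA a c) (hmult GA b d)"
proof -
  let ?T = "tensor GA GA"
  let ?f = "\<lambda>V a b. tensor_lift ?T (\<lambda>c d. pure_tensor GA GA (hmult GA a c) (hmult GA b d)) V"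
  note c = GA_complete and c3 = GA_complete GA_complete T
  have b: "?f V \<in> bimorphism GA GA ?T" if V: "V \<in> carrier ?T" for V
  proof (rule bimorphismI)
    fix l assume l: "l \<in> carrier GA"
    show "?f V l \<in> suplat_hom GA ?T"
      by (rule tensor_lift_param[OF c c c T _ _ V])
        (use l in \<open>auto intro: tmult_bim0 bimorphismD(1)[OF tmult_bim0(2)] simp del: GA_sel\<close>)
  next
    fix l assume l: "l \<in> carrier GA"
    show "(\<lambda>a. ?f V a l) \<in> suplat_hom GA ?T"
      by (rule tensor_lift_param[OF c c c T _ _ V])
        (use l in \<open>auto intro: tmult_bim0 bimorphismD(2)[OF tmult_bim0(2)] simp del: GA_sel\<close>)
  qed
  show "V \<in> carrier ?T \<Longrightarrow> (\<lambda>U. tensor_mult GA U V) \<in> suplat_hom ?T ?T"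
    unfolding tensor_mult_def by (rule tensor_lift_hom[OF c3 b])
  show "U \<in> carrier ?T \<Longrightarrow> tensor_mult GA U \<in> suplat_hom ?T ?T"
    unfolding tensor_mult_def
    by (rule tensor_lift_param[OF c c T T b]) (auto intro: tensor_lift_hom[OF c3 tmult_bim0(1)])
  assume a: "a \<in> carrier GA" "b \<in> carrier GA" "c \<in> carrier GA" "d \<in> carrier GA"
  then show "tensor_mult GA (pure_tensor GA GA a b) (pure_tensor GA GA c d) =
    pure_tensor GA GA (hmult GA a c) (hmult GA b d)"
    unfolding tensor_mult_def
    using tensor_lift_pure[OF c3 b[OF pc[of c d]] a(1,2)] tensor_lift_pure[OF c3 tmult_bim0(1)[OF a(1,2)] a(3,4)]
    by simp
qed

private lemma GA_ext:
  assumes "f \<in> suplat_hom GA K" "g \<in> suplat_hom GA K" "\<And>a. a \<in> carrier G \<Longrightarrow> f {a} = g {a}" "X \<in> carrier GA"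
  shows "f X = g X"
  by (rule hom_powerset_eq[OF assms(1,2), of "carrier G"]) (use assms in auto)

theorem group_algebra_hopf: "suplat_hopf GA"
proof (rule suplat_hopf.intro)
  note c = GA_complete and c2 = GA_complete GA_complete
  note id = suplat_hom_id[OF c]
  show prodh: "hprod GA \<in> suplat_hom (tensor GA GA) GA"
    unfolding GA_prod by (rule tensor_lift_hom[OF c2 c mult_bim])
  have prodp: "hprod GA (pure_tensor GA GA A B) = A <#>\<^bsub>G\<^esub> B" if "A \<subseteq> carrier G" "B \<subseteq> carrier G" for A B
    using GA_hmult[OF that] by (simp add: hmult_def)
  show "complete_lattice GA" by (rule c)
  show "hunit GA \<in> carrier GA" by simp
  show "coprod GA \<in> suplat_hom GA (tensor GA GA)" by (rule GA_coprod_hom)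
  show "counit GA \<in> suplat_hom GA P1" by (rule counit_hom)
  show "antipode GA \<in> suplat_iso GA GA"
    unfolding suplat_iso_def using antip_hom
    by (auto intro!: bexI[of _ "antipode GA"] simp: image_image subset_iff image_iff)
  show "hmult GA (hmult GA a b) d = hmult GA a (hmult GA b d)"
    if "a \<in> carrier GA" "b \<in> carrier GA" "d \<in> carrier GA" for a b d
    using that G.set_mult_assoc[of a b d] by (simp add: GA_hmult G.setmult_subset_G)
  show "hmult GA (hunit GA) a = a" "hmult GA a (hunit GA) = a" if "a \<in> carrier GA" for a
    using that by (auto simp: GA_hmult set_mult_def subset_iff)
  show "coprod GA (hunit GA) = pure_tensor GA GA (hunit GA) (hunit GA)"
    by (simp add: GA_coprod_sing)
  show "counit GA (hunit GA) = {()}" by simp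
  show "(counit GA (hmult GA h h') = {()}) = (counit GA h = {()} \<and> counit GA h' = {()})"
    if "h \<in> carrier GA" "h' \<in> carrier GA" for h h'
    using that by (auto simp: GA_hmult set_mult_def)
  show "tensor_assoc GA GA GA (tensor_map (tensor GA GA) GA (coprod GA) id (coprod GA h)) =
      tensor_map GA (tensor GA GA) id (coprod GA) (coprod GA h)" if h: "h \<in> carrier GA" for h
  proof (rule GA_ext[OF _ _ _ h])
    show "(\<lambda>h. tensor_assoc GA GA GA (tensor_map (tensor GA GA) GA (coprod GA) id (coprod GA h)))
      \<in> suplat_hom GA (tensor GA (tensor GA GA))"
      by (rule suplat_hom_comp[OF suplat_hom_comp[OF GA_coprod_hom tensor_map_props(1)[OF GA_coprod_hom id]] tensor_assoc_props(1)[OF c c c]])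
    show "(\<lambda>h. tensor_map GA (tensor GA GA) id (coprod GA) (coprod GA h))
      \<in> suplat_hom GA (tensor GA (tensor GA GA))"
      by (rule suplat_hom_comp[OF GA_coprod_hom tensor_map_props(1)[OF id GA_coprod_hom]])
    fix a assume "a \<in> carrier G"
    then show "tensor_assoc GA GA GA (tensor_map (tensor GA GA) GA (coprod GA) id (coprod GA {a})) =
      tensor_map GA (tensor GA GA) id (coprod GA) (coprod GA {a})"
      by (simp add: GA_coprod_sing tensor_map_props(2)[OF GA_coprod_hom id] tensor_map_props(2)[OF id GA_coprod_hom]
        tensor_assoc_props(2)[OF c c c])
  qed
  show "left_unitor GA (tensor_map P1 GA (counit GA) id (coprod GA h)) = h" if h: "h \<in> carrier GA" for h
  proof -
    have "left_unitor GA (tensor_map P1 GA (counit GA) id (coprod GA h)) = id h"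
    proof (rule GA_ext[OF _ _ _ h])
      show "(\<lambda>h. left_unitor GA (tensor_map P1 GA (counit GA) id (coprod GA h))) \<in> suplat_hom GA GA"
        unfolding left_unitor_def
        by (rule suplat_hom_comp[OF suplat_hom_comp[OF GA_coprod_hom tensor_map_props(1)[OF counit_hom id]]
          tensor_lift_hom[OF powerset_order_complete c c unit_bim(1)]])
      fix a assume "a \<in> carrier G"
      then show "left_unitor GA (tensor_map P1 GA (counit GA) id (coprod GA {a})) = id {a}"
        using tensor_lift_pure[OF powerset_order_complete c c unit_bim(1), of "{()}" "{a}"]
          tensor_map_props(2)[OF counit_hom id, of "{a}" "{a}"]
        by (simp add: left_unitor_def GA_coprod_sing powerset_order_def)
    qed (rule id)
    then show ?thesis by simp
  qed
  show "right_unitor GA (tensor_map GA P1 id (counit GA) (coprod GA h)) = h" if h: "h \<in> carrier GA" for h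
  proof -
    have "right_unitor GA (tensor_map GA P1 id (counit GA) (coprod GA h)) = id h"
    proof (rule GA_ext[OF _ _ _ h])
      show "(\<lambda>h. right_unitor GA (tensor_map GA P1 id (counit GA) (coprod GA h))) \<in> suplat_hom GA GA"
        unfolding right_unitor_def
        by (rule suplat_hom_comp[OF suplat_hom_comp[OF GA_coprod_hom tensor_map_props(1)[OF id counit_hom]]
          tensor_lift_hom[OF c powerset_order_complete c unit_bim(2)]])
      fix a assume "a \<in> carrier G"
      then show "right_unitor GA (tensor_map GA P1 id (counit GA) (coprod GA {a})) = id {a}"
        using tensor_lift_pure[OF c powerset_order_complete c unit_bim(2), of "{a}" "{()}"]
          tensor_map_props(2)[OF id counit_hom, of "{a}" "{a}"]
        by (simp add: right_unitor_def GA_coprod_sing powerset_order_def)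
    qed (rule id)
    then show ?thesis by simp
  qed
  have hm: "hmult GA x \<in> suplat_hom GA GA" if "x \<in> carrier GA" for x
    unfolding hmult_def by (rule suplat_hom_comp[OF bimorphismD(1)[OF p that] prodh])
  have hm': "(\<lambda>y. hmult GA y x) \<in> suplat_hom GA GA" if "x \<in> carrier GA" for x
    unfolding hmult_def by (rule suplat_hom_comp[OF bimorphismD(2)[OF p that] prodh])
  have cc: "coprod GA x \<in> carrier (tensor GA GA)" if "x \<in> carrier GA" for x
    by (rule suplat_homD(3)[OF GA_coprod_hom that])
  show "coprod GA (hmult GA h h') = tensor_mult GA (coprod GA h) (coprod GA h')"
    if h: "h \<in> carrier GA" and h': "h' \<in> carrier GA" for h h'
  proof (rule GA_ext[where f = "\<lambda>h. coprod GA (hmult GA h h')", OF _ _ _ h])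
    show "(\<lambda>h. coprod GA (hmult GA h h')) \<in> suplat_hom GA (tensor GA GA)"
      by (rule suplat_hom_comp[OF hm'[OF h'] GA_coprod_hom])
    show "(\<lambda>h. tensor_mult GA (coprod GA h) (coprod GA h')) \<in> suplat_hom GA (tensor GA GA)"
      by (rule suplat_hom_comp[OF GA_coprod_hom tmult(1)[OF cc[OF h']]])
    fix a assume a: "a \<in> carrier G"
    then have a': "{a} \<in> carrier GA" by simp
    show "coprod GA (hmult GA {a} h') = tensor_mult GA (coprod GA {a}) (coprod GA h')"
    proof (rule GA_ext[where f = "\<lambda>h'. coprod GA (hmult GA {a} h')", OF _ _ _ h'])
      show "(\<lambda>h'. coprod GA (hmult GA {a} h')) \<in> suplat_hom GA (tensor GA GA)"
        by (rule suplat_hom_comp[OF hm[OF a'] GA_coprod_hom])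
      show "(\<lambda>h'. tensor_mult GA (coprod GA {a}) (coprod GA h')) \<in> suplat_hom GA (tensor GA GA)"
        by (rule suplat_hom_comp[OF GA_coprod_hom tmult(2)[OF cc[OF a']]])
      fix b assume b: "b \<in> carrier G"
      have "hmult GA {a} {b} = {a \<otimes>\<^bsub>G\<^esub> b}" using a b by (simp add: GA_hmult set_mult_def)
      then show "coprod GA (hmult GA {a} {b}) = tensor_mult GA (coprod GA {a}) (coprod GA {b})"
        using a b by (simp add: GA_coprod_sing tmult(3))
    qed
  qed
  have un: "(\<lambda>h. if counit GA h = {()} then hunit GA else \<bottom>\<^bsub>GA\<^esub>) \<in> suplat_hom GA GA"
  proof (rule GA_hom_to[OF GA_complete])
    fix S assume "S \<subseteq> Pow (carrier G)"
    then show "(if counit GA (\<Union> S) = {()} then hunit GA else \<bottom>\<^bsub>GA\<^esub>) = \<Squnion>\<^bsub>GA\<^esub> ((\<lambda>h. if counit GA h = {()} then hunit GA else \<bottom>\<^bsub>GA\<^esub>) ` S)"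
      by (subst GA_sup) (auto simp: GA_bot split: if_splits)
  qed (auto simp: GA_bot)
  show "hprod GA (tensor_map GA GA id (antipode GA) (coprod GA h)) =
    (if counit GA h = {()} then hunit GA else \<bottom>\<^bsub>GA\<^esub>)" if h: "h \<in> carrier GA" for h
  proof (rule GA_ext[OF suplat_hom_comp[OF suplat_hom_comp[OF GA_coprod_hom tensor_map_props(1)[OF id antip_hom]] prodh] un _ h])
    fix a assume "a \<in> carrier G"
    then show "hprod GA (tensor_map GA GA id (antipode GA) (coprod GA {a})) =
      (if counit GA {a} = {()} then hunit GA else \<bottom>\<^bsub>GA\<^esub>)"
      using tensor_map_props(2)[OF id antip_hom, of "{a}" "{a}"]
      by (simp add: GA_coprod_sing prodp set_mult_def)
  qed
  show "hprod GA (tensor_map GA GA (antipode GA) id (coprod GA h)) =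
    (if counit GA h = {()} then hunit GA else \<bottom>\<^bsub>GA\<^esub>)" if h: "h \<in> carrier GA" for h
  proof (rule GA_ext[OF suplat_hom_comp[OF suplat_hom_comp[OF GA_coprod_hom tensor_map_props(1)[OF antip_hom id]] prodh] un _ h])
    fix a assume "a \<in> carrier G"
    then show "hprod GA (tensor_map GA GA (antipode GA) id (coprod GA {a})) =
      (if counit GA {a} = {()} then hunit GA else \<bottom>\<^bsub>GA\<^esub>)"
      using tensor_map_props(2)[OF antip_hom id, of "{a}" "{a}"]
      by (simp add: GA_coprod_sing prodp set_mult_def)
  qed
qed

end

end

theory Submission
  imports Defs
begin

text \<open>
  Write $D$ for the largest element with empty counit. Because the counit is multiplicative, $D$ is
  an ideal; because \<open>left_unitor\<close> and \<open>right_unitor\<close> undo the comultiplication, every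
  pair below $\Delta(D)$ has an entry below $D$; and because the antipode axiom forces
  $\epsilon S = \epsilon$ (\<open>counit_antipode\<close>), $S$ and $S^{-1}$ map $D$ below $D$. So all structure
  maps descend along the projection, and the axioms are inherited by its surjective image
  (\<open>suplat_hopf_surjective_image\<close>). In the quotient only the bottom element has empty counit, and
  the rest of the argument concerns such a Hopf algebra.

  The key is that the unit $1$ is an atom (\<open>unit_atom\<close>): for $\emptyset \neq x \le 1$ the antipode
  axiom writes $1$ as a join of products $a.S(b)$ over pairs $(a,b) \le \Delta(x)$. If both entries are
  nonzero, they lie below $x \le 1$, so $S(b) \le S(1) = 1$ and $a.S(b) \le a \le x$, whence $1 \le x$. If now
  $(a,b) \le \Delta(h)$ with $a, b$ nonzero, then $a.S(b)$ is nonzero and at most $1$, hence it is $1$.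
  Thus $a$ has the right inverse $S(b)$, and applying the same to $S(b)$ in place of $h$ shows that the
  inverse is two-sided (\<open>coprod_factor_in_remnant\<close>). By the counit law $h$ is the join of such
  elements $a$. So every element is a join of invertible elements, and invertible elements are atoms,
  being translates of $1$.

  It remains to see that an invertible $u$ lies below a join of invertible elements only if it is one
  of them (\<open>remnant_sup_prime\<close>). This need not hold in an atomistic lattice, and it comes from the
  comultiplication: $\Delta(u) = (u,u)$ for invertible $u$, and the pairs $(x,x)$ with $x \in X$ generate in
  the tensor square only the diagonal of $X$, since atoms allow no new pair to arise in a single row or
  column. Consequently $X \mapsto \bigvee X$ is an isomorphism from the power set of the group of
  invertible elements. It is a map of Hopf algebras because this can be tested on singletons.
\<close>

section \<open>Maps out of tensor products\<close>

lemma suplat_hom_bottom: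
  assumes "f \<in> suplat_hom L M"
  shows "f \<bottom>\<^bsub>L\<^esub> = \<bottom>\<^bsub>M\<^esub>"
proof -
  interpret L: complete_lattice L by (rule suplat_homD(1)[OF assms])
  interpret M: complete_lattice M by (rule suplat_homD(2)[OF assms])
  have "\<Squnion>\<^bsub>L\<^esub> {} = \<bottom>\<^bsub>L\<^esub>" by (intro L.sup_eqI) auto
  moreover have "\<Squnion>\<^bsub>M\<^esub> {} = \<bottom>\<^bsub>M\<^esub>" by (intro M.sup_eqI) auto
  ultimately show ?thesis using suplat_homD(4)[OF assms, of "{}"] by simp
qed

lemma suplat_hom_join:
  assumes "f \<in> suplat_hom L M" "a \<in> carrier L" "b \<in> carrier L"
  shows "f (a \<squnion>\<^bsub>L\<^esub> b) = f a \<squnion>\<^bsub>M\<^esub> f b"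
  using suplat_homD(4)[OF assms(1), of "{a, b}"] assms by (simp add: join_def)

lemma suplat_hom_cong:
  assumes f: "f \<in> suplat_hom L M" and eq: "\<And>x. x \<in> carrier L \<Longrightarrow> g x = f x"
  shows "g \<in> suplat_hom L M"
proof (rule suplat_homI[OF suplat_homD(1,2)[OF f]])
  interpret L: complete_lattice L by (rule suplat_homD(1)[OF f])
  show "g x \<in> carrier M" if "x \<in> carrier L" for x using suplat_homD(3)[OF f that] eq[OF that] by simp
  fix A assume A: "A \<subseteq> carrier L"
  have "g ` A = f ` A" using A eq by (intro image_cong) auto
  then show "g (\<Squnion>\<^bsub>L\<^esub> A) = \<Squnion>\<^bsub>M\<^esub> (g ` A)"
    using suplat_homD(4)[OF f A] eq[of "\<Squnion>\<^bsub>L\<^esub> A"] A by simp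
qed

text \<open>
  Surjections are quotient maps: this is how maps out of the quotient by the counit kernel are shown to
  preserve joins, although they are defined through \<open>quot_section\<close>, which does not preserve the empty join.
\<close>

lemma suplat_hom_factor:
  assumes f: "f \<in> suplat_hom L M" and surj: "f ` carrier L = carrier M"
    and g': "g' \<in> suplat_hom L K" and eq: "\<And>x. x \<in> carrier L \<Longrightarrow> g (f x) = g' x"
  shows "g \<in> suplat_hom M K"
proof (rule suplat_homI[OF suplat_homD(2)[OF f] suplat_homD(2)[OF g']])
  have g: "(\<lambda>x. g (f x)) \<in> suplat_hom L K" by (rule suplat_hom_cong[OF g' eq])
  show "g y \<in> carrier K" if "y \<in> carrier M" for y
    using that surj suplat_homD(3)[OF g] by (metis imageE)
  fix B assume "B \<subseteq> carrier M"
  then obtain A where A: "A \<subseteq> carrier L" "B = f ` A" unfolding surj[symmetric] by (meson subset_imageE)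
  show "g (\<Squnion>\<^bsub>M\<^esub> B) = \<Squnion>\<^bsub>K\<^esub> (g ` B)"
    using suplat_homD(4)[OF f A(1)] suplat_homD(4)[OF g A(1)] A(2) by (simp add: image_image)
qed

lemma pure_tensor_closed:
  assumes "complete_lattice L" "complete_lattice M" "l \<in> carrier L" "m \<in> carrier M"
  shows "pure_tensor L M l m \<in> carrier (tensor L M)"
  using pure_tensor_bi_ideal[OF assms] by (simp add: tensor_def)

lemma hom_tensor_lift:
  assumes "g \<in> suplat_hom K K'" "\<And>l m. (l, m) \<in> U \<Longrightarrow> f l m \<in> carrier K"
  shows "g (tensor_lift K f U) = tensor_lift K' (\<lambda>l m. g (f l m)) U"
proof -
  have "(\<lambda>(l, m). f l m) ` U \<subseteq> carrier K" using assms(2) by auto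
  then show ?thesis unfolding tensor_lift_def
    by (subst suplat_homD(4)[OF assms(1)]) (auto simp: image_image case_prod_beta)
qed

lemma tensor_lift_cong:
  assumes "\<And>l m. (l, m) \<in> U \<Longrightarrow> f l m = g l m"
  shows "tensor_lift K f U = tensor_lift K g U"
proof -
  have "(\<lambda>(l, m). f l m) ` U = (\<lambda>(l, m). g l m) ` U" using assms by (intro image_cong) auto
  then show ?thesis by (simp add: tensor_lift_def)
qed

text \<open>
  The maps \<open>f1\<close> and \<open>f2\<close> are arbitrary between carriers, so that the formula covers \<open>quot_section\<close>, which does
  not preserve bottom. For a Hopf algebra it is the Sweedler notation: a map applied to a
  comultiplication becomes a join over the pairs in it.
\<close>

lemma hom_tensor_map:
  assumes L': "complete_lattice L'" and M': "complete_lattice M'"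
    and g: "g \<in> suplat_hom (tensor L' M') K"
    and "\<And>l. l \<in> carrier L \<Longrightarrow> f1 l \<in> carrier L'" "\<And>m. m \<in> carrier M \<Longrightarrow> f2 m \<in> carrier M'"
    and U: "U \<in> carrier (tensor L M)"
  shows "g (tensor_map L' M' f1 f2 U) = tensor_lift K (\<lambda>l m. g (pure_tensor L' M' (f1 l) (f2 m))) U"
  unfolding tensor_map_def using assms tensor_sub[OF U]
  by (intro hom_tensor_lift[OF g] pure_tensor_closed) auto

lemma tensor_hom_ext:
  assumes c: "complete_lattice L" "complete_lattice M"
    and f: "f \<in> suplat_hom (tensor L M) K" and g: "g \<in> suplat_hom (tensor L M) K"
    and eq: "\<And>l m. l \<in> carrier L \<Longrightarrow> m \<in> carrier M \<Longrightarrow> f (pure_tensor L M l m) = g (pure_tensor L M l m)"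
    and U: "U \<in> carrier (tensor L M)"
  shows "f U = g U"
proof -
  let ?P = "(\<lambda>(l, m). pure_tensor L M l m) ` U"
  have c': "?P \<subseteq> carrier (tensor L M)"
    using tensor_sub[OF U] by (auto intro: pure_tensor_closed[OF c])
  have "f ` ?P = g ` ?P"
    unfolding image_image using tensor_sub[OF U] eq by (intro image_cong) auto
  then show ?thesis
    using tensor_eq_sup_pure[OF c U] suplat_homD(4)[OF f c'] suplat_homD(4)[OF g c'] by metis
qed

lemma tensor3_hom_ext:
  assumes L: "complete_lattice L" and M: "complete_lattice M" and N: "complete_lattice N"
    and f: "f \<in> suplat_hom (tensor (tensor L M) N) K" and g: "g \<in> suplat_hom (tensor (tensor L M) N) K"
    and eq: "\<And>l m n. l \<in> carrier L \<Longrightarrow> m \<in> carrier M \<Longrightarrow> n \<in> carrier N \<Longrightarrow>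
      f (pure_tensor (tensor L M) N (pure_tensor L M l m) n) =
      g (pure_tensor (tensor L M) N (pure_tensor L M l m) n)"
    and U: "U \<in> carrier (tensor (tensor L M) N)"
  shows "f U = g U"
proof (rule tensor_hom_ext[OF tensor_complete[OF L M] N f g _ U])
  fix t n assume t: "t \<in> carrier (tensor L M)" and n: "n \<in> carrier N"
  note p = bimorphismD(2)[OF pure_tensor_bimorphism[OF tensor_complete[OF L M] N] n]
  show "f (pure_tensor (tensor L M) N t n) = g (pure_tensor (tensor L M) N t n)"
    by (rule tensor_hom_ext[OF L M suplat_hom_comp[OF p f] suplat_hom_comp[OF p g] eq[OF _ _ n] t])
qed

lemma tensor_map_comp:
  assumes f: "f \<in> suplat_hom L L'" "f' \<in> suplat_hom L' L''"
    and g: "g \<in> suplat_hom M M'" "g' \<in> suplat_hom M' M''"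
    and U: "U \<in> carrier (tensor L M)"
  shows "tensor_map L'' M'' f' g' (tensor_map L' M' f g U) =
    tensor_map L'' M'' (\<lambda>x. f' (f x)) (\<lambda>y. g' (g y)) U"
proof (rule tensor_hom_ext[OF suplat_homD(1)[OF f(1)] suplat_homD(1)[OF g(1)] _ _ _ U])
  note fg = tensor_map_props[OF f(1) g(1)] and fg' = tensor_map_props[OF f(2) g(2)]
  note fc = suplat_hom_comp[OF f] and gc = suplat_hom_comp[OF g]
  show "(\<lambda>U. tensor_map L'' M'' f' g' (tensor_map L' M' f g U)) \<in> suplat_hom (tensor L M) (tensor L'' M'')"
    by (rule suplat_hom_comp[OF fg(1) fg'(1)])
  show "tensor_map L'' M'' (\<lambda>x. f' (f x)) (\<lambda>y. g' (g y)) \<in> suplat_hom (tensor L M) (tensor L'' M'')"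
    by (rule tensor_map_props(1)[OF fc gc])
  fix l m assume "l \<in> carrier L" "m \<in> carrier M"
  then show "tensor_map L'' M'' f' g' (tensor_map L' M' f g (pure_tensor L M l m)) =
      tensor_map L'' M'' (\<lambda>x. f' (f x)) (\<lambda>y. g' (g y)) (pure_tensor L M l m)"
    using suplat_homD(3)[OF f(1)] suplat_homD(3)[OF g(1)]
    by (simp add: fg(2) fg'(2) tensor_map_props(2)[OF fc gc])
qed

text \<open>
  Equality with the identity is only asked for on carriers, because two maps that are mutually inverse on
  carriers need not compose to \<open>id\<close>.
\<close>

lemma tensor_map_ident:
  assumes c: "complete_lattice L" "complete_lattice M" and U: "U \<in> carrier (tensor L M)"
    and "\<And>l. l \<in> carrier L \<Longrightarrow> f l = l" "\<And>m. m \<in> carrier M \<Longrightarrow> g m = m"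
  shows "tensor_map L M f g U = U"
proof -
  have "tensor_map L M f g U = tensor_lift (tensor L M) (pure_tensor L M) U"
    unfolding tensor_map_def using assms tensor_sub[OF U] by (intro tensor_lift_cong) auto
  also have "\<dots> = U" unfolding tensor_lift_def by (rule tensor_eq_sup_pure[OF c U, symmetric])
  finally show ?thesis .
qed

lemma tensor_assoc_natural:
  assumes f: "f \<in> suplat_hom L L'" and g: "g \<in> suplat_hom M M'" and h: "h \<in> suplat_hom N N'"
    and U: "U \<in> carrier (tensor (tensor L M) N)"
  shows "tensor_assoc L' M' N' (tensor_map (tensor L' M') N' (tensor_map L' M' f g) h U) =
    tensor_map L' (tensor M' N') f (tensor_map M' N' g h) (tensor_assoc L M N U)"
proof -
  note c = suplat_homD(1)[OF f] suplat_homD(1)[OF g] suplat_homD(1)[OF h]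
  note c' = suplat_homD(2)[OF f] suplat_homD(2)[OF g] suplat_homD(2)[OF h]
  note fg = tensor_map_props[OF f g] and gh = tensor_map_props[OF g h]
  note l = tensor_map_props[OF fg(1) h] and r = tensor_map_props[OF f gh(1)]
  note a = tensor_assoc_props[OF c] and a' = tensor_assoc_props[OF c']
  show ?thesis
    by (rule tensor3_hom_ext[OF c suplat_hom_comp[OF l(1) a'(1)] suplat_hom_comp[OF a(1) r(1)] _ U])
      (simp add: l(2) r(2) fg(2) gh(2) a(2) a'(2) pure_tensor_closed c
        suplat_homD(3)[OF f] suplat_homD(3)[OF g] suplat_homD(3)[OF h])
qed

lemma P1_carrier: "carrier P1 = {{}, {()}}"
  by (auto simp: powerset_order_def)

lemma powerset_order_bottom: "\<bottom>\<^bsub>powerset_order A\<^esub> = {}"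
proof -
  interpret complete_lattice "powerset_order A" by (rule powerset_order_complete)
  show ?thesis using bottom_lower[of "{}"] by (simp add: powerset_order_def)
qed

lemma scalar_hom:
  assumes "complete_lattice L"
  shows "(\<lambda>l. if x = {} then \<bottom>\<^bsub>L\<^esub> else l) \<in> suplat_hom L L"
    and "l \<in> carrier L \<Longrightarrow> (\<lambda>x. if x = {} then \<bottom>\<^bsub>L\<^esub> else l) \<in> suplat_hom P1 L"
proof -
  interpret L: complete_lattice L by (fact assms)
  show "(\<lambda>l. if x = {} then \<bottom>\<^bsub>L\<^esub> else l) \<in> suplat_hom L L"
  proof (rule suplat_homI[OF assms assms])
    fix A assume A: "A \<subseteq> carrier L"
    have "\<Squnion>\<^bsub>L\<^esub> ((\<lambda>l. \<bottom>\<^bsub>L\<^esub>) ` A) = \<bottom>\<^bsub>L\<^esub>" by (intro L.sup_eqI) auto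
    then show "(if x = {} then \<bottom>\<^bsub>L\<^esub> else \<Squnion>\<^bsub>L\<^esub> A) = \<Squnion>\<^bsub>L\<^esub> ((\<lambda>l. if x = {} then \<bottom>\<^bsub>L\<^esub> else l) ` A)"
      by simp
  qed auto
  show "(\<lambda>x. if x = {} then \<bottom>\<^bsub>L\<^esub> else l) \<in> suplat_hom P1 L" if l: "l \<in> carrier L"
  proof (rule suplat_homI[OF powerset_order_complete assms])
    fix A assume "A \<subseteq> carrier P1"
    then have "A \<subseteq> Pow {()}" by (simp add: powerset_order_def)
    then have s: "\<Squnion>\<^bsub>P1\<^esub> A = \<Union> A" by (rule powerset_order_sup)
    show "(if \<Squnion>\<^bsub>P1\<^esub> A = {} then \<bottom>\<^bsub>L\<^esub> else l) = \<Squnion>\<^bsub>L\<^esub> ((\<lambda>x. if x = {} then \<bottom>\<^bsub>L\<^esub> else l) ` A)"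
      unfolding s using l by (intro L.sup_eqI[symmetric]) (auto intro: L.le_refl)
  qed (use l in auto)
qed

lemma unitor_bimorphism:
  assumes "complete_lattice L"
  shows "(\<lambda>x l. if x = {} then \<bottom>\<^bsub>L\<^esub> else l) \<in> bimorphism P1 L L"
    and "(\<lambda>l x. if x = {} then \<bottom>\<^bsub>L\<^esub> else l) \<in> bimorphism L P1 L"
  by (auto intro!: bimorphismI scalar_hom[OF assms])

lemma left_unitor_props:
  assumes "complete_lattice L"
  shows "left_unitor L \<in> suplat_hom (tensor P1 L) L"
    and "x \<in> carrier P1 \<Longrightarrow> l \<in> carrier L \<Longrightarrow>
      left_unitor L (pure_tensor P1 L x l) = (if x = {} then \<bottom>\<^bsub>L\<^esub> else l)"
  unfolding left_unitor_def
  by (rule tensor_lift_hom[OF powerset_order_complete assms assms unitor_bimorphism(1)[OF assms]],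
      rule tensor_lift_pure[OF powerset_order_complete assms assms unitor_bimorphism(1)[OF assms]])

lemma right_unitor_props:
  assumes "complete_lattice L"
  shows "right_unitor L \<in> suplat_hom (tensor L P1) L"
    and "x \<in> carrier P1 \<Longrightarrow> l \<in> carrier L \<Longrightarrow>
      right_unitor L (pure_tensor L P1 l x) = (if x = {} then \<bottom>\<^bsub>L\<^esub> else l)"
proof -
  note t = assms powerset_order_complete assms unitor_bimorphism(2)[OF assms]
  show "right_unitor L \<in> suplat_hom (tensor L P1) L"
    unfolding right_unitor_def by (rule tensor_lift_hom[OF t])
  show "x \<in> carrier P1 \<Longrightarrow> l \<in> carrier L \<Longrightarrow>
      right_unitor L (pure_tensor L P1 l x) = (if x = {} then \<bottom>\<^bsub>L\<^esub> else l)"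
    unfolding right_unitor_def by (rule tensor_lift_pure[OF t])
qed

lemma tensor_same_order:
  assumes "carrier L = carrier L'" "eq L = eq L'" "le L = le L'"
    and "carrier M = carrier M'" "eq M = eq M'" "le M = le M'"
  shows "tensor L M = tensor L' M'" "pure_tensor L M = pure_tensor L' M'"
proof -
  have b: "bi_ideal L M = bi_ideal L' M'"
    unfolding bi_ideal_def fun_eq_iff same_order(1)[OF assms(1-3)] same_order(1)[OF assms(4-6)] assms
    by simp
  show "tensor L M = tensor L' M'" "pure_tensor L M = pure_tensor L' M'"
    by (simp add: tensor_def b, intro ext, simp add: pure_tensor_def b)
qed

section \<open>Multiplication and its extension to the tensor square\<close>

lemma hmult_bimorphism:
  assumes "hprod K \<in> suplat_hom (tensor K K) K" "complete_lattice K"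
  shows "hmult K \<in> bimorphism K K K"
proof -
  note p = pure_tensor_bimorphism[OF assms(2) assms(2)]
  show ?thesis unfolding hmult_def
    by (intro bimorphismI suplat_hom_comp[OF bimorphismD(1)[OF p] assms(1)]
      suplat_hom_comp[OF bimorphismD(2)[OF p] assms(1)])
qed

lemma tensor_mult_props:
  assumes h: "hprod K \<in> suplat_hom (tensor K K) K" and c: "complete_lattice K"
  shows "tensor_mult K \<in> bimorphism (tensor K K) (tensor K K) (tensor K K)"
    and "\<lbrakk>a \<in> carrier K; b \<in> carrier K; c \<in> carrier K; d \<in> carrier K\<rbrakk> \<Longrightarrow>
      tensor_mult K (pure_tensor K K a b) (pure_tensor K K c d) =
      pure_tensor K K (hmult K a c) (hmult K b d)"
proof -
  let ?T = "tensor K K"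
  let ?f = "\<lambda>V a b. tensor_lift ?T (\<lambda>c d. pure_tensor K K (hmult K a c) (hmult K b d)) V"
  note m = bimorphismD[OF hmult_bimorphism[OF h c]]
  note T = tensor_complete[OF c c]
  have r: "(\<lambda>c d. pure_tensor K K (hmult K a c) (hmult K b d)) \<in> bimorphism K K ?T"
    and l: "(\<lambda>c d. pure_tensor K K (hmult K c a) (hmult K d b)) \<in> bimorphism K K ?T"
    if "a \<in> carrier K" "b \<in> carrier K" for a b
    using that by (auto intro: tensor_map_bim m)
  have b: "?f V \<in> bimorphism K K ?T" if V: "V \<in> carrier ?T" for V
    by (intro bimorphismI tensor_lift_param[OF c c c T _ _ V] r bimorphismD[OF l])
  show "tensor_mult K \<in> bimorphism ?T ?T ?T"
    unfolding tensor_mult_def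
    by (intro bimorphismI tensor_lift_hom[OF c c T b] tensor_lift_param[OF c c T T b]
      tensor_lift_hom[OF c c T r])
  show "tensor_mult K (pure_tensor K K a b) (pure_tensor K K c d) =
      pure_tensor K K (hmult K a c) (hmult K b d)"
    if a: "a \<in> carrier K" "b \<in> carrier K" "c \<in> carrier K" "d \<in> carrier K" for a b c d
    unfolding tensor_mult_def
    using tensor_lift_pure[OF c c T b[OF pure_tensor_closed[OF c c a(3,4)]] a(1,2)]
      tensor_lift_pure[OF c c T r[OF a(1,2)] a(3,4)] by simp
qed

lemma tensor_mult_natural:
  assumes f: "f \<in> suplat_hom H K"
    and H: "hprod H \<in> suplat_hom (tensor H H) H" and K: "hprod K \<in> suplat_hom (tensor K K) K"
    and mult: "\<And>a b. a \<in> carrier H \<Longrightarrow> b \<in> carrier H \<Longrightarrow> f (hmult H a b) = hmult K (f a) (f b)"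
    and U: "U \<in> carrier (tensor H H)" and V: "V \<in> carrier (tensor H H)"
  shows "tensor_map K K f f (tensor_mult H U V) =
    tensor_mult K (tensor_map K K f f U) (tensor_map K K f f V)"
proof -
  note c = suplat_homD(1)[OF f] and c' = suplat_homD(2)[OF f]
  note tf = tensor_map_props[OF f f]
  note mH = tensor_mult_props[OF H c] and mK = tensor_mult_props[OF K c']
  note hH = bimorphismD[OF hmult_bimorphism[OF H c]]
  show ?thesis
  proof (rule tensor_hom_ext[OF c c suplat_hom_comp[OF bimorphismD(2)[OF mH(1) V] tf(1)]
        suplat_hom_comp[OF tf(1) bimorphismD(2)[OF mK(1) suplat_homD(3)[OF tf(1) V]]] _ U])
    fix a b assume a: "a \<in> carrier H" and b: "b \<in> carrier H"
    note p = pure_tensor_closed[OF c c a b]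
    show "tensor_map K K f f (tensor_mult H (pure_tensor H H a b) V) =
      tensor_mult K (tensor_map K K f f (pure_tensor H H a b)) (tensor_map K K f f V)"
    proof (rule tensor_hom_ext[OF c c suplat_hom_comp[OF bimorphismD(1)[OF mH(1) p] tf(1)]
        suplat_hom_comp[OF tf(1) bimorphismD(1)[OF mK(1) suplat_homD(3)[OF tf(1) p]]] _ V])
      fix a' b' assume "a' \<in> carrier H" "b' \<in> carrier H"
      with a b show "tensor_map K K f f (tensor_mult H (pure_tensor H H a b) (pure_tensor H H a' b')) =
        tensor_mult K (tensor_map K K f f (pure_tensor H H a b)) (tensor_map K K f f (pure_tensor H H a' b'))"
        by (simp add: mH(2) mK(2) tf(2) suplat_homD(3)[OF f] suplat_homD(3)[OF hH(1)] mult)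
    qed
  qed
qed

section \<open>Images and inverses of Hopf algebra morphisms\<close>

text \<open>
  Each axiom of \<open>K\<close> is an equation between composites of structure maps. Naturality of the associator,
  the unitors and the componentwise product moves \<open>f\<close> to the outside of the corresponding
  composite for \<open>H\<close>, where the axiom holds; surjectivity then reaches every element of \<open>K\<close>.
\<close>

theorem suplat_hopf_surjective_image:
  assumes "suplat_hopf H" and f: "f \<in> hopf_hom H K" and surj: "f ` carrier H = carrier K"
    and prod: "hprod K \<in> suplat_hom (tensor K K) K"
    and coprod: "coprod K \<in> suplat_hom K (tensor K K)"
    and counit: "counit K \<in> suplat_hom K P1"
    and antipode: "antipode K \<in> suplat_iso K K"
  shows "suplat_hopf K"
proof -
  interpret H: suplat_hopf H by fact
  have fh: "f \<in> suplat_hom H K"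
    and f_prod: "\<And>t. t \<in> carrier (tensor H H) \<Longrightarrow> f (hprod H t) = hprod K (tensor_map K K f f t)"
    and f_unit: "f (hunit H) = hunit K"
    and f_coprod: "\<And>h. h \<in> carrier H \<Longrightarrow> coprod K (f h) = tensor_map K K f f (coprod H h)"
    and f_counit: "\<And>h. h \<in> carrier H \<Longrightarrow> counit K (f h) = counit H h"
    and f_antipode: "\<And>h. h \<in> carrier H \<Longrightarrow> antipode K (f h) = f (antipode H h)"
    using f by (auto simp: hopf_hom_def)
  note cH = suplat_homD(1)[OF fh] and cK = suplat_homD(2)[OF fh] and fc = suplat_homD(3)[OF fh]
  note ff = tensor_map_props[OF fh fh]
  note idH = suplat_hom_id[OF cH] and idK = suplat_hom_id[OF cK]
  note Hc = suplat_homD(3)[OF H.coprod_hom]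
  note hH = bimorphismD[OF hmult_bimorphism[OF H.prod_hom cH]]
  have SH: "antipode H \<in> suplat_hom H H" and SK: "antipode K \<in> suplat_hom K K"
    using H.antipode_iso antipode by (auto simp: suplat_iso_def)
  have mult: "f (hmult H a b) = hmult K (f a) (f b)" if "a \<in> carrier H" "b \<in> carrier H" for a b
    using that by (simp add: hmult_def f_prod pure_tensor_closed[OF cH cH] ff(2))
  have mc: "hmult H a b \<in> carrier H" if "a \<in> carrier H" "b \<in> carrier H" for a b
    by (rule suplat_homD(3)[OF hH(1)]) fact+
  have cases: "\<exists>h \<in> carrier H. x = f h" if "x \<in> carrier K" for x
    using that surj by auto
  have coassoc: "tensor_assoc K K K (tensor_map (tensor K K) K (coprod K) id (coprod K (f h))) =
      tensor_map K (tensor K K) id (coprod K) (coprod K (f h))" if h: "h \<in> carrier H" for h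
  proof -
    note fff = tensor_map_props[OF ff(1) fh] and fff' = tensor_map_props[OF fh ff(1)]
    note dH = tensor_map_props[OF H.coprod_hom idH] and dK = tensor_map_props[OF coprod idK]
    note dH' = tensor_map_props[OF idH H.coprod_hom] and dK' = tensor_map_props[OF idK coprod]
    have l: "tensor_map (tensor K K) K (coprod K) id (tensor_map K K f f U) =
        tensor_map (tensor K K) K (tensor_map K K f f) f (tensor_map (tensor H H) H (coprod H) id U)"
      if U: "U \<in> carrier (tensor H H)" for U
      by (rule tensor_hom_ext[OF cH cH suplat_hom_comp[OF ff(1) dK(1)] suplat_hom_comp[OF dH(1) fff(1)] _ U])
        (simp add: ff(2) dK(2) dH(2) fff(2) fc Hc f_coprod)
    have r: "tensor_map K (tensor K K) id (coprod K) (tensor_map K K f f U) =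
        tensor_map K (tensor K K) f (tensor_map K K f f) (tensor_map H (tensor H H) id (coprod H) U)"
      if U: "U \<in> carrier (tensor H H)" for U
      by (rule tensor_hom_ext[OF cH cH suplat_hom_comp[OF ff(1) dK'(1)] suplat_hom_comp[OF dH'(1) fff'(1)] _ U])
        (simp add: ff(2) dK'(2) dH'(2) fff'(2) fc Hc f_coprod)
    show ?thesis
      using h by (simp add: f_coprod l r Hc suplat_homD(3)[OF dH(1)] H.coassoc
          tensor_assoc_natural[OF fh fh fh])
  qed
  have counit_l: "left_unitor K (tensor_map P1 K (counit K) id (coprod K (f h))) = f h"
    if h: "h \<in> carrier H" for h
  proof -
    note eH = tensor_map_props[OF H.counit_hom idH] and eK = tensor_map_props[OF counit idK]
    note uH = left_unitor_props[OF cH] and uK = left_unitor_props[OF cK]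
    have "left_unitor K (tensor_map P1 K (counit K) id (tensor_map K K f f U)) =
        f (left_unitor H (tensor_map P1 H (counit H) id U))" if U: "U \<in> carrier (tensor H H)" for U
      by (rule tensor_hom_ext[OF cH cH suplat_hom_comp[OF ff(1) suplat_hom_comp[OF eK(1) uK(1)]]
            suplat_hom_comp[OF suplat_hom_comp[OF eH(1) uH(1)] fh] _ U])
        (simp add: ff(2) eK(2) eH(2) uK(2) uH(2) fc suplat_homD(3)[OF H.counit_hom] f_counit
          suplat_hom_bottom[OF fh])
    then show ?thesis using h by (simp add: f_coprod Hc H.counit)
  qed
  have counit_r: "right_unitor K (tensor_map K P1 id (counit K) (coprod K (f h))) = f h"
    if h: "h \<in> carrier H" for h
  proof -
    note eH = tensor_map_props[OF idH H.counit_hom] and eK = tensor_map_props[OF idK counit]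
    note uH = right_unitor_props[OF cH] and uK = right_unitor_props[OF cK]
    have "right_unitor K (tensor_map K P1 id (counit K) (tensor_map K K f f U)) =
        f (right_unitor H (tensor_map H P1 id (counit H) U))" if U: "U \<in> carrier (tensor H H)" for U
      by (rule tensor_hom_ext[OF cH cH suplat_hom_comp[OF ff(1) suplat_hom_comp[OF eK(1) uK(1)]]
            suplat_hom_comp[OF suplat_hom_comp[OF eH(1) uH(1)] fh] _ U])
        (simp add: ff(2) eK(2) eH(2) uK(2) uH(2) fc suplat_homD(3)[OF H.counit_hom] f_counit
          suplat_hom_bottom[OF fh])
    then show ?thesis using h by (simp add: f_coprod Hc H.counit)
  qed
  have convolution: "hprod K (tensor_map K K p q (tensor_map K K f f U)) =
      f (hprod H (tensor_map H H p' q' U))"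
    if p: "p \<in> suplat_hom K K" "p' \<in> suplat_hom H H" "\<And>h. h \<in> carrier H \<Longrightarrow> p (f h) = f (p' h)"
      and q: "q \<in> suplat_hom K K" "q' \<in> suplat_hom H H" "\<And>h. h \<in> carrier H \<Longrightarrow> q (f h) = f (q' h)"
      and U: "U \<in> carrier (tensor H H)" for p p' q q' U
    by (rule tensor_hom_ext[OF cH cH
          suplat_hom_comp[OF ff(1) suplat_hom_comp[OF tensor_map_props(1)[OF p(1) q(1)] prod]]
          suplat_hom_comp[OF suplat_hom_comp[OF tensor_map_props(1)[OF p(2) q(2)] H.prod_hom] fh] _ U])
      (simp add: ff(2) tensor_map_props(2)[OF p(1) q(1)] tensor_map_props(2)[OF p(2) q(2)] fc p q
        mult[unfolded hmult_def] suplat_homD(3)[OF p(2)] suplat_homD(3)[OF q(2)])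
  show ?thesis
  proof (rule suplat_hopf.intro)
    fix x assume "x \<in> carrier K"
    then obtain h where h: "h \<in> carrier H" "x = f h" using cases by blast
    show "hmult K (hunit K) x = x" "hmult K x (hunit K) = x"
      using h mult[of "hunit H" h] mult[of h "hunit H"]
      by (simp_all add: H.unit_closed f_unit H.prod_unit)
    show "tensor_assoc K K K (tensor_map (tensor K K) K (coprod K) id (coprod K x)) =
      tensor_map K (tensor K K) id (coprod K) (coprod K x)" using h coassoc by simp
    show "left_unitor K (tensor_map P1 K (counit K) id (coprod K x)) = x"
      "right_unitor K (tensor_map K P1 id (counit K) (coprod K x)) = x"
      using h counit_l counit_r by simp_all
    show "hprod K (tensor_map K K id (antipode K) (coprod K x)) =
      (if counit K x = {()} then hunit K else \<bottom>\<^bsub>K\<^esub>)"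
      using h convolution[OF idK idH _ SK SH, of "coprod H h"]
      by (simp add: f_coprod f_counit f_antipode Hc H.antipode_right f_unit suplat_hom_bottom[OF fh])
    show "hprod K (tensor_map K K (antipode K) id (coprod K x)) =
      (if counit K x = {()} then hunit K else \<bottom>\<^bsub>K\<^esub>)"
      using h convolution[OF SK SH _ idK idH, of "coprod H h"]
      by (simp add: f_coprod f_counit f_antipode Hc H.antipode_left f_unit suplat_hom_bottom[OF fh])
    fix y assume "y \<in> carrier K"
    then obtain k where k: "k \<in> carrier H" "y = f k" using cases by blast
    show "counit K (hmult K x y) = {()} \<longleftrightarrow> counit K x = {()} \<and> counit K y = {()}"
      using h k by (simp add: mult[symmetric] f_counit mc H.counit_prod)
    show "coprod K (hmult K x y) = tensor_mult K (coprod K x) (coprod K y)"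
      using h k by (simp add: mult[symmetric] f_coprod mc H.coprod_prod Hc
          tensor_mult_natural[OF fh H.prod_hom prod mult])
    fix z assume "z \<in> carrier K"
    then obtain l where l: "l \<in> carrier H" "z = f l" using cases by blast
    show "hmult K (hmult K x y) z = hmult K x (hmult K y z)"
      using h k l by (simp add: mult[symmetric] mc H.prod_assoc)
  next
    show "hunit K \<in> carrier K" using fc[OF H.unit_closed] f_unit by simp
    show "coprod K (hunit K) = pure_tensor K K (hunit K) (hunit K)"
      using f_coprod[OF H.unit_closed] by (simp add: H.coprod_unit ff(2) H.unit_closed f_unit)
    show "counit K (hunit K) = {()}"
      using f_counit[OF H.unit_closed] by (simp add: H.counit_unit f_unit)
  qed fact+
qed

lemma suplat_hom_inverse:
  assumes f: "f \<in> suplat_hom L M"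
    and g: "\<And>y. y \<in> carrier M \<Longrightarrow> g y \<in> carrier L"
    and gf: "\<And>x. x \<in> carrier L \<Longrightarrow> g (f x) = x" and fg: "\<And>y. y \<in> carrier M \<Longrightarrow> f (g y) = y"
  shows "g \<in> suplat_hom M L"
proof (rule suplat_hom_factor[OF f])
  show "f ` carrier L = carrier M"
    using suplat_homD(3)[OF f] g fg by (auto simp: image_iff) metis
  show "g (f x) = id x" if "x \<in> carrier L" for x using gf[OF that] by simp
qed (rule suplat_hom_id[OF suplat_homD(1)[OF f]])

text \<open>
  Inverse pairs induce inverse pairs on tensor squares, so each compatibility condition for \<open>f\<close> can
  be solved for \<open>g\<close>.
\<close>

lemma hopf_hom_inverse:
  assumes f: "f \<in> hopf_hom H K" and "suplat_hopf H" "suplat_hopf K"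
    and g: "\<And>y. y \<in> carrier K \<Longrightarrow> g y \<in> carrier H"
    and gf: "\<And>x. x \<in> carrier H \<Longrightarrow> g (f x) = x" and fg: "\<And>y. y \<in> carrier K \<Longrightarrow> f (g y) = y"
  shows "g \<in> hopf_hom K H"
proof -
  interpret H: suplat_hopf H by fact
  interpret K: suplat_hopf K by fact
  have SH: "antipode H \<in> suplat_hom H H" using H.antipode_iso by (simp add: suplat_iso_def)
  have fh: "f \<in> suplat_hom H K" using f by (simp add: hopf_hom_def)
  have gh: "g \<in> suplat_hom K H" by (rule suplat_hom_inverse[OF fh g gf fg])
  note ff = suplat_homD(3)[OF tensor_map_props(1)[OF fh fh]]
  note gg = suplat_homD(3)[OF tensor_map_props(1)[OF gh gh]]
  have fg2: "tensor_map K K f f (tensor_map H H g g t) = t" if "t \<in> carrier (tensor K K)" for t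
    using that tensor_map_comp[OF gh fh gh fh that] tensor_map_ident[OF K.complete K.complete that]
    by (simp add: fg)
  have gf2: "tensor_map H H g g (tensor_map K K f f t) = t" if "t \<in> carrier (tensor H H)" for t
    using that tensor_map_comp[OF fh gh fh gh that] tensor_map_ident[OF H.complete H.complete that]
    by (simp add: gf)
  note fd = f[unfolded hopf_hom_def, simplified]
  show ?thesis
    unfolding hopf_hom_def mem_Collect_eq
  proof (intro conjI ballI)
    show "g \<in> suplat_hom K H" by (rule gh)
    show "g (hunit K) = hunit H" using fd gf[OF H.unit_closed] by simp
    fix t assume t: "t \<in> carrier (tensor K K)"
    have "hprod K t = f (hprod H (tensor_map H H g g t))"
      using fd gg[OF t] fg2[OF t] by simp
    then show "g (hprod K t) = hprod H (tensor_map H H g g t)"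
      using gf suplat_homD(3)[OF H.prod_hom gg[OF t]] by simp
  next
    fix k assume k: "k \<in> carrier K"
    note gk = g[OF k]
    have "coprod K k = tensor_map K K f f (coprod H (g k))" using fd gk fg[OF k] by metis
    then show "coprod H (g k) = tensor_map H H g g (coprod K k)"
      using gf2 suplat_homD(3)[OF H.coprod_hom gk] by simp
    show "counit H (g k) = counit K k" using fd gk fg[OF k] by metis
    have "antipode K k = f (antipode H (g k))" using fd gk fg[OF k] by metis
    then show "antipode H (g k) = g (antipode K k)"
      using gf suplat_homD(3)[OF SH gk] by simp
  qed
qed

section \<open>The counit in Sweedler style\<close>

context suplat_hopf
begin

interpretation L: complete_lattice H by (fact complete)

lemma coprod_sub: "h \<in> carrier H \<Longrightarrow> coprod H h \<subseteq> carrier H \<times> carrier H"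
  by (rule tensor_sub[OF suplat_homD(3)[OF coprod_hom]])

lemma antipode_hom: "antipode H \<in> suplat_hom H H"
  using antipode_iso by (simp add: suplat_iso_def)

lemma hmult_closed: "a \<in> carrier H \<Longrightarrow> b \<in> carrier H \<Longrightarrow> hmult H a b \<in> carrier H"
  by (rule suplat_homD(3)[OF bimorphismD(1)[OF hmult_bimorphism[OF prod_hom complete]]])

lemma counit_two_valued: "h \<in> carrier H \<Longrightarrow> counit H h \<noteq> {()} \<longleftrightarrow> counit H h = {}"
  using suplat_homD(3)[OF counit_hom, of h] by (auto simp: P1_carrier)

lemma counit_bottom: "counit H \<bottom> = {}"
  using suplat_hom_bottom[OF counit_hom] powerset_order_bottom by simp

text \<open>
  The counit laws in Sweedler form. Elements of the tensor square are sets of pairs, so \<open>h\<close> is the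
  join of the second entries of the pairs in its comultiplication whose first entry is visible
  to the counit, and symmetrically.
\<close>

lemma counit_expansion:
  assumes h: "h \<in> carrier H"
  shows "tensor_lift H (\<lambda>a b. if counit H a = {} then \<bottom> else b) (coprod H h) = h"
    and "tensor_lift H (\<lambda>a b. if counit H b = {} then \<bottom> else a) (coprod H h) = h"
proof -
  note s = coprod_sub[OF h] and c = suplat_homD(3)[OF coprod_hom h]
  note P = powerset_order_complete and e = suplat_homD(3)[OF counit_hom]
  have "h = tensor_lift H (\<lambda>a b. left_unitor H (pure_tensor P1 H (counit H a) (id b))) (coprod H h)"
    using hom_tensor_map[OF P complete left_unitor_props(1)[OF complete] _ _ c, of "counit H" id] e counit(1)[OF h]
    by simp
  also have "\<dots> = tensor_lift H (\<lambda>a b. if counit H a = {} then \<bottom> else b) (coprod H h)"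
    using s e left_unitor_props(2)[OF complete] by (intro tensor_lift_cong) (metis id_apply mem_Sigma_iff subsetD)
  finally show "tensor_lift H (\<lambda>a b. if counit H a = {} then \<bottom> else b) (coprod H h) = h" ..
  have "h = tensor_lift H (\<lambda>a b. right_unitor H (pure_tensor H P1 (id a) (counit H b))) (coprod H h)"
    using hom_tensor_map[OF complete P right_unitor_props(1)[OF complete] _ _ c, of id "counit H"] e counit(2)[OF h]
    by simp
  also have "\<dots> = tensor_lift H (\<lambda>a b. if counit H b = {} then \<bottom> else a) (coprod H h)"
    using s e right_unitor_props(2)[OF complete] by (intro tensor_lift_cong) (metis id_apply mem_Sigma_iff subsetD)
  finally show "tensor_lift H (\<lambda>a b. if counit H b = {} then \<bottom> else a) (coprod H h) = h" ..
qed

lemma coprod_le: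
  assumes h: "h \<in> carrier H" and ab: "(a, b) \<in> coprod H h"
  shows "counit H a \<noteq> {} \<Longrightarrow> b \<sqsubseteq> h" "counit H b \<noteq> {} \<Longrightarrow> a \<sqsubseteq> h"
proof -
  have up: "f a b \<sqsubseteq> h" if "tensor_lift H f (coprod H h) = h"
    "\<And>a b. a \<in> carrier H \<Longrightarrow> b \<in> carrier H \<Longrightarrow> f a b \<in> carrier H" for f
  proof -
    have "(\<lambda>(a, b). f a b) ` coprod H h \<subseteq> carrier H" using coprod_sub[OF h] that(2) by auto
    then have "f a b \<sqsubseteq> tensor_lift H f (coprod H h)"
      unfolding tensor_lift_def using ab by (intro L.weak.sup_upper) auto
    then show ?thesis using that(1) by simp
  qed
  show "counit H a \<noteq> {} \<Longrightarrow> b \<sqsubseteq> h" using up[OF counit_expansion(1)[OF h]] by simp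
  show "counit H b \<noteq> {} \<Longrightarrow> a \<sqsubseteq> h" using up[OF counit_expansion(2)[OF h]] by simp
qed

lemma convolution_expansion:
  assumes h: "h \<in> carrier H" and p: "\<And>a. a \<in> carrier H \<Longrightarrow> p a \<in> carrier H"
    and q: "\<And>a. a \<in> carrier H \<Longrightarrow> q a \<in> carrier H"
  shows "hprod H (tensor_map H H p q (coprod H h)) =
    tensor_lift H (\<lambda>a b. hmult H (p a) (q b)) (coprod H h)"
  unfolding hmult_def
  by (rule hom_tensor_map[OF complete complete prod_hom p q suplat_homD(3)[OF coprod_hom h]])

text \<open>
  Applying the counit to the antipode axiom gives on one side the join of
  $\epsilon(a) \wedge \epsilon(S(b))$ over $(a,b) \le \Delta(h)$. As $\epsilon S$ preserves joins, this is
  $\epsilon S$ of the join of those $b$ with $\epsilon(a) = 1$, and that join is $h$ by the counit law.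
\<close>

lemma counit_antipode:
  assumes h: "h \<in> carrier H"
  shows "counit H (antipode H h) = counit H h"
proof -
  note s = coprod_sub[OF h] and S = suplat_homD(3)[OF antipode_hom]
  have "counit H h = counit H (if counit H h = {()} then hunit H else \<bottom>)"
    using counit_two_valued[OF h] by (auto simp: counit_unit counit_bottom)
  also have "\<dots> = counit H (tensor_lift H (\<lambda>a b. hmult H a (antipode H b)) (coprod H h))"
    using antipode_right[OF h] convolution_expansion[OF h, of id "antipode H"] S by simp
  also have "\<dots> = tensor_lift P1 (\<lambda>a b. counit H (hmult H a (antipode H b))) (coprod H h)"
    using s S by (intro hom_tensor_lift[OF counit_hom]) (auto intro: hmult_closed)
  also have "\<dots> = tensor_lift P1 (\<lambda>a b. counit H (antipode H (if counit H a = {} then \<bottom> else b))) (coprod H h)"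
  proof (rule tensor_lift_cong)
    fix a b assume "(a, b) \<in> coprod H h"
    then have a: "a \<in> carrier H" and b: "antipode H b \<in> carrier H" using s S by auto
    show "counit H (hmult H a (antipode H b)) = counit H (antipode H (if counit H a = {} then \<bottom> else b))"
      using counit_prod[OF a b] counit_two_valued[OF a] counit_two_valued[OF b]
        counit_two_valued[OF hmult_closed[OF a b]]
      by (auto simp: suplat_hom_bottom[OF antipode_hom] counit_bottom)
  qed
  also have "\<dots> = counit H (antipode H h)"
    using s by (subst counit_expansion(1)[OF h, symmetric],
      intro hom_tensor_lift[OF suplat_hom_comp[OF antipode_hom counit_hom], symmetric]) auto
  finally show ?thesis ..
qed

section \<open>The quotient by the kernel of the counit\<close>

lemma kernel_top_closed: "kernel_top H \<in> carrier H"
  unfolding kernel_top_def by (rule L.weak.sup_closed) auto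

lemma counit_kernel_top: "counit H (kernel_top H) = {}"
proof -
  have "counit H (kernel_top H) = \<Squnion>\<^bsub>P1\<^esub> (counit H ` {h \<in> carrier H. counit H h = {}})"
    unfolding kernel_top_def by (rule suplat_homD(4)[OF counit_hom]) auto
  also have "\<dots> = \<Union> (counit H ` {h \<in> carrier H. counit H h = {}})"
    by (rule powerset_order_sup) auto
  finally show ?thesis by auto
qed

lemma le_kernel_top: "h \<in> carrier H \<Longrightarrow> h \<sqsubseteq> kernel_top H \<longleftrightarrow> counit H h = {}"
proof
  assume "h \<in> carrier H" "h \<sqsubseteq> kernel_top H"
  then show "counit H h = {}"
    using suplat_hom_mono[OF counit_hom _ kernel_top_closed] counit_kernel_top
    by (auto simp: powerset_order_def)
next
  assume "h \<in> carrier H" "counit H h = {}"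
  then show "h \<sqsubseteq> kernel_top H" unfolding kernel_top_def by (intro L.weak.sup_upper) auto
qed

text \<open>
  The section followed by the projection adds the top of the kernel as a joinand, which a map that kills
  it does not see. Every structure map of the quotient is evaluated through this lemma.
\<close>

lemma hom_section_proj:
  assumes f: "f \<in> suplat_hom H K" and D: "f (kernel_top H) = \<bottom>\<^bsub>K\<^esub>" and h: "h \<in> carrier H"
  shows "f (quot_section H (quot_proj H h)) = f h"
proof -
  interpret K: complete_lattice K by (rule suplat_homD(2)[OF f])
  have "f (quot_section H (quot_proj H h)) = f h \<squnion>\<^bsub>K\<^esub> \<bottom>\<^bsub>K\<^esub>"
    using D by (simp add: quot_section_proj[OF h] suplat_hom_join[OF f h kernel_top_closed])
  also have "\<dots> = f h"
    unfolding join_def using suplat_homD(3)[OF f h] by (intro K.sup_eqI) (auto intro: K.le_refl)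
  finally show ?thesis .
qed

lemma quot_hopf_order:
  "carrier (quot_hopf H) = carrier (quot_lattice H)" "eq (quot_hopf H) = eq (quot_lattice H)"
  "le (quot_hopf H) = le (quot_lattice H)"
  by (simp_all add: quot_hopf_def Let_def)

lemma quot_proj_hom: "quot_proj H \<in> suplat_hom H (quot_hopf H)"
proof -
  note p = quot_coequalizer(1)
  show ?thesis
  proof (rule suplat_homI[OF complete])
    show "complete_lattice (quot_hopf H)"
      using same_order(2)[OF quot_hopf_order] suplat_homD(2)[OF p] by simp
    show "quot_proj H x \<in> carrier (quot_hopf H)" if "x \<in> carrier H" for x
      using suplat_homD(3)[OF p that] by (simp add: quot_hopf_order)
    show "quot_proj H (\<Squnion> A) = \<Squnion>\<^bsub>quot_hopf H\<^esub> (quot_proj H ` A)" if "A \<subseteq> carrier H" for A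
      using suplat_homD(4)[OF p that] same_order(1)[OF quot_hopf_order] by simp
  qed
qed

lemma quot_proj_surj: "quot_proj H ` carrier H = carrier (quot_hopf H)"
  by (auto simp: quot_hopf_order quot_lattice_def quot_proj_def quotient_def)

lemma quot_proj_eq_bottom_iff:
  assumes h: "h \<in> carrier H"
  shows "quot_proj H h = \<bottom>\<^bsub>quot_hopf H\<^esub> \<longleftrightarrow> counit H h = {}"
proof -
  have b: "\<bottom>\<^bsub>quot_hopf H\<^esub> = quot_proj H \<bottom>"
    using suplat_hom_bottom[OF quot_proj_hom] by simp
  have "quot_proj H h = quot_proj H \<bottom> \<Longrightarrow> counit H h = {}"
    using hom_section_proj[OF counit_hom, of h] hom_section_proj[OF counit_hom, of \<bottom>] h
    by (simp add: counit_kernel_top powerset_order_bottom counit_bottom)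
  moreover have "quot_proj H h = \<bottom>\<^bsub>quot_hopf H\<^esub>" if "counit H h = {}"
    using quot_coequalizer(2)[OF h that] same_order(3)[OF quot_hopf_order] by simp
  ultimately show ?thesis using b by auto
qed

lemma quot_section_closed: "x \<in> carrier (quot_hopf H) \<Longrightarrow> quot_section H x \<in> carrier H"
  unfolding quot_proj_surj[symmetric] using kernel_top_closed by (auto simp: quot_section_proj)

text \<open>
  The kernel of a multiplicative counit is a two-sided ideal.
\<close>

lemma quot_mult_section_proj:
  assumes a: "a \<in> carrier H" and b: "b \<in> carrier H"
  shows "quot_proj H (hmult H (quot_section H (quot_proj H a)) (quot_section H (quot_proj H b))) =
    quot_proj H (hmult H a b)"
proof -
  note m = bimorphismD[OF hmult_bimorphism[OF prod_hom complete]]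
  note D = kernel_top_closed
  have zero: "quot_proj H (hmult H x y) = \<bottom>\<^bsub>quot_hopf H\<^esub>"
    if "x \<in> carrier H" "y \<in> carrier H" "x = kernel_top H \<or> y = kernel_top H" for x y
    using that quot_proj_eq_bottom_iff[OF hmult_closed] counit_prod[of x y] counit_kernel_top
      counit_two_valued[OF hmult_closed[OF that(1,2)]] by auto
  have s: "quot_section H (quot_proj H b) \<in> carrier H"
    by (rule quot_section_closed[OF suplat_homD(3)[OF quot_proj_hom b]])
  have "quot_proj H (hmult H (quot_section H (quot_proj H a)) (quot_section H (quot_proj H b))) =
      quot_proj H (hmult H a (quot_section H (quot_proj H b)))"
    by (rule hom_section_proj[OF suplat_hom_comp[OF m(2)[OF s] quot_proj_hom] _ a]) (use s D zero in auto)
  also have "\<dots> = quot_proj H (hmult H a b)"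
    by (rule hom_section_proj[OF suplat_hom_comp[OF m(1)[OF a] quot_proj_hom] _ b]) (use a D zero in auto)
  finally show ?thesis .
qed

text \<open>
  If $(a,b) \le \Delta(D)$ and $b$ has nonempty counit, then $a \le D$ by the counit law. So one entry of each
  pair vanishes in the quotient.
\<close>

lemma quot_coprod_kernel_top:
  "tensor_map (quot_hopf H) (quot_hopf H) (quot_proj H) (quot_proj H) (coprod H (kernel_top H)) =
    \<bottom>\<^bsub>tensor (quot_hopf H) (quot_hopf H)\<^esub>"
proof -
  let ?Q = "quot_hopf H"
  note cQ = suplat_homD(2)[OF quot_proj_hom] and pc = suplat_homD(3)[OF quot_proj_hom]
  interpret T: complete_lattice "tensor ?Q ?Q" by (rule tensor_complete[OF cQ cQ])
  note p = bimorphismD[OF pure_tensor_bimorphism[OF cQ cQ]]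
  have "pure_tensor ?Q ?Q (quot_proj H a) (quot_proj H b) = \<bottom>\<^bsub>tensor ?Q ?Q\<^esub>"
    if ab: "(a, b) \<in> coprod H (kernel_top H)" for a b
  proof -
    have c: "a \<in> carrier H" "b \<in> carrier H"
      using ab coprod_sub[OF kernel_top_closed] by auto
    have "counit H a = {} \<or> counit H b = {}"
      using coprod_le(2)[OF kernel_top_closed ab] le_kernel_top[OF c(1)] by auto
    then show ?thesis
      using suplat_hom_bottom[OF p(1)[OF pc[OF c(1)]]] suplat_hom_bottom[OF p(2)[OF pc[OF c(2)]]]
        quot_proj_eq_bottom_iff[OF c(1)] quot_proj_eq_bottom_iff[OF c(2)] by metis
  qed
  then have "(\<lambda>(a, b). pure_tensor ?Q ?Q (quot_proj H a) (quot_proj H b)) ` coprod H (kernel_top H)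
      \<subseteq> {\<bottom>\<^bsub>tensor ?Q ?Q\<^esub>}" by auto
  then show ?thesis
    unfolding tensor_map_def tensor_lift_def by (intro T.sup_eqI) auto
qed

text \<open>
  Each structure map of the quotient is determined by what it does after the projection, where it
  agrees with the structure map of \<open>H\<close> followed by the projection. Hence the structure maps
  preserve joins, the projection is a morphism, and the axioms pass to the image. The counit of the quotient vanishes only
  at bottom since everything with empty counit has been collapsed.
\<close>

theorem quot_hopf_hopf:
  shows "suplat_hopf (quot_hopf H)"
    and "\<And>x. x \<in> carrier (quot_hopf H) \<Longrightarrow> counit (quot_hopf H) x = {} \<Longrightarrow> x = \<bottom>\<^bsub>quot_hopf H\<^esub>"
proof -
  let ?Q = "quot_hopf H" and ?p = "quot_proj H" and ?s = "quot_section H"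
  note p = quot_proj_hom and surj = quot_proj_surj
  note cQ = suplat_homD(2)[OF p] and pc = suplat_homD(3)[OF p]
  note pp = tensor_map_props[OF p p]
  note m = bimorphismD[OF hmult_bimorphism[OF prod_hom complete]]
  have Q: "hunit ?Q = ?p (hunit H)" "hprod ?Q U = ?p (hprod H (tensor_map H H ?s ?s U))"
    "counit ?Q x = counit H (?s x)" "antipode ?Q x = ?p (antipode H (?s x))"
    "coprod ?Q x = tensor_map (quot_lattice H) (quot_lattice H) ?p ?p (coprod H (?s x))" for U x
    by (simp_all add: quot_hopf_def Let_def)
  have "tensor_map (quot_lattice H) (quot_lattice H) ?p ?p = tensor_map ?Q ?Q ?p ?p"
    unfolding tensor_map_def by (simp add: tensor_same_order[OF quot_hopf_order quot_hopf_order])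
  then have Q_coprod: "coprod ?Q (?p h) = tensor_map ?Q ?Q ?p ?p (coprod H h)" if "h \<in> carrier H" for h
    using hom_section_proj[OF suplat_hom_comp[OF coprod_hom pp(1)] quot_coprod_kernel_top that] Q(5) by simp
  have Q_counit: "counit ?Q (?p h) = counit H h" if "h \<in> carrier H" for h
    using hom_section_proj[OF counit_hom _ that]
    by (simp add: Q counit_kernel_top powerset_order_bottom)
  have pS: "?p (S (?s (?p h))) = ?p (S h)"
    if "S \<in> suplat_hom H H" "\<And>h. h \<in> carrier H \<Longrightarrow> counit H (S h) = counit H h" "h \<in> carrier H" for S h
    by (rule hom_section_proj[OF suplat_hom_comp[OF that(1) p] _ that(3)])
      (use that kernel_top_closed suplat_homD(3)[OF that(1)] in
        \<open>simp add: quot_proj_eq_bottom_iff counit_kernel_top\<close>)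
  note factor = suplat_hom_factor[OF p surj]
  note Q_antipode = pS[OF antipode_hom counit_antipode, folded Q(4)]
  \<comment> \<open>The section does not preserve the empty join, so this is not by itself a composite of
    join-preserving maps. With one argument fixed and the projection applied to the other, it becomes
    multiplication by a fixed element of \<open>H\<close> followed by the projection.\<close>
  have mult_bim: "(\<lambda>x y. ?p (hmult H (?s x) (?s y))) \<in> bimorphism ?Q ?Q ?Q"
  proof (rule bimorphismI)
    fix x assume "x \<in> carrier ?Q"
    then obtain a where a: "a \<in> carrier H" "x = ?p a" using surj by auto
    have eq: "?p (hmult H (?s x) (?s (?p b))) = ?p (hmult H a b)" if "b \<in> carrier H" for b
      using quot_mult_section_proj a that by simp
    show "(\<lambda>y. ?p (hmult H (?s x) (?s y))) \<in> suplat_hom ?Q ?Q"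
      by (rule factor[OF suplat_hom_comp[OF m(1)[OF a(1)] p] eq])
  next
    fix y assume "y \<in> carrier ?Q"
    then obtain b where b: "b \<in> carrier H" "y = ?p b" using surj by auto
    have eq: "?p (hmult H (?s (?p a)) (?s y)) = ?p (hmult H a b)" if "a \<in> carrier H" for a
      using quot_mult_section_proj b that by simp
    show "(\<lambda>x. ?p (hmult H (?s x) (?s y))) \<in> suplat_hom ?Q ?Q"
      by (rule factor[OF suplat_hom_comp[OF m(2)[OF b(1)] p] eq])
  qed
  have Q_prod: "hprod ?Q U = tensor_lift ?Q (\<lambda>x y. ?p (hmult H (?s x) (?s y))) U"
    if "U \<in> carrier (tensor ?Q ?Q)" for U
    unfolding Q(2) hmult_def
    by (rule hom_tensor_map[OF complete complete suplat_hom_comp[OF prod_hom p] _ _ that])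
      (rule quot_section_closed, assumption)+
  have prod: "hprod ?Q \<in> suplat_hom (tensor ?Q ?Q) ?Q"
    by (rule suplat_hom_cong[OF tensor_lift_hom[OF cQ cQ cQ mult_bim] Q_prod])
  have p_prod: "?p (hprod H t) = hprod ?Q (tensor_map ?Q ?Q ?p ?p t)" if t: "t \<in> carrier (tensor H H)" for t
  proof (rule tensor_hom_ext[OF complete complete suplat_hom_comp[OF prod_hom p] suplat_hom_comp[OF pp(1) prod] _ t])
    fix a b assume ab: "a \<in> carrier H" "b \<in> carrier H"
    then show "?p (hprod H (pure_tensor H H a b)) = hprod ?Q (tensor_map ?Q ?Q ?p ?p (pure_tensor H H a b))"
      using tensor_lift_pure[OF cQ cQ cQ mult_bim pc[OF ab(1)] pc[OF ab(2)]]
      by (simp add: pp(2) Q_prod pc pure_tensor_closed[OF cQ cQ] quot_mult_section_proj[OF ab])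
        (simp add: hmult_def)
  qed
  have hopf_hom: "?p \<in> hopf_hom H ?Q"
    using p p_prod by (simp add: hopf_hom_def Q_coprod Q_counit Q_antipode Q(1))
  have antipode: "antipode ?Q \<in> suplat_iso ?Q ?Q"
  proof -
    obtain T where T: "T \<in> suplat_hom H H" "\<And>h. h \<in> carrier H \<Longrightarrow> T (antipode H h) = h"
      "\<And>h. h \<in> carrier H \<Longrightarrow> antipode H (T h) = h"
      using antipode_iso by (auto simp: suplat_iso_def)
    note Tc = suplat_homD(3)[OF T(1)] and Sc = suplat_homD(3)[OF antipode_hom]
    have Te: "counit H (T h) = counit H h" if "h \<in> carrier H" for h
      using counit_antipode[OF Tc[OF that]] T(3)[OF that] by simp
    let ?T = "\<lambda>x. ?p (T (?s x))"
    note QT = pS[OF T(1) Te]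
    have "antipode ?Q \<in> suplat_hom ?Q ?Q"
      by (rule factor[OF suplat_hom_comp[OF antipode_hom p] Q_antipode])
    moreover have "?T \<in> suplat_hom ?Q ?Q"
      by (rule factor[OF suplat_hom_comp[OF T(1) p] QT])
    moreover have "?T (antipode ?Q x) = x \<and> antipode ?Q (?T x) = x" if x: "x \<in> carrier ?Q" for x
    proof -
      obtain h where "h \<in> carrier H" "x = ?p h" using x unfolding surj[symmetric] by auto
      then show ?thesis by (simp add: Q_antipode QT Tc Sc T)
    qed
    ultimately show ?thesis
      unfolding suplat_iso_def mem_Collect_eq by (intro conjI bexI[of _ ?T] ballI) simp_all
  qed
  show "suplat_hopf ?Q"
  proof (rule suplat_hopf_surjective_image[OF suplat_hopf_axioms hopf_hom surj prod])
    show "coprod ?Q \<in> suplat_hom ?Q (tensor ?Q ?Q)"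
      by (rule factor[OF suplat_hom_comp[OF coprod_hom pp(1)] Q_coprod])
    show "counit ?Q \<in> suplat_hom ?Q P1" by (rule factor[OF counit_hom Q_counit])
  qed (rule antipode)
  fix x assume x: "x \<in> carrier ?Q" "counit ?Q x = {}"
  then obtain h where "h \<in> carrier H" "x = ?p h" unfolding surj[symmetric] by auto
  then show "x = \<bottom>\<^bsub>?Q\<^esub>" using x Q_counit quot_proj_eq_bottom_iff by simp
qed

end

section \<open>The group algebra on singletons\<close>

context
  fixes G :: "('g, 'm) monoid_scheme"
  assumes G: "group G"
begin

interpretation G: group G by (fact G)
interpretation A: suplat_hopf "group_algebra G" by (rule group_algebra_hopf[OF G])

lemma group_algebra_simps:
  "carrier (group_algebra G) = Pow (carrier G)" "eq (group_algebra G) = (=)" "le (group_algebra G) = (\<subseteq>)"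
  "hunit (group_algebra G) = {\<one>\<^bsub>G\<^esub>}" "antipode (group_algebra G) X = m_inv G ` X"
  "counit (group_algebra G) X = (if X = {} then {} else {()})"
  by (simp_all add: group_algebra_def powerset_order_def Let_def)

lemma group_algebra_order:
  "carrier (group_algebra G) = carrier (powerset_order (carrier G))"
  "eq (group_algebra G) = eq (powerset_order (carrier G))"
  "le (group_algebra G) = le (powerset_order (carrier G))"
  by (simp_all add: group_algebra_simps powerset_order_def)

lemma group_algebra_sup: "S \<subseteq> Pow (carrier G) \<Longrightarrow> \<Squnion>\<^bsub>group_algebra G\<^esub> S = \<Union> S"
  using same_order(1)[OF group_algebra_order] powerset_order_sup by metis

lemma group_algebra_coprod:
  assumes "g \<in> carrier G"
  shows "coprod (group_algebra G) {g} = pure_tensor (group_algebra G) (group_algebra G) {g} {g}"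
proof -
  let ?A = "group_algebra G"
  note T = tensor_same_order[OF group_algebra_order group_algebra_order]
  interpret T: complete_lattice "tensor ?A ?A" by (rule tensor_complete[OF A.complete A.complete])
  have "coprod ?A {g} = \<Squnion>\<^bsub>tensor ?A ?A\<^esub> {pure_tensor ?A ?A {g} {g}}"
    unfolding T by (simp add: group_algebra_def Let_def)
  also have "\<dots> = pure_tensor ?A ?A {g} {g}"
    using assms pure_tensor_closed[OF A.complete A.complete, of "{g}" "{g}"]
    by (intro T.sup_eqI) (auto simp: group_algebra_simps intro: T.le_refl)
  finally show ?thesis .
qed

text \<open>
  The elementwise product of subsets preserves unions in each variable, so it agrees on pairs with its
  extension to the tensor square.
\<close>

lemma group_algebra_mult:
  assumes "a \<in> carrier G" "b \<in> carrier G"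
  shows "hmult (group_algebra G) {a} {b} = {a \<otimes>\<^bsub>G\<^esub> b}"
proof -
  let ?A = "group_algebra G" and ?P = "powerset_order (carrier G)"
  have c: "A <#>\<^bsub>G\<^esub> B \<subseteq> carrier G" if "A \<subseteq> carrier G" "B \<subseteq> carrier G" for A B
    using that by (rule G.setmult_subset_G)
  have bim: "(\<lambda>A B. A <#>\<^bsub>G\<^esub> B) \<in> bimorphism ?A ?A ?A"
  proof (rule bimorphismI; rule suplat_homI[OF A.complete A.complete])
    fix l S assume l: "l \<in> carrier ?A" and S: "S \<subseteq> carrier ?A"
    then have "\<Squnion>\<^bsub>?A\<^esub> ((\<lambda>B. l <#>\<^bsub>G\<^esub> B) ` S) = \<Union> ((\<lambda>B. l <#>\<^bsub>G\<^esub> B) ` S)"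
      by (intro group_algebra_sup image_subsetI PowI c) (auto simp: group_algebra_simps)
    then show "l <#>\<^bsub>G\<^esub> (\<Squnion>\<^bsub>?A\<^esub> S) = \<Squnion>\<^bsub>?A\<^esub> ((\<lambda>B. l <#>\<^bsub>G\<^esub> B) ` S)"
      using S group_algebra_sup[of S] by (auto simp: group_algebra_simps set_mult_def)
    have "\<Squnion>\<^bsub>?A\<^esub> ((\<lambda>B. B <#>\<^bsub>G\<^esub> l) ` S) = \<Union> ((\<lambda>B. B <#>\<^bsub>G\<^esub> l) ` S)"
      using l S by (intro group_algebra_sup image_subsetI PowI c) (auto simp: group_algebra_simps)
    then show "(\<Squnion>\<^bsub>?A\<^esub> S) <#>\<^bsub>G\<^esub> l = \<Squnion>\<^bsub>?A\<^esub> ((\<lambda>B. B <#>\<^bsub>G\<^esub> l) ` S)"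
      using S group_algebra_sup[of S] by (auto simp: group_algebra_simps set_mult_def)
  qed (use c in \<open>auto simp: group_algebra_simps\<close>)
  have "hprod ?A = tensor_lift ?P (\<lambda>A B. A <#>\<^bsub>G\<^esub> B)"
    by (simp add: group_algebra_def Let_def)
  also have "\<dots> = tensor_lift ?A (\<lambda>A B. A <#>\<^bsub>G\<^esub> B)"
    unfolding tensor_lift_def same_order(1)[OF group_algebra_order] ..
  finally have "hmult ?A {a} {b} = {a} <#>\<^bsub>G\<^esub> {b}"
    unfolding hmult_def using assms
    by (simp add: tensor_lift_pure[OF A.complete A.complete A.complete bim] group_algebra_simps)
  then show ?thesis by (simp add: set_mult_def)
qed

end

section \<open>The group of invertible elements\<close>

definition multiplicative_monoid :: "('a, 'm) hopf_scheme \<Rightarrow> 'a monoid" where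
  "multiplicative_monoid H = \<lparr>carrier = carrier H, monoid.mult = hmult H, one = hunit H\<rparr>"

definition remnant :: "('a, 'm) hopf_scheme \<Rightarrow> 'a monoid" where
  "remnant H = units_of (multiplicative_monoid H)"

lemma (in suplat_hopf) multiplicative_monoid: "monoid (multiplicative_monoid H)"
  by (rule monoidI) (simp_all add: multiplicative_monoid_def hmult_closed unit_closed prod_assoc prod_unit)

lemma (in suplat_hopf) remnant_group: "group (remnant H)"
  unfolding remnant_def by (rule monoid.units_group[OF multiplicative_monoid])

lemma remnant_simps:
  "x \<otimes>\<^bsub>remnant H\<^esub> y = hmult H x y" "\<one>\<^bsub>remnant H\<^esub> = hunit H"
  "carrier (remnant H) = {u \<in> carrier H. \<exists>v \<in> carrier H. hmult H v u = hunit H \<and> hmult H u v = hunit H}"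
  by (auto simp: remnant_def multiplicative_monoid_def units_of_def Units_def)

section \<open>Hopf algebras in which only the bottom element has empty counit\<close>

locale faithful_counit_hopf = suplat_hopf H for H :: "('a, 'm) hopf_scheme" (structure) +
  assumes counit_faithful: "h \<in> carrier H \<Longrightarrow> counit H h = {} \<Longrightarrow> h = \<bottom>"
begin

interpretation L: complete_lattice H by (fact complete)

lemma counit_eq_empty_iff: "h \<in> carrier H \<Longrightarrow> counit H h = {} \<longleftrightarrow> h = \<bottom>"
  using counit_faithful counit_bottom by auto

lemma hmult_bottom_iff:
  assumes "a \<in> carrier H" "b \<in> carrier H"
  shows "hmult H a b = \<bottom> \<longleftrightarrow> a = \<bottom> \<or> b = \<bottom>"
  using counit_prod[OF assms] counit_two_valued hmult_closed assms counit_eq_empty_iff by metis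

lemma antipode_bottom_iff: "h \<in> carrier H \<Longrightarrow> antipode H h = \<bottom> \<longleftrightarrow> h = \<bottom>"
  using counit_antipode[of h] counit_eq_empty_iff suplat_homD(3)[OF antipode_hom] by metis

lemma unit_neq_bottom: "hunit H \<noteq> \<bottom>"
  using counit_unit counit_bottom by auto

lemma hmult_mono:
  assumes "a \<in> carrier H" "b \<in> carrier H" "a' \<in> carrier H" "b' \<in> carrier H" "a \<sqsubseteq> a'" "b \<sqsubseteq> b'"
  shows "hmult H a b \<sqsubseteq> hmult H a' b'"
proof -
  note m = bimorphismD[OF hmult_bimorphism[OF prod_hom complete]]
  have "hmult H a b \<sqsubseteq> hmult H a' b" by (rule suplat_hom_mono[OF m(2)]) fact+
  also have "hmult H a' b \<sqsubseteq> hmult H a' b'" by (rule suplat_hom_mono[OF m(1)]) fact+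
  finally show ?thesis using assms by (simp add: hmult_closed)
qed

text \<open>
  Evaluate the antipode axiom at the grouplike element $1$.
\<close>

lemma antipode_unit: "antipode H (hunit H) = hunit H"
proof -
  note u = unit_closed
  have "hmult H (hunit H) (antipode H (hunit H)) = hunit H"
    using antipode_right[OF u] tensor_map_props(2)[OF suplat_hom_id[OF complete] antipode_hom u u]
    by (simp add: coprod_unit counit_unit hmult_def)
  then show ?thesis using prod_unit(1) suplat_homD(3)[OF antipode_hom u] by simp
qed

text \<open>
  The antipode axiom writes $1$ as the join of the $a.S(b)$ with $(a,b) \le \Delta(x)$. If $a$ and $b$ are
  nonzero, then both are below $x \le 1$, so $S(b) \le S(1) = 1$ and $a.S(b) \le x$. Therefore $1 \le x$.
\<close>

lemma unit_atom:
  assumes x: "x \<in> carrier H" "x \<sqsubseteq> hunit H" "x \<noteq> \<bottom>"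
  shows "x = hunit H"
proof (rule L.le_antisym)
  note S = suplat_homD(3)[OF antipode_hom] and u = unit_closed
  have le: "hmult H a (antipode H b) \<sqsubseteq> x" if ab: "(a, b) \<in> coprod H x" for a b
  proof -
    have c: "a \<in> carrier H" "b \<in> carrier H" using coprod_sub[OF x(1)] ab by auto
    show ?thesis
    proof (cases "a = \<bottom> \<or> b = \<bottom>")
      case True
      then have "hmult H a (antipode H b) = \<bottom>"
        using c S by (simp add: hmult_bottom_iff antipode_bottom_iff)
      then show ?thesis using x by simp
    next
      case False
      then have "a \<sqsubseteq> x" "b \<sqsubseteq> x" using coprod_le[OF x(1) ab] c by (simp_all add: counit_eq_empty_iff)
      then have "b \<sqsubseteq> hunit H" using L.le_trans[of b x "hunit H"] x c u by simp
      then have "antipode H b \<sqsubseteq> hunit H"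
        using suplat_hom_mono[OF antipode_hom c(2) u] antipode_unit by simp
      then have "hmult H a (antipode H b) \<sqsubseteq> hmult H x (hunit H)"
        using \<open>a \<sqsubseteq> x\<close> c x u S by (intro hmult_mono) auto
      then show ?thesis using x prod_unit by simp
    qed
  qed
  have "hunit H = tensor_lift H (\<lambda>a b. hmult H a (antipode H b)) (coprod H x)"
    using convolution_expansion[OF x(1), of id "antipode H"] S antipode_right[OF x(1)] x
      counit_two_valued[OF x(1)] counit_eq_empty_iff[OF x(1)] by simp
  also have "\<dots> \<sqsubseteq> x"
    unfolding tensor_lift_def using le coprod_sub[OF x(1)] S x
    by (intro L.weak.sup_least) (auto intro!: hmult_closed)
  finally show "hunit H \<sqsubseteq> x" .
qed (use x unit_closed in auto)

text \<open>
  The product is nonzero, and the antipode axiom bounds it by the atom $1$.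
\<close>

lemma coprod_factor_inverse:
  assumes h: "h \<in> carrier H" and ab: "(a, b) \<in> coprod H h" "a \<noteq> \<bottom>" "b \<noteq> \<bottom>"
  shows "hmult H a (antipode H b) = hunit H"
proof (rule unit_atom)
  note S = suplat_homD(3)[OF antipode_hom] and u = unit_closed
  have c: "a \<in> carrier H" "b \<in> carrier H" using coprod_sub[OF h] ab by auto
  show cl: "hmult H a (antipode H b) \<in> carrier H" using c S by (simp add: hmult_closed)
  show "hmult H a (antipode H b) \<noteq> \<bottom>"
    using c S ab by (simp add: hmult_bottom_iff antipode_bottom_iff)
  let ?T = "tensor_lift H (\<lambda>a b. hmult H a (antipode H b)) (coprod H h)"
  have "?T = (if counit H h = {()} then hunit H else \<bottom>)"
    using convolution_expansion[OF h, of id "antipode H"] S antipode_right[OF h] by simp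
  then have T: "?T \<in> carrier H" "?T \<sqsubseteq> hunit H" using u by auto
  have "hmult H a (antipode H b) \<sqsubseteq> ?T"
    unfolding tensor_lift_def using coprod_sub[OF h] S ab
    by (intro L.weak.sup_upper) (auto intro!: hmult_closed)
  then show "hmult H a (antipode H b) \<sqsubseteq> hunit H" using L.le_trans[OF _ T(2) cl T(1) u] by simp
qed

text \<open>
  Otherwise the counit law would present \<open>h\<close> as a join of bottoms.
\<close>

lemma coprod_factor_exists:
  assumes h: "h \<in> carrier H" "h \<noteq> \<bottom>"
  obtains a b where "(a, b) \<in> coprod H h" "a \<noteq> \<bottom>" "b \<noteq> \<bottom>"
proof -
  have "\<exists>a b. (a, b) \<in> coprod H h \<and> a \<noteq> \<bottom> \<and> b \<noteq> \<bottom>"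
  proof (rule ccontr)
    assume "\<not> ?thesis"
    then have "(\<lambda>(a, b). if counit H a = {} then \<bottom> else b) ` coprod H h \<subseteq> {\<bottom>}"
      using coprod_sub[OF h(1)] counit_bottom by fastforce
    then have "tensor_lift H (\<lambda>a b. if counit H a = {} then \<bottom> else b) (coprod H h) = \<bottom>"
      unfolding tensor_lift_def by (intro L.sup_eqI) auto
    then show False using counit_expansion(1)[OF h(1)] h(2) by simp
  qed
  then show ?thesis using that by blast
qed

text \<open>
  The element $c = S(b)$ is a right inverse of $a$. A pair $(p,q)$ of nonzero entries in
  $\Delta(c)$ satisfies $p \le c$, so $a.p \le a.c = 1$ and thus $a.p = 1$, while $p.S(q) = 1$. Now $p$ has a left
  and a right inverse, so they coincide and $p.a = 1$.
\<close>

lemma coprod_factor_in_remnant: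
  assumes h: "h \<in> carrier H" and ab: "(a, b) \<in> coprod H h" "a \<noteq> \<bottom>" "b \<noteq> \<bottom>"
  shows "a \<in> carrier (remnant H)"
proof -
  note S = suplat_homD(3)[OF antipode_hom] and u = unit_closed
  have a: "a \<in> carrier H" and b: "b \<in> carrier H" using coprod_sub[OF h] ab by auto
  let ?c = "antipode H b"
  have c: "?c \<in> carrier H" "?c \<noteq> \<bottom>" "hmult H a ?c = hunit H"
    using S b ab coprod_factor_inverse[OF h ab] by (auto simp: antipode_bottom_iff)
  obtain p q where pq: "(p, q) \<in> coprod H ?c" "p \<noteq> \<bottom>" "q \<noteq> \<bottom>"
    using coprod_factor_exists c by metis
  have p: "p \<in> carrier H" and q: "q \<in> carrier H" "antipode H q \<in> carrier H"
    using coprod_sub[OF c(1)] pq S by auto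
  have "p \<sqsubseteq> ?c" using coprod_le(2)[OF c(1) pq(1)] q pq by (simp add: counit_eq_empty_iff)
  then have "hmult H a p \<sqsubseteq> hunit H" using hmult_mono[OF a p a c(1)] c(3) a by simp
  then have ap: "hmult H a p = hunit H"
    using a p ab pq by (intro unit_atom) (auto simp: hmult_bottom_iff hmult_closed)
  have pS: "hmult H p (antipode H q) = hunit H" by (rule coprod_factor_inverse[OF c(1) pq])
  have "a = hmult H a (hmult H p (antipode H q))" using pS prod_unit a by simp
  also have "\<dots> = antipode H q" using prod_assoc[OF a p q(2)] ap prod_unit q by simp
  finally have "hmult H p a = hunit H" using pS by simp
  then show ?thesis using ap a p by (auto simp: remnant_simps)
qed

lemma remnant_closed: "u \<in> carrier (remnant H) \<Longrightarrow> u \<in> carrier H"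
  by (simp add: remnant_simps)

lemma remnant_neq_bottom: "u \<in> carrier (remnant H) \<Longrightarrow> u \<noteq> \<bottom>"
  using unit_neq_bottom hmult_bottom_iff[of _ \<bottom>] by (auto simp: remnant_simps)

text \<open>
  Multiplying by the inverse of \<open>u\<close> moves \<open>x\<close> below the atom $1$.
\<close>

lemma remnant_atom:
  assumes u: "u \<in> carrier (remnant H)" and x: "x \<in> carrier H" "x \<sqsubseteq> u" "x \<noteq> \<bottom>"
  shows "x = u"
proof -
  obtain v where v: "v \<in> carrier H" "hmult H v u = hunit H" "hmult H u v = hunit H"
    and uc: "u \<in> carrier H" using u by (auto simp: remnant_simps)
  have "v \<noteq> \<bottom>" using v uc unit_neq_bottom hmult_bottom_iff by metis
  moreover have "hmult H x v \<sqsubseteq> hunit H" using hmult_mono[OF x(1) v(1) uc v(1)] v x by simp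
  ultimately have "hmult H x v = hunit H"
    using x v by (intro unit_atom) (auto simp: hmult_bottom_iff hmult_closed)
  then show ?thesis using prod_assoc[OF x(1) v(1) uc] v prod_unit x uc by simp
qed

text \<open>
  The counit law presents \<open>h\<close> as a join of first entries \<open>a\<close>, and the nonzero ones are
  invertible and below \<open>h\<close>.
\<close>

lemma sup_remnant_below:
  assumes h: "h \<in> carrier H"
  shows "\<Squnion> {u \<in> carrier (remnant H). u \<sqsubseteq> h} = h"
proof (rule L.le_antisym)
  let ?U = "{u \<in> carrier (remnant H). u \<sqsubseteq> h}"
  have U: "?U \<subseteq> carrier H" using remnant_closed by auto
  then show c: "\<Squnion> ?U \<in> carrier H" by simp
  show "\<Squnion> ?U \<sqsubseteq> h" using U h by (intro L.weak.sup_least) auto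
  have "(if counit H b = {} then \<bottom> else a) \<sqsubseteq> \<Squnion> ?U" if ab: "(a, b) \<in> coprod H h" for a b
  proof (cases "a = \<bottom> \<or> b = \<bottom>")
    case False
    have "a \<in> carrier H" "b \<in> carrier H" using ab coprod_sub[OF h] by auto
    then have "a \<sqsubseteq> h" using coprod_le(2)[OF h ab] False by (simp add: counit_eq_empty_iff)
    then have "a \<in> ?U" using coprod_factor_in_remnant[OF h ab] False by simp
    then have "a \<sqsubseteq> \<Squnion> ?U" by (rule L.weak.sup_upper[OF U])
    then show ?thesis using c by simp
  qed (use c counit_bottom in auto)
  then have "tensor_lift H (\<lambda>a b. if counit H b = {} then \<bottom> else a) (coprod H h) \<sqsubseteq> \<Squnion> ?U"
    unfolding tensor_lift_def using coprod_sub[OF h] c by (intro L.weak.sup_least) auto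
  then show "h \<sqsubseteq> \<Squnion> ?U" using counit_expansion(2)[OF h] by simp
qed (fact h)

text \<open>
  Both entries of a pair with nonzero entries are below the atom \<open>u\<close>, hence equal to it, and at least
  one such pair exists.
\<close>

lemma coprod_remnant:
  assumes u: "u \<in> carrier (remnant H)"
  shows "coprod H u = pure_tensor H H u u"
proof
  note uc = remnant_closed[OF u]
  have D: "bi_ideal H H (coprod H u)"
    using suplat_homD(3)[OF coprod_hom uc] by (simp add: tensor_def)
  have uu: "a = u \<and> b = u" if ab: "(a, b) \<in> coprod H u" "a \<noteq> \<bottom>" "b \<noteq> \<bottom>" for a b
  proof -
    have c: "a \<in> carrier H" "b \<in> carrier H" using ab coprod_sub[OF uc] by auto
    then show ?thesis
      using coprod_le[OF uc ab(1)] remnant_atom[OF u] ab by (auto simp: counit_eq_empty_iff)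
  qed
  obtain a b where "(a, b) \<in> coprod H u" "a \<noteq> \<bottom>" "b \<noteq> \<bottom>"
    by (rule coprod_factor_exists[OF uc remnant_neq_bottom[OF u]])
  then have "(u, u) \<in> coprod H u" using uu by blast
  then show "pure_tensor H H u u \<subseteq> coprod H u"
    using pure_tensor_least[OF complete complete D] by simp
  have P: "bi_ideal H H (pure_tensor H H u u)"
    by (rule pure_tensor_bi_ideal[OF complete complete uc uc])
  have s0: "\<Squnion> {} = \<bottom>" by (intro L.sup_eqI) auto
  show "coprod H u \<subseteq> pure_tensor H H u u"
  proof
    fix t assume t: "t \<in> coprod H u"
    obtain a b where ab: "t = (a, b)" by (cases t)
    have c: "a \<in> carrier H" "b \<in> carrier H" using t ab coprod_sub[OF uc] by auto
    consider "a = \<bottom>" | "b = \<bottom>" | "a = u" "b = u" using uu t ab by blast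
    then show "t \<in> pure_tensor H H u u"
    proof cases
      case 1
      then show ?thesis using bi_idealD(4)[OF P, of "{}" b] c ab s0 by simp
    next
      case 2
      then show ?thesis using bi_idealD(5)[OF P, of a "{}"] c ab s0 by simp
    next
      case 3
      then show ?thesis by (auto simp: ab pure_tensor_def)
    qed
  qed
qed

text \<open>
  A join of bottoms is bottom, and every other element is a join of invertible elements.
\<close>

lemma remnant_below_sup:
  assumes x: "x \<in> carrier (remnant H)" and A: "A \<subseteq> carrier H" and le: "x \<sqsubseteq> \<Squnion> A"
  obtains a w where "a \<in> A" "w \<in> carrier (remnant H)" "w \<sqsubseteq> a"
proof (rule ccontr)
  note xc = remnant_closed[OF x]
  have s0: "\<Squnion> {} = \<bottom>" by (intro L.sup_eqI) auto
  assume "\<not> thesis"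
  then have none: "{w \<in> carrier (remnant H). w \<sqsubseteq> a} = {}" if "a \<in> A" for a
    using \<open>a \<in> A\<close> \<open>\<And>a w. \<lbrakk>a \<in> A; w \<in> carrier (remnant H); w \<sqsubseteq> a\<rbrakk> \<Longrightarrow> thesis\<close> by blast
  have "a \<sqsubseteq> \<bottom>" if "a \<in> A" for a
  proof -
    have ac: "a \<in> carrier H" using A that by auto
    then have "\<bottom> = a" using sup_remnant_below[of a] none[OF that] s0 by simp
    then show ?thesis using L.le_refl[OF ac] by simp
  qed
  then have "\<Squnion> A \<sqsubseteq> \<bottom>" by (intro L.weak.sup_least[OF A]) simp_all
  then have "x \<sqsubseteq> \<bottom>" using L.le_trans[OF le _ xc] A by simp
  moreover have "\<bottom> \<sqsubseteq> x" using xc by simp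
  ultimately have "x = \<bottom>" using xc by (intro L.le_antisym) simp_all
  then show False using remnant_neq_bottom[OF x] by simp
qed

lemma le_remnant_of_units_eq:
  assumes a: "a \<in> carrier H" and k: "k \<in> carrier (remnant H)"
    and "\<And>w. w \<in> carrier (remnant H) \<Longrightarrow> w \<sqsubseteq> a \<Longrightarrow> w = k"
  shows "a \<sqsubseteq> k"
proof -
  note kc = remnant_closed[OF k]
  have "\<Squnion> {w \<in> carrier (remnant H). w \<sqsubseteq> a} \<sqsubseteq> k"
  proof (rule L.weak.sup_least)
    fix w assume "w \<in> {w \<in> carrier (remnant H). w \<sqsubseteq> a}"
    then have "w = k" using assms(3) by blast
    then show "w \<sqsubseteq> k" using L.le_refl[OF kc] by simp
  qed (use kc remnant_closed in auto)
  then show ?thesis using sup_remnant_below[OF a] by simp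
qed

text \<open>
  For a set $X$ of invertible elements this explicit set is the join of the $(x,x)$ with $x \in X$ in the
  tensor square; it is the bound used for the comultiplication of $\bigvee X$. The point is closure under
  joins in one variable: if all entries of a row are compatible with a fixed invertible $y$, then they,
  and so their join, are below $y$, and the only invertible element below the atom $y$ is $y$ itself.
\<close>

lemma diagonal_bi_ideal:
  shows "bi_ideal H H {(a, b). a \<in> carrier H \<and> b \<in> carrier H \<and>
    (\<forall>x \<in> carrier (remnant H). \<forall>y \<in> carrier (remnant H). x \<sqsubseteq> a \<longrightarrow> y \<sqsubseteq> b \<longrightarrow> x = y \<and> x \<in> X)}"
    (is "bi_ideal H H ?V")
proof (rule bi_idealI)
  note rc = remnant_closed
  \<comment> \<open>One argument serves rows and columns, because the conclusion is symmetric in \<open>x\<close> and \<open>y\<close>.\<close>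
  have row: "x = y \<and> x \<in> X"
    if A: "A \<subseteq> carrier H" and x: "x \<in> carrier (remnant H)" "x \<sqsubseteq> \<Squnion> A" and y: "y \<in> carrier (remnant H)"
      and eq: "\<And>a w. a \<in> A \<Longrightarrow> w \<in> carrier (remnant H) \<Longrightarrow> w \<sqsubseteq> a \<Longrightarrow> w = y \<and> y \<in> X"
    for A x y
  proof -
    obtain a w where "a \<in> A" "w \<in> carrier (remnant H)" "w \<sqsubseteq> a"
      by (rule remnant_below_sup[OF x(1) A x(2)])
    then have "y \<in> X" using eq by blast
    have "\<Squnion> A \<sqsubseteq> y"
    proof (rule L.weak.sup_least[OF A rc[OF y]])
      fix a assume "a \<in> A"
      then show "a \<sqsubseteq> y" using A eq by (intro le_remnant_of_units_eq[OF _ y]) blast+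
    qed
    then have "x \<sqsubseteq> y" using L.le_trans[OF x(2)] rc x(1) y A by simp
    then have "x = y" using remnant_atom[OF y rc[OF x(1)]] remnant_neq_bottom[OF x(1)] by simp
    then show ?thesis using \<open>y \<in> X\<close> by simp
  qed
  have mono: "x \<sqsubseteq> b" if "x \<in> carrier (remnant H)" "a \<in> carrier H" "b \<in> carrier H" "x \<sqsubseteq> a" "a \<sqsubseteq> b" for x a b
    using L.le_trans[OF that(4,5) rc[OF that(1)] that(2,3)] .
  have V: "(a, b) \<in> ?V \<longleftrightarrow> a \<in> carrier H \<and> b \<in> carrier H \<and>
    (\<forall>x \<in> carrier (remnant H). \<forall>y \<in> carrier (remnant H). x \<sqsubseteq> a \<longrightarrow> y \<sqsubseteq> b \<longrightarrow> x = y \<and> x \<in> X)" for a b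
    unfolding mem_Collect_eq prod.case ..
  show "(\<Squnion> A, m) \<in> ?V"
    if A: "A \<subseteq> carrier H" "m \<in> carrier H" "\<And>a. a \<in> A \<Longrightarrow> (a, m) \<in> ?V" for A m
    unfolding V
  proof (intro conjI[OF _ conjI] ballI impI)
    fix x y assume xy: "x \<in> carrier (remnant H)" "y \<in> carrier (remnant H)" "x \<sqsubseteq> \<Squnion> A" "y \<sqsubseteq> m"
    show "x = y \<and> x \<in> X"
      by (rule row[OF A(1) xy(1,3,2)]) (use A(3)[unfolded V] xy(2,4) in blast)
  qed (use A(1,2) in auto)
  show "(l, \<Squnion> B) \<in> ?V"
    if B: "l \<in> carrier H" "B \<subseteq> carrier H" "\<And>b. b \<in> B \<Longrightarrow> (l, b) \<in> ?V" for l B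
    unfolding V
  proof (intro conjI[OF _ conjI] ballI impI)
    fix x y assume xy: "x \<in> carrier (remnant H)" "y \<in> carrier (remnant H)" "x \<sqsubseteq> l" "y \<sqsubseteq> \<Squnion> B"
    have "y = x \<and> y \<in> X"
      by (rule row[OF B(2) xy(2,4,1)]) (use B(3)[unfolded V] xy(1,3) in blast)
    then show "x = y \<and> x \<in> X" by blast
  qed (use B(1,2) in auto)
  show "l \<in> carrier H \<and> m \<in> carrier H" if "(l, m) \<in> ?V" for l m using that unfolding V by blast
  show "(l', m') \<in> ?V"
    if "(l, m) \<in> ?V" "l' \<in> carrier H" "m' \<in> carrier H" "l' \<sqsubseteq> l" "m' \<sqsubseteq> m" for l m l' m'
    using that unfolding V by (blast intro: mono)
qed

section \<open>Independence of the invertible elements\<close>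

text \<open>
  From $u \le \bigvee X$ it follows that $(u,u) = \Delta(u) \le \Delta(\bigvee X)$, and the right-hand side is the join of the
  $(x,x)$ with $x \in X$, which lies in the diagonal of $X$.
\<close>

lemma remnant_sup_prime:
  assumes u: "u \<in> carrier (remnant H)" and X: "X \<subseteq> carrier (remnant H)" and le: "u \<sqsubseteq> \<Squnion> X"
  shows "u \<in> X"
proof -
  interpret T: complete_lattice "tensor H H" by (rule tensor_complete[OF complete complete])
  have XH: "X \<subseteq> carrier H" using X remnant_closed by auto
  define V where "V = {(a, b). a \<in> carrier H \<and> b \<in> carrier H \<and>
    (\<forall>x \<in> carrier (remnant H). \<forall>y \<in> carrier (remnant H). x \<sqsubseteq> a \<longrightarrow> y \<sqsubseteq> b \<longrightarrow> x = y \<and> x \<in> X)}"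
  have V: "bi_ideal H H V" unfolding V_def by (rule diagonal_bi_ideal)
  have "coprod H x \<subseteq> V" if x: "x \<in> X" for x
  proof -
    have xR: "x \<in> carrier (remnant H)" using x X by auto
    have atom: "y = x" if "y \<in> carrier (remnant H)" "y \<sqsubseteq> x" for y
      using remnant_atom[OF xR remnant_closed[OF that(1)] that(2) remnant_neq_bottom[OF that(1)]] .
    have "(x, x) \<in> V"
      unfolding V_def mem_Collect_eq prod.case
    proof (intro conjI[OF _ conjI] ballI impI)
      fix y z
      assume yz: "y \<in> carrier (remnant H)" "z \<in> carrier (remnant H)" "y \<sqsubseteq> x" "z \<sqsubseteq> x"
      show "y = z \<and> y \<in> X" using atom[OF yz(1,3)] atom[OF yz(2,4)] x by blast
    qed (rule remnant_closed[OF xR])+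
    then show ?thesis
      unfolding coprod_remnant[OF xR] pure_tensor_least[OF complete complete V] .
  qed
  then have "\<Squnion>\<^bsub>tensor H H\<^esub> (coprod H ` X) \<sqsubseteq>\<^bsub>tensor H H\<^esub> V"
    using V XH suplat_homD(3)[OF coprod_hom]
    by (intro T.weak.sup_least) (auto simp: tensor_def)
  then have "coprod H (\<Squnion> X) \<subseteq> V"
    using suplat_homD(4)[OF coprod_hom XH] by (simp add: tensor_def)
  moreover have "coprod H u \<subseteq> coprod H (\<Squnion> X)"
    using suplat_hom_mono[OF coprod_hom remnant_closed[OF u] _ le] XH by (simp add: tensor_def)
  moreover have "(u, u) \<in> coprod H u"
    unfolding coprod_remnant[OF u] by (auto simp: pure_tensor_def)
  ultimately have "(u, u) \<in> V" by blast
  then show ?thesis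
    unfolding V_def mem_Collect_eq prod.case using u L.le_refl[OF remnant_closed[OF u]] by blast
qed

text \<open>
  The grouplike element \<open>u\<close> has the right inverse $S(u)$ by the antipode axiom, and inverses are unique.
\<close>

lemma antipode_remnant:
  assumes u: "u \<in> carrier (remnant H)"
  shows "antipode H u = inv\<^bsub>remnant H\<^esub> u"
proof -
  interpret R: group "remnant H" by (rule remnant_group)
  note uc = remnant_closed[OF u] and S = suplat_homD(3)[OF antipode_hom remnant_closed[OF u]]
  have ic: "inv\<^bsub>remnant H\<^esub> u \<in> carrier H" using remnant_closed u by simp
  have "(u, u) \<in> coprod H u" unfolding coprod_remnant[OF u] by (auto simp: pure_tensor_def)
  then have r: "hmult H u (antipode H u) = hunit H"
    using coprod_factor_inverse[OF uc] remnant_neq_bottom[OF u] by simp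
  have l: "hmult H (inv\<^bsub>remnant H\<^esub> u) u = hunit H"
    using R.l_inv[OF u] by (simp add: remnant_simps)
  have "antipode H u = hmult H (hmult H (inv\<^bsub>remnant H\<^esub> u) u) (antipode H u)"
    using l prod_unit S by simp
  also have "\<dots> = inv\<^bsub>remnant H\<^esub> u" using prod_assoc[OF ic uc S] r prod_unit ic by simp
  finally show ?thesis .
qed

lemma sup_group_algebra_hom: "(\<lambda>X. \<Squnion> X) \<in> suplat_hom (group_algebra (remnant H)) H"
proof (rule suplat_homI[OF suplat_hopf.complete[OF group_algebra_hopf[OF remnant_group]] complete])
  note GA = group_algebra_simps[OF remnant_group]
  have sub: "X \<subseteq> carrier H" if "X \<in> Pow (carrier (remnant H))" for X using that remnant_closed by auto
  show "\<Squnion> X \<in> carrier H" if "X \<in> carrier (group_algebra (remnant H))" for X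
    using sub that by (simp add: GA)
  fix A assume A': "A \<subseteq> carrier (group_algebra (remnant H))"
  then have A: "A \<subseteq> Pow (carrier (remnant H))" by (simp add: GA)
  have U: "\<Union> A \<subseteq> carrier H" by (intro Union_least sub subsetD[OF A])
  have s: "(\<lambda>X. \<Squnion> X) ` A \<subseteq> carrier H"
    by (intro image_subsetI L.weak.sup_closed sub subsetD[OF A])
  have c: "\<Squnion> ((\<lambda>X. \<Squnion> X) ` A) \<in> carrier H" using s by simp
  have iff: "\<Squnion> ((\<lambda>X. \<Squnion> X) ` A) \<sqsubseteq> y \<longleftrightarrow> (\<forall>x \<in> \<Union> A. x \<sqsubseteq> y)" if y: "y \<in> carrier H" for y
  proof -
    have "\<Squnion> X \<sqsubseteq> y \<longleftrightarrow> (\<forall>x \<in> X. x \<sqsubseteq> y)" if "X \<in> A" for X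
      by (rule L.sup_le_iff[OF sub[OF subsetD[OF A that]] y])
    then show ?thesis using L.sup_le_iff[OF s y] by simp
  qed
  have "\<Squnion> (\<Union> A) = \<Squnion> ((\<lambda>X. \<Squnion> X) ` A)"
  proof (rule L.sup_eqI[OF U c])
    show "x \<sqsubseteq> \<Squnion> ((\<lambda>X. \<Squnion> X) ` A)" if "x \<in> \<Union> A" for x
      using iff[OF c] L.le_refl[OF c] that by blast
    show "\<Squnion> ((\<lambda>X. \<Squnion> X) ` A) \<sqsubseteq> y" if "y \<in> carrier H" "\<And>x. x \<in> \<Union> A \<Longrightarrow> x \<sqsubseteq> y" for y
      using iff[OF that(1)] that(2) by blast
  qed
  then show "\<Squnion> (\<Squnion>\<^bsub>group_algebra (remnant H)\<^esub> A) = \<Squnion> ((\<lambda>X. \<Squnion> X) ` A)"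
    using group_algebra_sup[OF remnant_group A] by simp
qed

text \<open>
  All compatibility conditions are equations between maps preserving joins (in each variable), so it is
  enough to compare them on singletons.
\<close>

lemma sup_group_algebra_hopf_hom: "(\<lambda>X. \<Squnion> X) \<in> hopf_hom (group_algebra (remnant H)) H"
proof -
  let ?A = "group_algebra (remnant H)" and ?e = "\<lambda>X. \<Squnion> X"
  interpret R: group "remnant H" by (rule remnant_group)
  interpret A: suplat_hopf ?A by (rule group_algebra_hopf[OF remnant_group])
  note GA = group_algebra_simps[OF remnant_group]
  note e = sup_group_algebra_hom
  note ee = tensor_map_props[OF e e]
  have sing: "\<Squnion> {u} = u" if "u \<in> carrier (remnant H)" for u
    using remnant_closed[OF that] by simp
  have ext: "f X = g X"
    if "f \<in> suplat_hom ?A K" "g \<in> suplat_hom ?A K" "\<And>u. u \<in> carrier (remnant H) \<Longrightarrow> f {u} = g {u}"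
      "X \<in> carrier ?A" for f g X and K :: "('z, 'y) gorder_scheme"
    using hom_powerset_eq[OF that(1,2) GA(1,2,3) that(3)] that(4) by (simp add: GA)
  note mA = bimorphismD[OF hmult_bimorphism[OF A.prod_hom A.complete]]
  note mH = bimorphismD[OF hmult_bimorphism[OF prod_hom complete]]
  have mult: "?e (hmult ?A X Y) = hmult H (?e X) (?e Y)" if X: "X \<in> carrier ?A" and Y: "Y \<in> carrier ?A" for X Y
  proof (rule ext[OF suplat_hom_comp[OF mA(2)[OF Y] e] suplat_hom_comp[OF e mH(2)[OF suplat_homD(3)[OF e Y]]] _ X])
    fix u assume u: "u \<in> carrier (remnant H)"
    then have u': "{u} \<in> carrier ?A" by (simp add: GA)
    show "?e (hmult ?A {u} Y) = hmult H (?e {u}) (?e Y)"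
    proof (rule ext[OF suplat_hom_comp[OF mA(1)[OF u'] e] suplat_hom_comp[OF e mH(1)[OF suplat_homD(3)[OF e u']]] _ Y])
      fix v assume v: "v \<in> carrier (remnant H)"
      show "?e (hmult ?A {u} {v}) = hmult H (?e {u}) (?e {v})"
        using sing[OF R.m_closed[OF u v]]
        by (simp add: group_algebra_mult[OF remnant_group u v] sing u v remnant_simps(1))
    qed
  qed
  show ?thesis
    unfolding hopf_hom_def mem_Collect_eq
  proof (intro conjI ballI)
    show "?e \<in> suplat_hom ?A H" by (rule e)
    show "?e (hunit ?A) = hunit H" using sing[OF R.one_closed] by (simp add: GA remnant_simps(2))
    show "?e (hprod ?A t) = hprod H (tensor_map H H ?e ?e t)" if t: "t \<in> carrier (tensor ?A ?A)" for t
      by (rule tensor_hom_ext[OF A.complete A.complete suplat_hom_comp[OF A.prod_hom e]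
            suplat_hom_comp[OF ee(1) prod_hom] _ t])
        (simp add: ee(2) mult[unfolded hmult_def])
    fix X assume X: "X \<in> carrier ?A"
    show "coprod H (?e X) = tensor_map H H ?e ?e (coprod ?A X)"
    proof (rule ext[OF suplat_hom_comp[OF e coprod_hom] suplat_hom_comp[OF A.coprod_hom ee(1)] _ X])
      fix u assume u: "u \<in> carrier (remnant H)"
      then show "coprod H (?e {u}) = tensor_map H H ?e ?e (coprod ?A {u})"
        by (simp add: sing coprod_remnant group_algebra_coprod[OF remnant_group] ee(2) GA)
    qed
    show "counit H (?e X) = counit ?A X"
    proof (rule ext[OF suplat_hom_comp[OF e counit_hom] A.counit_hom _ X])
      fix u assume u: "u \<in> carrier (remnant H)"
      show "counit H (?e {u}) = counit ?A {u}"
        using sing[OF u] remnant_neq_bottom[OF u] counit_two_valued[OF remnant_closed[OF u]]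
          counit_eq_empty_iff[OF remnant_closed[OF u]] by (simp add: GA)
    qed
    show "antipode H (?e X) = ?e (antipode ?A X)"
    proof (rule ext[OF suplat_hom_comp[OF e antipode_hom] suplat_hom_comp[OF A.antipode_hom e] _ X])
      fix u assume u: "u \<in> carrier (remnant H)"
      show "antipode H (?e {u}) = ?e (antipode ?A {u})"
        using sing[OF R.inv_closed[OF u]] by (simp add: sing[OF u] antipode_remnant[OF u] GA)
    qed
  qed
qed

text \<open>
  The inverse sends \<open>h\<close> to the set of invertible elements below it. One composite is the identity
  because these elements generate, the other because they are independent.
\<close>

theorem isomorphic_group_algebra_remnant: "hopf_isomorphic H (group_algebra (remnant H))"
proof -
  let ?A = "group_algebra (remnant H)"
  let ?g = "\<lambda>h. {u \<in> carrier (remnant H). u \<sqsubseteq> h}"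
  note GA = group_algebra_simps[OF remnant_group] and A = group_algebra_hopf[OF remnant_group]
  have g: "?g h \<in> carrier ?A" for h by (auto simp: GA)
  have gf: "?g (\<Squnion> X) = X" if "X \<in> carrier ?A" for X
  proof -
    have X: "X \<subseteq> carrier (remnant H)" "X \<subseteq> carrier H" using that remnant_closed by (auto simp: GA)
    show ?thesis
    proof (intro equalityI subsetI)
      fix u assume "u \<in> ?g (\<Squnion> X)"
      then show "u \<in> X" using remnant_sup_prime[OF _ X(1)] by simp
    next
      fix u assume "u \<in> X"
      then show "u \<in> ?g (\<Squnion> X)" using X(1) L.weak.sup_upper[OF X(2)] by auto
    qed
  qed
  have "?g \<in> hopf_hom H ?A"
    by (rule hopf_hom_inverse[OF sup_group_algebra_hopf_hom A suplat_hopf_axioms g gf sup_remnant_below])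
  then show ?thesis
    unfolding hopf_isomorphic_def
    by (intro conjI suplat_hopf_axioms A bexI[OF _ \<open>?g \<in> _\<close>] bexI[OF _ sup_group_algebra_hopf_hom]
        ballI gf sup_remnant_below)
qed

end

section \<open>The remnant theorem\<close>

theorem corollary3p7:
  fixes H :: "('a, 'm) hopf_scheme"
  assumes "suplat_hopf H"
  shows "\<exists>R :: 'a set monoid. group R \<and> hopf_isomorphic (quot_hopf H) (group_algebra R)"
proof -
  interpret H: suplat_hopf H by (fact assms)
  interpret Q: faithful_counit_hopf "quot_hopf H"
    by (intro faithful_counit_hopf.intro faithful_counit_hopf_axioms.intro H.quot_hopf_hopf)
  show ?thesis using Q.remnant_group Q.isomorphic_group_algebra_remnant by blast
qed

end
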